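(* Let $K=\mathbb{Q}(i,\sqrt5)$. Up to isomorphism over $K$ there is exactly one elliptic curve $E$ over $K$ with $E(K)_{\mathrm{tors}}\cong\mathbb{Z}/15\mathbb{Z}$, and for this curve $E(K)$ has positive rank.
   Context: $E(K)_{\mathrm{tors}}$ is the torsion subgroup of the Mordell--Weil group $E(K)$; the rank is the rank of the finitely generated abelian group $E(K)$. *)

theory Defs
  imports
    Complex_Main
    "HOL-Library.Extended_Nat"
    "HOL-Algebra.Elementary_Groups"
    "HOL-Algebra.Generated_Fields"
    "HOL-Algebra.Algebraic_Closure_Type"
begin

definition QQ_i_sqrt5 :: "complex set" where
  "QQ_i_sqrt5 = generate_field ring_of_type_algebra {\<i>, complex_of_real (sqrt 5)}"

text \<open>A field of definition is represented by its underlying subset \<open>K\<close> of an ambient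
  field of characteristic zero.  An elliptic curve over \<open>K\<close> is a nonsingular Weierstrass cubic
  \<open>y\<^sup>2 + a1 x y + a3 y = x\<^sup>3 + a2 x\<^sup>2 + a4 x + a6\<close> with coefficients in \<open>K\<close>, whose base point is
  the point at infinity.\<close>

record 'a weierstrass =
  a1 :: 'a
  a2 :: 'a
  a3 :: 'a
  a4 :: 'a
  a6 :: 'a

definition weierstrass_eval :: "'a::field weierstrass \<Rightarrow> 'a \<Rightarrow> 'a \<Rightarrow> 'a" where
  "weierstrass_eval E x y =
     y ^ 2 + a1 E * x * y + a3 E * y - (x ^ 3 + a2 E * x ^ 2 + a4 E * x + a6 E)"

definition discriminant :: "'a::field weierstrass \<Rightarrow> 'a" where
  "discriminant E =
    (let b2 = a1 E ^ 2 + 4 * a2 E;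
         b4 = 2 * a4 E + a1 E * a3 E;
         b6 = a3 E ^ 2 + 4 * a6 E;
         b8 = a1 E ^ 2 * a6 E + 4 * a2 E * a6 E - a1 E * a3 E * a4 E + a2 E * a3 E ^ 2 - a4 E ^ 2
     in - (b2 ^ 2) * b8 - 8 * b4 ^ 3 - 27 * b6 ^ 2 + 9 * b2 * b4 * b6)"

definition elliptic_curve_over :: "'a::field set \<Rightarrow> 'a weierstrass \<Rightarrow> bool" where
  "elliptic_curve_over K E \<longleftrightarrow> {a1 E, a2 E, a3 E, a4 E, a6 E} \<subseteq> K \<and> discriminant E \<noteq> 0"

text \<open>Isomorphism over \<open>K\<close> (as curves with base point) is given by an admissible change of variables
  \<open>x = u\<^sup>2 x' + r\<close>, \<open>y = u\<^sup>3 y' + u\<^sup>2 s x' + t\<close> over \<open>K\<close> that turns the equation of \<open>E\<close> into \<open>u\<^sup>6\<close>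
  times that of \<open>E'\<close>.  The ambient field is infinite, so the identity of functions below is the
  identity of polynomials in \<open>x'\<close> and \<open>y'\<close>.\<close>

definition isomorphic_over ::
    "'a::field_char_0 set \<Rightarrow> 'a weierstrass \<Rightarrow> 'a weierstrass \<Rightarrow> bool" where
  "isomorphic_over K E E' \<longleftrightarrow>
    (\<exists>u\<in>K. \<exists>r\<in>K. \<exists>s\<in>K. \<exists>t\<in>K. u \<noteq> 0 \<and>
      (\<forall>x y. weierstrass_eval E (u ^ 2 * x + r) (u ^ 3 * y + u ^ 2 * s * x + t)
             = u ^ 6 * weierstrass_eval E' x y))"

datatype 'a point = Infinity | Affine 'a 'a

text \<open>The chord-and-tangent law.  In the first affine case the two points are negatives of each
  other; otherwise \<open>l\<close> is the slope of the chord, or of the tangent when the points coincide.\<close>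

fun point_add :: "'a::field weierstrass \<Rightarrow> 'a point \<Rightarrow> 'a point \<Rightarrow> 'a point" where
  "point_add E Infinity Q = Q"
| "point_add E P Infinity = P"
| "point_add E (Affine x1 y1) (Affine x2 y2) =
    (if x1 = x2 \<and> y2 = - y1 - a1 E * x1 - a3 E then Infinity
     else
       let l = (if x1 = x2
                then (3 * x1 ^ 2 + 2 * a2 E * x1 + a4 E - a1 E * y1) / (2 * y1 + a1 E * x1 + a3 E)
                else (y2 - y1) / (x2 - x1));
           x3 = l ^ 2 + a1 E * l - a2 E - x1 - x2
       in Affine x3 (- (y1 + l * (x3 - x1)) - a1 E * x3 - a3 E))"

definition mordell_weil_group :: "'a::field set \<Rightarrow> 'a weierstrass \<Rightarrow> 'a point monoid" where
  "mordell_weil_group K E =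
     \<lparr>carrier = insert Infinity {Affine x y | x y. x \<in> K \<and> y \<in> K \<and> weierstrass_eval E x y = 0},
      monoid.mult = point_add E,
      one = Infinity\<rparr>"

definition torsion_subgroup :: "('a, 'b) monoid_scheme \<Rightarrow> ('a, 'b) monoid_scheme" where
  "torsion_subgroup G = G\<lparr>carrier := {x \<in> carrier G. \<exists>n::nat. n > 0 \<and> x [^]\<^bsub>G\<^esub> n = \<one>\<^bsub>G\<^esub>}\<rparr>"

text \<open>The rank of an abelian group (written multiplicatively) is the supremum of the sizes of its
  finite \<open>\<int>\<close>-linearly independent subsets; for \<open>\<int>\<^sup>r \<times> T\<close> with \<open>T\<close> finite it is \<open>r\<close>.\<close>

definition int_independent :: "('a, 'b) monoid_scheme \<Rightarrow> 'a set \<Rightarrow> bool" where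
  "int_independent G S \<longleftrightarrow>
     (\<forall>k :: 'a \<Rightarrow> int. (\<Otimes>\<^bsub>G\<^esub>x\<in>S. x [^]\<^bsub>G\<^esub> k x) = \<one>\<^bsub>G\<^esub> \<longrightarrow> (\<forall>x\<in>S. k x = 0))"

definition abelian_rank :: "('a, 'b) monoid_scheme \<Rightarrow> enat" where
  "abelian_rank G = Sup {enat (card S) | S. finite S \<and> S \<subseteq> carrier G \<and> int_independent G S}"

end

theory Submission
  imports Defs "HOL-Computational_Algebra.Squarefree" "HOL-Computational_Algebra.Nth_Powers"
begin

text \<open>An elliptic curve with a point of order 15 is given by a non-cuspidal point of the modular curve
  \<open>X\<^sub>1(15)\<close>. Kubert's normal form, with the points \<open>4 O\<close>, \<open>5 O\<close>, \<open>6 O\<close> on a line, leads to the model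
  \<open>J: y\<^sup>2 + x y + y = x\<^sup>3 + x\<^sup>2\<close>. The action of complex conjugation and of \<open>sqrt 5 \<mapsto> - sqrt 5\<close>
  on \<open>J(K)\<close> writes \<open>4 P\<close> as a sum of rational points of the twists of \<open>J\<close> by 1, -1, 5 and -5. On each twist a
  2-descent shows that every point is a 4-torsion point plus twice a point; since duplication strictly
  decreases the 2-adic valuation of \<open>x\<close> in the kernel of reduction, \<open>J(K)\<close> is torsion, and reduction at
  the prime above 2 leaves its eight known points. The four that are not cusps all give the
  isomorphism class of \<open>E0: y\<^sup>2 + x y + y = x\<^sup>3 + x\<^sup>2 - 3 x + 1\<close>. Reduction at a prime above 3 determines the
  torsion of \<open>E0(K)\<close>, to which \<open>(-5, 2 + 4 i sqrt 5)\<close> does not belong.\<close>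

section \<open>The group law on a Weierstrass cubic\<close>

text \<open>Arithmetic in K takes place in the type \<open>kf\<close> of rational coordinate
  vectors, where identities between explicit points are decided by simplification; the complex
  numbers enter only through the embedding \<open>kf_complex\<close> at the end. Reduction modulo a
  prime is never a map: congruences of coordinates and the set of points whose abscissa has negative
  valuation replace the reduced curve and the kernel of reduction. Heights and finite generation of
  J(K) are avoided: on each twist P = S + 2 Q with 4 S = 0, so 8 P is 2^n times some 8 Q_n for every
  n; since 8 Q_n reduces to infinity, a nonzero 8 P would have arbitrarily negative valuation. Hence
  8 annihilates each twist and 32 annihilates J(K). The primes are matched to the torsion: J has
  just eight points over the field with four elements, E0 just 15 over the field with nine, and
  known points reach all of them. The multiples 4, 5 and 6 are used because they add up to
  15.\<close>

definition on_curve :: "'a::field weierstrass \<Rightarrow> 'a point \<Rightarrow> bool" where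
  "on_curve E P \<longleftrightarrow> (case P of Infinity \<Rightarrow> True | Affine x y \<Rightarrow> weierstrass_eval E x y = 0)"

lemma on_curve_simps [simp]:
  "on_curve E Infinity" "on_curve E (Affine x y) \<longleftrightarrow> weierstrass_eval E x y = 0"
  by (simp_all add: on_curve_def)

fun point_neg :: "'a::field weierstrass \<Rightarrow> 'a point \<Rightarrow> 'a point" where
  "point_neg E Infinity = Infinity"
| "point_neg E (Affine x y) = Affine x (- y - a1 E * x - a3 E)"

text \<open>The two equations characterise the slope of the chord and of the tangent simultaneously:
  the second one is the first one multiplied by the conjugate factor and divided by
  \<open>x2 - x1\<close> with the help of the equation of the curve.\<close>

definition is_slope :: "'a::field weierstrass \<Rightarrow> 'a \<Rightarrow> 'a \<Rightarrow> 'a \<Rightarrow> 'a \<Rightarrow> 'a \<Rightarrow> bool" where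
  "is_slope E l x1 y1 x2 y2 \<longleftrightarrow> l * (x2 - x1) = y2 - y1 \<and>
     l * (y1 + y2 + a1 E * x2 + a3 E)
       = x1 ^ 2 + x1 * x2 + x2 ^ 2 + a2 E * (x1 + x2) + a4 E - a1 E * y1"

definition third_x :: "'a::field weierstrass \<Rightarrow> 'a \<Rightarrow> 'a \<Rightarrow> 'a \<Rightarrow> 'a" where
  "third_x E l x1 x2 = l ^ 2 + a1 E * l - a2 E - x1 - x2"

definition chord_sum :: "'a::field weierstrass \<Rightarrow> 'a \<Rightarrow> 'a \<Rightarrow> 'a \<Rightarrow> 'a \<Rightarrow> 'a point" where
  "chord_sum E l x1 y1 x2 = Affine (third_x E l x1 x2)
     (- (y1 + l * (third_x E l x1 x2 - x1)) - a1 E * third_x E l x1 x2 - a3 E)"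

text \<open>The three conditions are linear in \<open>c3\<close>, \<open>c4\<close> and
  \<open>c6\<close>. Eliminating these makes b4, b6, b8 polynomials in b2 and x alone, for which the
  discriminant cancels. No division by 2 or 3 occurs, so the characteristic is arbitrary.\<close>

lemma singular_poly:
  fixes x y c1 c2 c3 c4 c6 :: "'a::field"
  assumes "y^2 + c1*x*y + c3*y - (x^3 + c2*x^2 + c4*x + c6) = 0"
    "2*y + c1*x + c3 = 0" "3*x^2 + 2*c2*x + c4 - c1*y = 0"
    "b2 = c1^2+4*c2" "b4 = 2*c4+c1*c3" "b6 = c3^2+4*c6"
    "b8 = c1^2*c6+4*c2*c6-c1*c3*c4+c2*c3^2-c4^2"
  shows "- (b2 ^ 2) * b8 - 8 * b4 ^ 3 - 27 * b6 ^ 2 + 9 * b2 * b4 * b6 = 0"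
proof -
  have c3: "c3 = - 2*y - c1*x" and c4: "c4 = c1*y - 3*x^2 - 2*c2*x"
    using assms(2,3) by Groebner_Basis.algebra+
  have c6: "c6 = 2*x^3 + c2*x^2 - c1*x*y - y^2"
    using assms(1) unfolding c3 c4 by Groebner_Basis.algebra
  have b4: "b4 = - (b2*x) - 6*x^2" unfolding assms(5,4) c4 c3 by Groebner_Basis.algebra
  have b6: "b6 = b2*x^2 + 8*x^3" unfolding assms(6,4) c6 c3 by Groebner_Basis.algebra
  have b8: "b8 = - (b2*x^3) - 9*x^4" unfolding assms(7,4) c6 c4 c3 by Groebner_Basis.algebra
  show ?thesis unfolding b4 b6 b8 by Groebner_Basis.algebra
qed

lemma nonsingular:
  fixes x y :: "'a::field"
  assumes "weierstrass_eval E x y = 0" "2*y + a1 E*x + a3 E = 0"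
    "3*x^2 + 2*a2 E*x + a4 E - a1 E*y = 0"
  shows "discriminant E = 0"
  using assms singular_poly[of y "a1 E" x "a3 E" "a2 E" "a4 E" "a6 E", OF _ _ _ refl refl refl refl]
  unfolding weierstrass_eval_def discriminant_def Let_def by blast

lemma same_x_poly:
  fixes x y1 y2 c1 c2 c3 c4 c6 :: "'a::field"
  assumes "y1^2 + c1*x*y1 + c3*y1 - (x^3 + c2*x^2 + c4*x + c6) = 0"
    "y2^2 + c1*x*y2 + c3*y2 - (x^3 + c2*x^2 + c4*x + c6) = 0" "y2 \<noteq> - y1 - c1*x - c3"
  shows "y1 = y2"
proof -
  have "(y1 - y2) * (y2 + y1 + c1*x + c3) = 0" using assms(1,2) by Groebner_Basis.algebra
  moreover have "y2 + y1 + c1*x + c3 \<noteq> 0" using assms(3) by Groebner_Basis.algebra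
  ultimately show ?thesis by simp
qed

lemma chord_poly:
  fixes x1 x2 y1 y2 c1 c2 c3 c4 c6 l :: "'a::field"
  assumes "y1^2 + c1*x1*y1 + c3*y1 - (x1^3 + c2*x1^2 + c4*x1 + c6) = 0"
    "y2^2 + c1*x2*y2 + c3*y2 - (x2^3 + c2*x2^2 + c4*x2 + c6) = 0"
    "l*(x2-x1) = y2-y1" "x1 \<noteq> x2"
  shows "l * (y1 + y2 + c1*x2 + c3) = x1 ^ 2 + x1 * x2 + x2 ^ 2 + c2 * (x1 + x2) + c4 - c1*y1"
  using assms by Groebner_Basis.algebra

lemma slope_exists:
  fixes E :: "'a::field weierstrass"
  assumes 1: "weierstrass_eval E x1 y1 = 0" and 2: "weierstrass_eval E x2 y2 = 0"
    and ne: "\<not> (x1 = x2 \<and> y2 = - y1 - a1 E * x1 - a3 E)"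
  shows "\<exists>l. is_slope E l x1 y1 x2 y2 \<and> point_add E (Affine x1 y1) (Affine x2 y2) = chord_sum E l x1 y1 x2"
proof (cases "x1 = x2")
  case True
  then have yy: "y1 = y2"
    using same_x_poly[of y1 "a1 E" x1 "a3 E" "a2 E" "a4 E" "a6 E" y2] 1 2 ne
    unfolding weierstrass_eval_def by blast
  have nz: "2 * y1 + a1 E * x1 + a3 E \<noteq> 0"
  proof
    assume "2 * y1 + a1 E * x1 + a3 E = 0"
    then have "y2 = - y1 - a1 E * x1 - a3 E" using yy by Groebner_Basis.algebra
    then show False using True ne by blast
  qed
  define l where "l = (3 * x1 ^ 2 + 2 * a2 E * x1 + a4 E - a1 E * y1) / (2 * y1 + a1 E * x1 + a3 E)"
  have "l * (2 * y1 + a1 E * x1 + a3 E) = 3 * x1 ^ 2 + 2 * a2 E * x1 + a4 E - a1 E * y1"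
    using nz by (simp add: l_def)
  then have "is_slope E l x1 y1 x2 y2"
    unfolding is_slope_def using True yy by (simp add: power2_eq_square algebra_simps)
  moreover have "point_add E (Affine x1 y1) (Affine x2 y2) = chord_sum E l x1 y1 x2"
    using ne True unfolding chord_sum_def third_x_def by (simp add: Let_def l_def)
  ultimately show ?thesis by blast
next
  case False
  define l where "l = (y2 - y1) / (x2 - x1)"
  have l: "l * (x2 - x1) = y2 - y1" using False by (simp add: l_def)
  have "is_slope E l x1 y1 x2 y2"
    unfolding is_slope_def
    using chord_poly[of y1 "a1 E" x1 "a3 E" "a2 E" "a4 E" "a6 E" y2 x2 l] l False 1 2
    unfolding weierstrass_eval_def by blast
  moreover have "point_add E (Affine x1 y1) (Affine x2 y2) = chord_sum E l x1 y1 x2"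
    using False unfolding chord_sum_def third_x_def by (simp add: Let_def l_def)
  ultimately show ?thesis by blast
qed

text \<open>Opposite points that satisfy the first slope equation have equal ordinates, so one
  partial derivative vanishes; the second slope equation then kills the other one, and the curve
  would be singular there.\<close>

lemma slope_not_neg:
  fixes E :: "'a::field weierstrass"
  assumes d: "discriminant E \<noteq> 0" and 1: "weierstrass_eval E x1 y1 = 0"
    and l: "is_slope E l x1 y1 x2 y2"
  shows "\<not> (x1 = x2 \<and> y2 = - y1 - a1 E * x1 - a3 E)"
proof
  assume A: "x1 = x2 \<and> y2 = - y1 - a1 E * x1 - a3 E"
  with l have y: "y2 = y1" by (simp add: is_slope_def)
  have s: "2*y1 + a1 E*x1 + a3 E = 0" using conjunct2[OF A] y by Groebner_Basis.algebra
  have "y1 + y2 + a1 E * x2 + a3 E = 0" using A by simp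
  then have "3*x1^2 + 2*a2 E*x1 + a4 E - a1 E*y1 = 0"
    using l A unfolding is_slope_def by (simp add: power2_eq_square algebra_simps)
  with nonsingular[OF 1 s] d show False by simp
qed

lemma slope_unique:
  fixes E :: "'a::field weierstrass"
  assumes "is_slope E l x1 y1 x2 y2" "is_slope E l' x1 y1 x2 y2"
    "\<not> (x1 = x2 \<and> y2 = - y1 - a1 E * x1 - a3 E)"
  shows "l = l'"
proof (cases "x1 = x2")
  case True
  have "y1 + y2 + a1 E * x2 + a3 E \<noteq> 0"
  proof
    assume "y1 + y2 + a1 E * x2 + a3 E = 0"
    then have "y2 = - y1 - a1 E * x1 - a3 E" using True by Groebner_Basis.algebra
    then show False using True assms(3) by blast
  qed
  then show ?thesis using assms(1,2) unfolding is_slope_def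
    by (metis mult_right_cancel)
next
  case False
  then have "x2 - x1 \<noteq> 0" by simp
  then show ?thesis using assms(1,2) unfolding is_slope_def by (metis mult_right_cancel)
qed

text \<open>Turns any solution l of the two slope equations into the value of the sum, so explicit
  additions need neither a division nor a distinction between chord and tangent.\<close>

lemma add_slope:
  fixes E :: "'a::field weierstrass"
  assumes "discriminant E \<noteq> 0" "weierstrass_eval E x1 y1 = 0" "weierstrass_eval E x2 y2 = 0"
    "is_slope E l x1 y1 x2 y2"
  shows "point_add E (Affine x1 y1) (Affine x2 y2) = chord_sum E l x1 y1 x2"
  using slope_exists[OF assms(2,3)] slope_unique slope_not_neg[OF assms(1,2)] assms(4) by metis

lemma add_neg_eq:
  "x1 = x2 \<Longrightarrow> y2 = - y1 - a1 E * x1 - a3 E \<Longrightarrow> point_add E (Affine x1 y1) (Affine x2 y2) = Infinity"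
  by simp

lemma third_point_poly:
  fixes x1 x2 y1 y2 c1 c2 c3 c4 c6 l x3 y3 :: "'a::field"
  assumes "y1^2 + c1*x1*y1 + c3*y1 - (x1^3 + c2*x1^2 + c4*x1 + c6) = 0"
    "l*(x2-x1) = y2-y1"
    "l * (y1 + y2 + c1*x2 + c3) = x1 ^ 2 + x1 * x2 + x2 ^ 2 + c2 * (x1 + x2) + c4 - c1*y1"
    "x3 = l^2+c1*l-c2-x1-x2" "y3 = - (y1+l*(x3-x1)) - c1*x3 - c3"
  shows "y3^2 + c1*x3*y3 + c3*y3 - (x3^3 + c2*x3^2 + c4*x3 + c6) = 0"
  using assms by Groebner_Basis.algebra

lemma chord_sum_on_curve:
  assumes "weierstrass_eval E x1 y1 = 0" "is_slope E l x1 y1 x2 y2"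
  shows "on_curve E (chord_sum E l x1 y1 x2)"
  using third_point_poly[of y1 "a1 E" x1 "a3 E" "a2 E" "a4 E" "a6 E" l x2 y2, OF _ _ _ refl refl] assms
  unfolding weierstrass_eval_def is_slope_def chord_sum_def third_x_def on_curve_simps by blast

lemma point_add_Infinity_right [simp]: "point_add E P Infinity = P"
  by (cases P) simp_all

lemma add_on_curve:
  assumes "on_curve E P" "on_curve E Q"
  shows "on_curve E (point_add E P Q)"
proof (cases P)
  case (Affine x1 y1)
  show ?thesis
  proof (cases Q)
    case (Affine x2 y2)
    show ?thesis
      using assms \<open>P = _\<close> Affine slope_exists[of E x1 y1 x2 y2] chord_sum_on_curve[of E x1 y1 _ x2 y2]
      by (cases "x1 = x2 \<and> y2 = - y1 - a1 E * x1 - a3 E") auto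
  qed (use assms in simp)
qed (use assms in simp)

lemma slope_sym_poly:
  fixes x1 x2 y1 y2 c1 c2 c3 c4 l :: "'a::field"
  assumes "l * (x2 - x1) = y2 - y1"
    "l * (y1 + y2 + c1 * x2 + c3) = x1 ^ 2 + x1 * x2 + x2 ^ 2 + c2 * (x1 + x2) + c4 - c1 * y1"
  shows "l * (x1 - x2) = y1 - y2 \<and>
    l * (y2 + y1 + c1 * x1 + c3) = x2 ^ 2 + x2 * x1 + x1 ^ 2 + c2 * (x2 + x1) + c4 - c1 * y2"
  using assms by Groebner_Basis.algebra

lemma is_slope_sym:
  "is_slope E l x1 y1 x2 y2 \<Longrightarrow> is_slope E l x2 y2 x1 y1"
  unfolding is_slope_def by (blast dest: slope_sym_poly)

lemma chord_sum_sym: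
  fixes E :: "'a::field weierstrass"
  assumes "is_slope E l x1 y1 x2 y2"
  shows "chord_sum E l x1 y1 x2 = chord_sum E l x2 y2 x1"
proof -
  have x: "third_x E l x1 x2 = third_x E l x2 x1" by (simp add: third_x_def)
  have "y1 + l * (z - x1) = y2 + l * (z - x2)" for z
    using assms unfolding is_slope_def by Groebner_Basis.algebra
  then show ?thesis by (simp add: chord_sum_def x)
qed

lemma add_comm:
  assumes "discriminant E \<noteq> 0" "on_curve E P" "on_curve E Q"
  shows "point_add E P Q = point_add E Q P"
proof (cases P)
  case P: (Affine x1 y1)
  show ?thesis
  proof (cases Q)
    case Q: (Affine x2 y2)
    show ?thesis
    proof (cases "x1 = x2 \<and> y2 = - y1 - a1 E * x1 - a3 E")
      case True
      then show ?thesis using P Q by simp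
    next
      case False
      have w: "weierstrass_eval E x1 y1 = 0" "weierstrass_eval E x2 y2 = 0" using assms P Q by auto
      from slope_exists[OF w False] obtain l where l: "is_slope E l x1 y1 x2 y2"
        "point_add E (Affine x1 y1) (Affine x2 y2) = chord_sum E l x1 y1 x2" by blast
      then show ?thesis using P Q add_slope[OF assms(1) w(2,1) is_slope_sym[OF l(1)]] chord_sum_sym[OF l(1)]
        by simp
    qed
  qed (use assms in simp)
qed (use assms in simp)

lemma neg_on_curve:
  fixes E :: "'a::field weierstrass"
  assumes "on_curve E P" shows "on_curve E (point_neg E P)"
proof (cases P)
  case (Affine x y)
  have "weierstrass_eval E x (- y - a1 E * x - a3 E) = weierstrass_eval E x y"
    unfolding weierstrass_eval_def by (simp add: power2_eq_square algebra_simps)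
  then show ?thesis using assms Affine by simp
qed simp

lemma add_neg: "point_add E P (point_neg E P) = Infinity"
  by (cases P) simp_all

text \<open>Admissible changes of variables \<open>x = u\<^sup>2 x' + r\<close>, \<open>y = u\<^sup>3 y' + u\<^sup>2 s x' + t\<close> from \<open>E\<close> to \<open>E'\<close>.\<close>

definition admissible :: "'a::field \<Rightarrow> 'a \<Rightarrow> 'a \<Rightarrow> 'a \<Rightarrow> 'a weierstrass \<Rightarrow> 'a weierstrass \<Rightarrow> bool" where
  "admissible u r s t E E' \<longleftrightarrow> u \<noteq> 0 \<and>
     u * a1 E' = a1 E + 2 * s \<and>
     u ^ 2 * a2 E' = a2 E - s * a1 E + 3 * r - s ^ 2 \<and>
     u ^ 3 * a3 E' = a3 E + r * a1 E + 2 * t \<and>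
     u ^ 4 * a4 E' = a4 E - s * a3 E + 2 * r * a2 E - (t + r * s) * a1 E + 3 * r ^ 2 - 2 * s * t \<and>
     u ^ 6 * a6 E' = a6 E + r * a4 E + r ^ 2 * a2 E + r ^ 3 - t * a3 E - t ^ 2 - r * t * a1 E"

fun old_point :: "'a::field \<Rightarrow> 'a \<Rightarrow> 'a \<Rightarrow> 'a \<Rightarrow> 'a point \<Rightarrow> 'a point" where
  "old_point u r s t Infinity = Infinity"
| "old_point u r s t (Affine x y) = Affine (u ^ 2 * x + r) (u ^ 3 * y + u ^ 2 * s * x + t)"

lemma admissible_eval_poly:
  fixes x y x1 y1 c1 c2 c3 c4 c6 d1 d2 d3 d4 d6 u r s t :: "'a::field"
  assumes "u * d1 = c1 + 2 * s"
     "u ^ 2 * d2 = c2 - s * c1 + 3 * r - s ^ 2"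
     "u ^ 3 * d3 = c3 + r * c1 + 2 * t"
     "u ^ 4 * d4 = c4 - s * c3 + 2 * r * c2 - (t + r * s) * c1 + 3 * r ^ 2 - 2 * s * t"
     "u ^ 6 * d6 = c6 + r * c4 + r ^ 2 * c2 + r ^ 3 - t * c3 - t ^ 2 - r * t * c1"
    "x1 = u ^ 2 * x + r" "y1 = u ^ 3 * y + u ^ 2 * s * x + t"
  shows "y1^2 + c1 * x1 * y1 + c3 * y1 - (x1 ^ 3 + c2 * x1 ^ 2 + c4 * x1 + c6) =
    u ^ 6 * (y^2 + d1 * x * y + d3 * y - (x ^ 3 + d2 * x ^ 2 + d4 * x + d6))"
  using assms by Groebner_Basis.algebra

lemma admissible_eval:
  assumes "admissible u r s t E E'"
  shows "weierstrass_eval E (u ^ 2 * x + r) (u ^ 3 * y + u ^ 2 * s * x + t) = u ^ 6 * weierstrass_eval E' x y"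
  using assms admissible_eval_poly[of u "a1 E'" "a1 E" s "a2 E'" "a2 E" r "a3 E'" "a3 E" t "a4 E'" "a4 E" "a6 E'" "a6 E",
     OF _ _ _ _ _ refl refl]
  unfolding admissible_def weierstrass_eval_def by blast

lemma old_point_on_curve:
  assumes "admissible u r s t E E'"
  shows "on_curve E (old_point u r s t P) \<longleftrightarrow> on_curve E' P"
  using assms by (cases P) (auto simp: admissible_eval admissible_def)

text \<open>A line of slope l becomes one of slope u l + s. The second slope equation is multiplied
  by u^4, up to a multiple of the first.\<close>

lemma admissible_slope_poly:
  fixes x1 x2 y1 y2 c1 c2 c3 c4 d1 d2 d3 d4 u r s t l :: "'a::field"
  assumes "u * d1 = c1 + 2 * s"
     "u ^ 2 * d2 = c2 - s * c1 + 3 * r - s ^ 2"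
     "u ^ 3 * d3 = c3 + r * c1 + 2 * t"
     "u ^ 4 * d4 = c4 - s * c3 + 2 * r * c2 - (t + r * s) * c1 + 3 * r ^ 2 - 2 * s * t"
     "l * (x2 - x1) = y2 - y1"
     "l * (y1 + y2 + d1 * x2 + d3) = x1 ^ 2 + x1 * x2 + x2 ^ 2 + d2 * (x1 + x2) + d4 - d1 * y1"
     "z1 = u ^ 2 * x1 + r" "w1 = u ^ 3 * y1 + u ^ 2 * s * x1 + t"
     "z2 = u ^ 2 * x2 + r" "w2 = u ^ 3 * y2 + u ^ 2 * s * x2 + t" "k = u * l + s"
  shows "k * (z2 - z1) = w2 - w1 \<and>
     k * (w1 + w2 + c1 * z2 + c3) = z1 ^ 2 + z1 * z2 + z2 ^ 2 + c2 * (z1 + z2) + c4 - c1 * w1"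
proof -
  have a: "k * (z2 - z1) = w2 - w1" using assms by Groebner_Basis.algebra
  have e: "c1 = u*d1 - 2*s" "c2 = u^2*d2 + s*c1 - 3*r + s^2" "c3 = u^3*d3 - r*c1 - 2*t"
    "c4 = u^4*d4 + s*c3 - 2*r*c2 + (t+r*s)*c1 - 3*r^2 + 2*s*t"
    using assms(1-4) by Groebner_Basis.algebra+
  have "k * (w1 + w2 + c1 * z2 + c3) - (z1 ^ 2 + z1 * z2 + z2 ^ 2 + c2 * (z1 + z2) + c4 - c1 * w1)
   = u^4 * (l * (y1 + y2 + d1 * x2 + d3) - (x1 ^ 2 + x1 * x2 + x2 ^ 2 + d2 * (x1 + x2) + d4 - d1 * y1))
     + s * u^3 * (y1 - y2 + l * (x2 - x1))"
    unfolding assms(7-) e(4) e(3) e(2) unfolding e(1) using assms(5) by Groebner_Basis.algebra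
  then show ?thesis using a assms(5,6) by simp
qed

lemma admissible_slope:
  assumes "admissible u r s t E E'" "is_slope E' l x1 y1 x2 y2"
  shows "is_slope E (u * l + s) (u ^ 2 * x1 + r) (u ^ 3 * y1 + u ^ 2 * s * x1 + t)
     (u ^ 2 * x2 + r) (u ^ 3 * y2 + u ^ 2 * s * x2 + t)"
  using assms admissible_slope_poly[of u "a1 E'" "a1 E" s "a2 E'" "a2 E" r "a3 E'" "a3 E" t "a4 E'" "a4 E"
     l x2 x1 y2 y1, OF _ _ _ _ _ _ refl refl refl refl refl]
  unfolding admissible_def is_slope_def by blast

lemma admissible_chord_poly:
  fixes x1 x2 y1 c1 c2 c3 d1 d2 d3 u r s t l :: "'a::field"
  assumes "u * d1 = c1 + 2 * s"
     "u ^ 2 * d2 = c2 - s * c1 + 3 * r - s ^ 2"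
     "u ^ 3 * d3 = c3 + r * c1 + 2 * t"
     "z1 = u ^ 2 * x1 + r" "w1 = u ^ 3 * y1 + u ^ 2 * s * x1 + t"
     "z2 = u ^ 2 * x2 + r" "k = u * l + s"
     "x3 = l^2 + d1 * l - d2 - x1 - x2" "z3 = k^2 + c1 * k - c2 - z1 - z2"
  shows "z3 = u^2 * x3 + r \<and> - (w1 + k * (z3 - z1)) - c1 * z3 - c3
    = u^3 * (- (y1 + l * (x3 - x1)) - d1 * x3 - d3) + u^2 * s * x3 + t"
proof -
  have e: "c1 = u*d1 - 2*s" "c2 = u^2*d2 + s*c1 - 3*r + s^2" "c3 = u^3*d3 - r*c1 - 2*t"
    using assms(1-3) by Groebner_Basis.algebra+
  have a: "z3 = u^2 * x3 + r"
    unfolding assms(4-) e(3) e(2) unfolding e(1) by Groebner_Basis.algebra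
  have "- (w1 + k * (z3 - z1)) - c1 * z3 - c3
    = u^3 * (- (y1 + l * (x3 - x1)) - d1 * x3 - d3) + u^2 * s * x3 + t"
    unfolding a unfolding assms(4-7) e(3) e(2) unfolding e(1) by Groebner_Basis.algebra
  with a show ?thesis by blast
qed

lemma admissible_chord_sum:
  assumes "admissible u r s t E E'"
  shows "chord_sum E (u * l + s) (u ^ 2 * x1 + r) (u ^ 3 * y1 + u ^ 2 * s * x1 + t) (u ^ 2 * x2 + r)
    = old_point u r s t (chord_sum E' l x1 y1 x2)"
  using assms admissible_chord_poly[of u "a1 E'" "a1 E" s "a2 E'" "a2 E" r "a3 E'" "a3 E" t
     _ x1 _ y1 _ x2 _ l, OF _ _ _ refl refl refl refl refl refl]
  unfolding admissible_def chord_sum_def third_x_def old_point.simps by blast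

text \<open>Apart from the scaling by u, the b-invariants shift by polynomials in r and the b's
  alone, which keeps the elimination small; the last step also uses the relation 4 b8 = b2 b6 -
  b4^2.\<close>

lemma discriminant_poly:
  fixes c1 c2 c3 c4 c6 d1 d2 d3 d4 d6 u r s t :: "'a::field"
  assumes "u * d1 = c1 + 2 * s"
     "u ^ 2 * d2 = c2 - s * c1 + 3 * r - s ^ 2"
     "u ^ 3 * d3 = c3 + r * c1 + 2 * t"
     "u ^ 4 * d4 = c4 - s * c3 + 2 * r * c2 - (t + r * s) * c1 + 3 * r ^ 2 - 2 * s * t"
     "u ^ 6 * d6 = c6 + r * c4 + r ^ 2 * c2 + r ^ 3 - t * c3 - t ^ 2 - r * t * c1"
    "b2 = c1^2+4*c2" "b4 = 2*c4+c1*c3" "b6 = c3^2+4*c6"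
    "b8 = c1^2*c6+4*c2*c6-c1*c3*c4+c2*c3^2-c4^2"
    "e2 = d1^2+4*d2" "e4 = 2*d4+d1*d3" "e6 = d3^2+4*d6"
    "e8 = d1^2*d6+4*d2*d6-d1*d3*d4+d2*d3^2-d4^2"
  shows "- (b2 ^ 2) * b8 - 8 * b4 ^ 3 - 27 * b6 ^ 2 + 9 * b2 * b4 * b6
    = u^12 * (- (e2 ^ 2) * e8 - 8 * e4 ^ 3 - 27 * e6 ^ 2 + 9 * e2 * e4 * e6)"
proof -
  have e: "c1 = u*d1 - 2*s" "c2 = u^2*d2 + s*c1 - 3*r + s^2" "c3 = u^3*d3 - r*c1 - 2*t"
    "c4 = u^4*d4 + s*c3 - 2*r*c2 + (t+r*s)*c1 - 3*r^2 + 2*s*t"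
    "c6 = u^6*d6 - r * c4 - r ^ 2 * c2 - r ^ 3 + t * c3 + t ^ 2 + r * t * c1"
    using assms(1-5) by Groebner_Basis.algebra+
  have b2: "b2 = u^2*e2 - 12*r"
    unfolding assms(6-) e(3) e(2) unfolding e(1) by Groebner_Basis.algebra
  have b4: "b4 = u^4*e4 - r*(b2 + 6*r)"
    unfolding assms(6-) e(4) e(3) e(2) unfolding e(1) by Groebner_Basis.algebra
  have b6: "b6 = u^6*e6 - 2*r*b4 - r^2*b2 - 4*r^3"
    unfolding assms(6-) e(5) e(4) e(3) e(2) unfolding e(1) by Groebner_Basis.algebra
  have b8: "b8 = u^8*e8 - 3*r*b6 - 3*r^2*b4 - r^3*b2 - 3*r^4"
    unfolding assms(6-) e(5) unfolding e(4) unfolding e(3) unfolding e(2) unfolding e(1) by Groebner_Basis.algebra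
  have e8: "4*e8 = e2*e6 - e4^2" unfolding assms(6-) by Groebner_Basis.algebra
  show ?thesis unfolding b8 unfolding b6 unfolding b4 unfolding b2 using e8 by Groebner_Basis.algebra
qed

lemma admissible_discriminant:
  assumes "admissible u r s t E E'"
  shows "discriminant E = u^12 * discriminant E'"
  using assms discriminant_poly[of u "a1 E'" "a1 E" s "a2 E'" "a2 E" r "a3 E'" "a3 E" t "a4 E'" "a4 E" "a6 E'" "a6 E",
    OF _ _ _ _ _ refl refl refl refl refl refl refl refl]
  unfolding admissible_def discriminant_def Let_def by blast

lemma admissible_add:
  fixes E :: "'a::field weierstrass"
  assumes ad: "admissible u r s t E E'" and d: "discriminant E' \<noteq> 0"
    and on: "on_curve E' P" "on_curve E' Q"
  shows "point_add E (old_point u r s t P) (old_point u r s t Q) = old_point u r s t (point_add E' P Q)"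
proof (cases P)
  case P: (Affine x1 y1)
  show ?thesis
  proof (cases Q)
    case Q: (Affine x2 y2)
    have w: "weierstrass_eval E' x1 y1 = 0" "weierstrass_eval E' x2 y2 = 0" using on P Q by auto
    have w': "weierstrass_eval E (u ^ 2 * x1 + r) (u ^ 3 * y1 + u ^ 2 * s * x1 + t) = 0"
       "weierstrass_eval E (u ^ 2 * x2 + r) (u ^ 3 * y2 + u ^ 2 * s * x2 + t) = 0"
      using admissible_eval[OF ad] w by simp_all
    have u: "u \<noteq> 0" using ad by (simp add: admissible_def)
    have d': "discriminant E \<noteq> 0" using admissible_discriminant[OF ad] d u by simp
    show ?thesis
    proof (cases "x1 = x2 \<and> y2 = - y1 - a1 E' * x1 - a3 E'")
      case True
      define c1 c3 d1 d3 where c: "c1 = a1 E" "c3 = a3 E" "d1 = a1 E'" "d3 = a3 E'"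
      have "u * d1 = c1 + 2 * s" "u ^ 3 * d3 = c3 + r * c1 + 2 * t"
        using ad unfolding admissible_def c by auto
      moreover have "y2 = - y1 - d1 * x1 - d3" using True c by simp
      ultimately have "u ^ 3 * y2 + u ^ 2 * s * x1 + t
         = - (u ^ 3 * y1 + u ^ 2 * s * x1 + t) - c1 * (u ^ 2 * x1 + r) - c3"
        by Groebner_Basis.algebra
      then show ?thesis using True P Q by (simp add: c)
    next
      case False
      from slope_exists[OF w False] obtain l where l: "is_slope E' l x1 y1 x2 y2"
        "point_add E' (Affine x1 y1) (Affine x2 y2) = chord_sum E' l x1 y1 x2" by blast
      show ?thesis using P Q l(2) add_slope[OF d' w' admissible_slope[OF ad l(1)]]
          admissible_chord_sum[OF ad] by simp
    qed
  qed simp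
qed simp

text \<open>Dictionary for P = (p, 0), Q = (0, 0), R = (r, m r): the line y = 0 meets the cubic
  again at abscissa s, the line y = m x at t; l and n are the slopes in (P + Q) + R and P + (Q + R).
  The hypothesis \<open>f\<close> says that r is a root of the cubic on y = m x after the root 0 is
  removed.\<close>

lemma assoc_poly_generic:
  fixes c1 c3 p s r m t l n z :: "'a::field"
  assumes f: "m^2*r+c1*m*r+c3*m = (r-p)*(r-s)" and t: "t = p+s+m^2+c1*m-r"
    and l: "l*(r-s) = m*r+c1*s+c3" and n: "n*(p-t) = m*t+c1*t+c3"
    and ne: "r \<noteq> s" "p \<noteq> t" and z: "z = l^2+c1*l+p-r"
  shows "z = n^2+c1*n+s-t \<and> -c1*s-c3+l*(z-s) = n*(z-p)"
proof -
  define w where "w = (m*r+c1*s+c3)^2+c1*(m*r+c1*s+c3)*(r-s)+(p-r)*(r-s)^2"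
  have wz: "w = z*(r-s)^2" unfolding w_def z using l by Groebner_Basis.algebra
  have "w*(p-t)^2 = ((m*t+c1*t+c3)^2+c1*(m*t+c1*t+c3)*(p-t)+(s-t)*(p-t)^2)*(r-s)^2"
    unfolding w_def using f t by Groebner_Basis.algebra
  also have "\<dots> = (n^2+c1*n+s-t)*(p-t)^2*(r-s)^2" using n by Groebner_Basis.algebra
  finally have "(z - (n^2+c1*n+s-t))*((p-t)^2*(r-s)^2) = 0" using wz by Groebner_Basis.algebra
  then have 1: "z = n^2+c1*n+s-t" using ne by simp
  have "((-c1*s-c3)*(r-s)^3+(m*r+c1*s+c3)*(w-s*(r-s)^2))*(p-t) = (m*t+c1*t+c3)*(w-p*(r-s)^2)*(r-s)"
    using f t w_def by Groebner_Basis.algebra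
  then have "(-c1*s-c3+l*(z-s) - n*(z-p))*((r-s)^3*(p-t)) = 0" using wz l n by Groebner_Basis.algebra
  then show ?thesis using ne 1 by simp
qed

text \<open>If r = s or p = t, the chord equation loses its slope, which is then fixed by the
  tangent equation; the coefficient there is nonzero because the points are not opposite.\<close>

lemma assoc_poly:
  fixes c1 c3 p s r m t l n z :: "'a::field"
  assumes f: "m^2*r+c1*m*r+c3*m = (r-p)*(r-s)" and t: "t = p+s+m^2+c1*m-r"
    and l: "l*(r-s) = m*r+c1*s+c3"
      "l*(m*r+c1*(r-s)) = s^2+s*r+r^2-(p+s)*(s+r)+p*s+c1*(c1*s+c3)"
    and n: "n*(p-t) = m*t+c1*t+c3"
      "n*(-m*t-c1*t+c1*p) = t^2+t*p+p^2-(p+s)*(t+p)+p*s+c1*(m*t+c1*t+c3)"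
    and ne: "r = s \<Longrightarrow> m*r+c1*(r-s) \<noteq> 0" "p = t \<Longrightarrow> -m*t-c1*t+c1*p \<noteq> 0"
    and z: "z = l^2+c1*l+p-r"
  shows "z = n^2+c1*n+s-t \<and> -c1*s-c3+l*(z-s) = n*(z-p)"
proof (cases "r = s")
  case True
  then have ne1: "m*r+c1*(r-s) \<noteq> 0" and 1: "m*r+c1*s+c3 = 0" using ne l by auto
  show ?thesis
  proof (cases "p = t")
    case pt: True
    then have ne2: "-m*t-c1*t+c1*p \<noteq> 0" and 2: "m*t+c1*t+c3 = 0" using ne n by auto
    have "z = n^2+c1*n+s-t" using f t True pt 1 2 l(2) n(2) ne1 ne2 z by Groebner_Basis.algebra
    moreover have "-c1*s-c3+l*(z-s) = n*(z-p)" using f t True pt 1 2 l(2) n(2) ne1 ne2 z by Groebner_Basis.algebra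
    ultimately show ?thesis by blast
  next
    case False
    have "z = n^2+c1*n+s-t" using f t True False 1 l(2) n ne1 z by Groebner_Basis.algebra
    moreover have "-c1*s-c3+l*(z-s) = n*(z-p)" using f t True False 1 l(2) n(1) ne1 z by Groebner_Basis.algebra
    ultimately show ?thesis by blast
  qed
next
  case False
  show ?thesis
  proof (cases "p = t")
    case pt: True
    then have ne2: "-m*t-c1*t+c1*p \<noteq> 0" and 2: "m*t+c1*t+c3 = 0" using ne n by auto
    have "z = n^2+c1*n+s-t" using f t False pt 2 l(1) n(2) ne2 z by Groebner_Basis.algebra
    moreover have "-c1*s-c3+l*(z-s) = n*(z-p)" using f t False pt 2 l(1) n(2) ne2 z by Groebner_Basis.algebra
    ultimately show ?thesis by blast
  next
    case pt: False
    show ?thesis by (rule assoc_poly_generic[OF f t l(1) n(1) False pt z])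
  qed
qed

text \<open>R = -(P + Q) implies P = -(Q + R); the next lemma is the converse. The condition c3 = 0,
  p s = 0 would make the curve singular at Q, and its exclusion forces m = 0.\<close>

lemma assoc_infinity_poly1:
  fixes c1 c3 p s r m t :: "'a::field"
  assumes f: "m^2*r+c1*m*r+c3*m = (r-p)*(r-s)" and t: "t = p+s+m^2+c1*m-r"
    and "r = s" "m*r = 0" "\<not> (c3 = 0 \<and> p*s = 0)"
  shows "p = t \<and> m*t = 0"
proof -
  have "c3*m = 0" using assms(1,3,4) by Groebner_Basis.algebra
  have "m = 0"
  proof (rule ccontr)
    assume "m \<noteq> 0"
    then have "c3 = 0" "r = 0" using \<open>c3*m = 0\<close> assms(4) by auto
    then show False using assms(3,5) by simp
  qed
  then show ?thesis using t assms(3) by simp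
qed

lemma assoc_infinity_poly2:
  fixes c1 c3 p s r m t :: "'a::field"
  assumes f: "m^2*r+c1*m*r+c3*m = (r-p)*(r-s)" and t: "t = p+s+m^2+c1*m-r"
    and "p = t" "m*t = 0" "\<not> (c3 = 0 \<and> p*s = 0)"
  shows "r = s \<and> m*r = 0"
proof -
  have "m = 0"
  proof (rule ccontr)
    assume m: "m \<noteq> 0"
    then have p0: "p = 0" using assms(3,4) by auto
    have "m*c3 = 0" using f t p0 assms(3) by Groebner_Basis.algebra
    then show False using m p0 assms(5) by simp
  qed
  then show ?thesis using t assms(3) by simp
qed

text \<open>Associativity when the second point is \<open>(0, 0)\<close> and its chord with the first point is
  horizontal; \<open>s\<close> is the abscissa of the third intersection point of that chord.\<close>

lemma assoc_normalized:
  fixes E :: "'a::field weierstrass"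
  assumes d: "discriminant E \<noteq> 0" and E: "a2 E = - (p + s)" "a4 E = p * s" "a6 E = 0"
    and P: "weierstrass_eval E p 0 = 0" and sl: "is_slope E 0 p 0 0 0"
    and R: "weierstrass_eval E r (m*r) = 0" and slm: "is_slope E m 0 0 r (m*r)"
  shows "point_add E (point_add E (Affine p 0) (Affine 0 0)) (Affine r (m*r))
    = point_add E (Affine p 0) (point_add E (Affine 0 0) (Affine r (m*r)))"
proof -
  define c1 c3 where c: "c1 = a1 E" "c3 = a3 E"
  define t where t: "t = p+s+m^2+c1*m-r"
  have Q: "weierstrass_eval E 0 0 = 0" by (simp add: weierstrass_eval_def E)
  have f: "m^2*r+c1*m*r+c3*m = (r-p)*(r-s)"
  proof -
    have "m * (m*r + c1*r + c3) = r^2 + (-(p+s))*r + p*s"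
      using slm unfolding is_slope_def c E by simp
    then show ?thesis by Groebner_Basis.algebra
  qed
  have ns: "\<not> (c3 = 0 \<and> p*s = 0)"
    using nonsingular[OF Q] d c E by auto
  have S: "point_add E (Affine p 0) (Affine 0 0) = Affine s (-c1*s-c3)"
    using add_slope[OF d P Q sl] by (simp add: chord_sum_def third_x_def E c)
  have T: "point_add E (Affine 0 0) (Affine r (m*r)) = Affine t (-m*t-c1*t-c3)"
    using add_slope[OF d Q R slm] by (simp add: chord_sum_def third_x_def E c t algebra_simps)
  have wS: "weierstrass_eval E s (-c1*s-c3) = 0" and wT: "weierstrass_eval E t (-m*t-c1*t-c3) = 0"
    using add_on_curve[of E "Affine p 0" "Affine 0 0"] add_on_curve[of E "Affine 0 0" "Affine r (m*r)"] P Q R S T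
    by simp_all
  show ?thesis
  proof (cases "s = r \<and> m*r = -(-c1*s-c3) - c1*s - c3")
    case True
    then have "p = t \<and> m*t = 0"
      using assoc_infinity_poly1[OF f t _ _ ns] by simp
    then show ?thesis using True unfolding S T by (simp add: c)
  next
    case SR: False
    show ?thesis
    proof (cases "p = t \<and> -m*t-c1*t-c3 = -0 - c1*p - c3")
      case True
      then have "p = t" "m*t = 0" by (auto simp: algebra_simps)
      then have "r = s \<and> m*r = 0"
        using assoc_infinity_poly2[OF f t _ _ ns] by blast
      then show ?thesis using SR by auto
    next
      case PT: False
      obtain l where l: "is_slope E l s (-c1*s-c3) r (m*r)"
         "point_add E (Affine s (-c1*s-c3)) (Affine r (m*r)) = chord_sum E l s (-c1*s-c3) r"
        using slope_exists[OF wS R] SR c by auto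
      obtain n where n: "is_slope E n p 0 t (-m*t-c1*t-c3)"
         "point_add E (Affine p 0) (Affine t (-m*t-c1*t-c3)) = chord_sum E n p 0 t"
        using slope_exists[OF P wT] PT c by auto
      have l1: "l*(r-s) = m*r+c1*s+c3" using l(1) by (simp add: is_slope_def)
      have n1: "n*(p-t) = m*t+c1*t+c3" using n(1) unfolding is_slope_def by Groebner_Basis.algebra
      have "l * ((-c1*s-c3) + m*r + c1*r + c3) = s^2+s*r+r^2+(-(p+s))*(s+r)+p*s-c1*(-c1*s-c3)"
        using l(1) unfolding is_slope_def E c by blast
      then have l2: "l*(m*r+c1*(r-s)) = s^2+s*r+r^2-(p+s)*(s+r)+p*s+c1*(c1*s+c3)"
        by Groebner_Basis.algebra
      have "n * (0 + (-m*t-c1*t-c3) + c1*t + c3) = p^2+p*t+t^2+(-(p+s))*(p+t)+p*s-c1*0"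
        using n(1) unfolding is_slope_def E c by blast
      then have n2: "n*(-m*t-c1*t+c1*p) = t^2+t*p+p^2-(p+s)*(t+p)+p*s+c1*(m*t+c1*t+c3)"
        using n1 by Groebner_Basis.algebra
      have ne1: "m*r+c1*(r-s) \<noteq> 0" if "r = s"
        using SR that by auto
      have ne2: "-m*t-c1*t+c1*p \<noteq> 0" if "p = t"
        using PT that by auto
      define z where "z = third_x E l s r"
      have "z = l^2+c1*l+p-r" by (simp add: z_def third_x_def E c)
      note * = assoc_poly[OF f t l1 l2 n1 n2 ne1 ne2 this]
      have z: "z = third_x E n p t" using conjunct1[OF *] by (simp add: third_x_def E c)
      note y = conjunct2[OF *]
      show ?thesis unfolding S T l(2) n(2) chord_sum_def z[symmetric] z_def[symmetric]
        by (simp only: y add_0)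
    qed
  qed
qed

text \<open>The change of variables that moves \<open>Q\<close> to the origin and the chord through \<open>P\<close> and \<open>Q\<close> to
  the horizontal axis reduces the claim to the normalized case.\<close>

lemma add_assoc_affine:
  fixes E :: "'a::field weierstrass"
  assumes d: "discriminant E \<noteq> 0"
    and on: "weierstrass_eval E x1 y1 = 0" "weierstrass_eval E x2 y2 = 0" "weierstrass_eval E x3 y3 = 0"
    and l: "is_slope E l x1 y1 x2 y2" and m: "is_slope E m x2 y2 x3 y3"
  shows "point_add E (point_add E (Affine x1 y1) (Affine x2 y2)) (Affine x3 y3)
    = point_add E (Affine x1 y1) (point_add E (Affine x2 y2) (Affine x3 y3))"
proof -
  define E' where "E' = \<lparr> a1 = a1 E + 2 * l, a2 = a2 E - l * a1 E + 3 * x2 - l ^ 2,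
     a3 = a3 E + x2 * a1 E + 2 * y2,
     a4 = a4 E - l * a3 E + 2 * x2 * a2 E - (y2 + x2 * l) * a1 E + 3 * x2 ^ 2 - 2 * l * y2,
     a6 = a6 E + x2 * a4 E + x2 ^ 2 * a2 E + x2 ^ 3 - y2 * a3 E - y2 ^ 2 - x2 * y2 * a1 E\<rparr>"
  have ad: "admissible 1 x2 l y2 E E'" by (simp add: admissible_def E'_def)
  have d': "discriminant E' \<noteq> 0" using admissible_discriminant[OF ad] d by simp
  define p r k where "p = x1 - x2" and "r = x3 - x2" and "k = m - l"
  define s where "s = - a2 E' - p"
  have kr: "y3 = k*r + l*r + y2" using m unfolding is_slope_def k_def r_def by Groebner_Basis.algebra
  have lp: "y1 = l*p + y2" using l unfolding is_slope_def p_def by Groebner_Basis.algebra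
  have o: "Affine x1 y1 = old_point 1 x2 l y2 (Affine p 0)"
     "Affine x2 y2 = old_point 1 x2 l y2 (Affine 0 0)"
     "Affine x3 y3 = old_point 1 x2 l y2 (Affine r (k*r))"
    using lp kr by (simp_all add: p_def r_def)
  have on': "on_curve E' (Affine p 0)" "on_curve E' (Affine 0 0)" "on_curve E' (Affine r (k*r))"
    using on old_point_on_curve[OF ad] o on_curve_simps(2) by metis+
  \<comment> \<open>The converse of \<open>admissible_slope\<close> for u = 1: a slope in the old
    coordinates gives one in the coordinates centred at the second point.\<close>
  have slope_back: "is_slope E' (q - l) z w z' w'"
    if "is_slope E q (z + x2) (w + l*z + y2) (z' + x2) (w' + l*z' + y2)" for q z w z' w'
  proof -
    define c1 c2 c3 c4 where c: "c1 = a1 E" "c2 = a2 E" "c3 = a3 E" "c4 = a4 E"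
    have "q * (z' + x2 - (z + x2)) = w' + l*z' + y2 - (w + l*z + y2)"
      "q * (w + l*z + y2 + (w' + l*z' + y2) + c1*(z'+x2) + c3) =
        (z+x2)^2 + (z+x2)*(z'+x2) + (z'+x2)^2 + c2*(z+x2+(z'+x2)) + c4 - c1*(w + l*z + y2)"
      using that unfolding is_slope_def c by auto
    then have "(q-l) * (z' - z) = w' - w \<and>
       (q-l) * (w + w' + (c1 + 2 * l) * z' + (c3 + x2 * c1 + 2 * y2)) =
        z^2 + z*z' + z'^2 + (c2 - l * c1 + 3 * x2 - l ^ 2) * (z+z') +
        (c4 - l * c3 + 2 * x2 * c2 - (y2 + x2 * l) * c1 + 3 * x2 ^ 2 - 2 * l * y2) - (c1 + 2 * l)*w"
      by Groebner_Basis.algebra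
    then show ?thesis unfolding is_slope_def E'_def c by simp
  qed
  have sl: "is_slope E' 0 p 0 0 0"
    using slope_back[of l p 0 0 0] l lp by (simp add: p_def algebra_simps)
  have slm: "is_slope E' k 0 0 r (k*r)"
    using slope_back[of m 0 0 r "k*r"] m kr by (simp add: k_def r_def algebra_simps)
  have a6: "a6 E' = 0" using on'(2) by (simp add: weierstrass_eval_def)
  have "a4 E' + p * a2 E' + p * p = 0" using sl unfolding is_slope_def
    by (simp add: power2_eq_square algebra_simps)
  then have a4: "a4 E' = p * s" unfolding s_def by (simp add: algebra_simps eq_neg_iff_add_eq_0)
  have a2: "a2 E' = - (p + s)" by (simp add: s_def)
  note * = assoc_normalized[OF d' a2 a4 a6 _ sl _ slm]
  show ?thesis unfolding o
    using * on' admissible_add[OF ad d'] add_on_curve on_curve_simps(2) by metis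
qed

text \<open>Negation reflects the chord through P and Q into the line of slope - l - c1 through -P,
  -Q and P + Q; adding -P and P + Q along that line returns Q.\<close>

lemma cancel_slope_poly:
  fixes x1 x2 y1 y2 c1 c2 c3 c4 l :: "'a::field"
  assumes "l * (x2 - x1) = y2 - y1"
    "l * (y1 + y2 + c1 * x2 + c3) = x1 ^ 2 + x1 * x2 + x2 ^ 2 + c2 * (x1 + x2) + c4 - c1 * y1"
    "x3 = l^2 + c1 * l - c2 - x1 - x2" "y3 = - (y1 + l * (x3 - x1)) - c1 * x3 - c3"
    "k = - l - c1" "z1 = - y1 - c1 * x1 - c3"
  shows "k * (x3 - x1) = y3 - z1 \<and>
    k * (z1 + y3 + c1 * x3 + c3) = x1 ^ 2 + x1 * x3 + x3 ^ 2 + c2 * (x1 + x3) + c4 - c1 * z1"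
  using assms by Groebner_Basis.algebra

lemma cancel_sum_poly:
  fixes x1 x2 y1 y2 c1 c2 c3 l :: "'a::field"
  assumes "l * (x2 - x1) = y2 - y1"
    "x3 = l^2 + c1 * l - c2 - x1 - x2"
    "k = - l - c1" "z1 = - y1 - c1 * x1 - c3" "x4 = k^2 + c1 * k - c2 - x1 - x3"
  shows "x4 = x2 \<and> - (z1 + k * (x4 - x1)) - c1 * x4 - c3 = y2"
proof -
  have "x4 = x2" using assms by Groebner_Basis.algebra
  moreover have "- (z1 + k * (x2 - x1)) - c1 * x2 - c3 = y2"
    using assms(1,3,4) by Groebner_Basis.algebra
  ultimately show ?thesis by simp
qed

text \<open>Settles associativity when P + Q or Q + R is \<open>Infinity\<close>, where there is no
  slope to work with.\<close>

lemma neg_add_cancel: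
  fixes E :: "'a::field weierstrass"
  assumes d: "discriminant E \<noteq> 0" and on: "on_curve E P" "on_curve E Q"
  shows "point_add E (point_neg E P) (point_add E P Q) = Q"
proof (cases P)
  case P: (Affine x1 y1)
  show ?thesis
  proof (cases Q)
    case Infinity
    then show ?thesis using add_neg[of E P] add_comm[OF d on(1) neg_on_curve[OF on(1)]] by simp
  next
    case Q: (Affine x2 y2)
    have w: "weierstrass_eval E x1 y1 = 0" "weierstrass_eval E x2 y2 = 0" using on P Q by auto
    show ?thesis
    proof (cases "x1 = x2 \<and> y2 = - y1 - a1 E * x1 - a3 E")
      case True
      then show ?thesis using P Q by simp
    next
      case False
      obtain l where l: "is_slope E l x1 y1 x2 y2"
        "point_add E (Affine x1 y1) (Affine x2 y2) = chord_sum E l x1 y1 x2"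
        using slope_exists[OF w False] by blast
      define x3 y3 where 3: "x3 = l^2 + a1 E * l - a2 E - x1 - x2" "y3 = - (y1 + l * (x3 - x1)) - a1 E * x3 - a3 E"
      have S: "chord_sum E l x1 y1 x2 = Affine x3 y3" by (simp add: chord_sum_def third_x_def 3)
      have w3: "weierstrass_eval E x3 y3 = 0"
        using chord_sum_on_curve[OF w(1) l(1)] S by simp
      have w1: "weierstrass_eval E x1 (- y1 - a1 E * x1 - a3 E) = 0"
        using neg_on_curve[OF on(1)] P by simp
      have sl: "is_slope E (- l - a1 E) x1 (- y1 - a1 E * x1 - a3 E) x3 y3"
        using cancel_slope_poly[of l x2 x1 y2 y1 "a1 E" "a3 E" "a2 E" "a4 E", OF _ _ 3 refl refl] l(1)
        unfolding is_slope_def by blast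
      have "chord_sum E (- l - a1 E) x1 (- y1 - a1 E * x1 - a3 E) x3 = Affine x2 y2"
        using cancel_sum_poly[of l x2 x1 y2 y1 x3 "a1 E" "a2 E" "- l - a1 E" "- y1 - a1 E * x1 - a3 E" "a3 E"
          "third_x E (- l - a1 E) x1 x3", OF _ 3(1) refl refl] l(1)
        unfolding is_slope_def chord_sum_def third_x_def point.inject by blast
      then show ?thesis using P Q l(2) S add_slope[OF d w1 w3 sl] by simp
    qed
  qed
qed simp

lemma add_eq_Infinity_iff:
  assumes "on_curve E P" "on_curve E Q"
  shows "point_add E P Q = Infinity \<longleftrightarrow> Q = point_neg E P"
proof (cases P)
  case P: (Affine x1 y1)
  show ?thesis
  proof (cases Q)
    case Q: (Affine x2 y2)
    have w: "weierstrass_eval E x1 y1 = 0" "weierstrass_eval E x2 y2 = 0" using assms P Q by auto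
    show ?thesis using slope_exists[OF w] P Q
      by (cases "x1 = x2 \<and> y2 = - y1 - a1 E * x1 - a3 E") (auto simp: chord_sum_def)
  qed (simp add: P)
qed (use assms in simp)

theorem add_assoc:
  fixes E :: "'a::field weierstrass"
  assumes d: "discriminant E \<noteq> 0" and on: "on_curve E P" "on_curve E Q" "on_curve E R"
  shows "point_add E (point_add E P Q) R = point_add E P (point_add E Q R)"
proof (cases "P = Infinity \<or> Q = Infinity \<or> R = Infinity")
  case True
  then show ?thesis by auto
next
  case False
  then obtain x1 y1 x2 y2 x3 y3 where A: "P = Affine x1 y1" "Q = Affine x2 y2" "R = Affine x3 y3"
    by (metis point.exhaust)
  have w: "weierstrass_eval E x1 y1 = 0" "weierstrass_eval E x2 y2 = 0" "weierstrass_eval E x3 y3 = 0"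
    using on A by auto
  show ?thesis
  proof (cases "point_add E P Q = Infinity")
    case True
    then have "P = point_neg E Q"
      using add_eq_Infinity_iff add_comm[OF d] on by metis
    then show ?thesis using True neg_add_cancel[OF d on(2,3)] by simp
  next
    case PQ: False
    show ?thesis
    proof (cases "point_add E Q R = Infinity")
      case True
      then have "Q = point_neg E R"
        using add_eq_Infinity_iff add_comm[OF d] on by metis
      moreover have "point_add E (point_add E P Q) R = point_add E R (point_add E Q P)"
        using add_comm[OF d] on add_on_curve by metis
      ultimately show ?thesis using True neg_add_cancel[OF d neg_on_curve[OF on(3)] on(1)]
        by (cases R) simp_all
    next
      case QR: False
      obtain l where "is_slope E l x1 y1 x2 y2"
        using slope_exists[OF w(1,2)] PQ A add_neg_eq by metis
      moreover obtain m where "is_slope E m x2 y2 x3 y3"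
        using slope_exists[OF w(2,3)] QR A add_neg_eq by metis
      ultimately show ?thesis using add_assoc_affine[OF d w] A by blast
    qed
  qed
qed

section \<open>The field and its valuations\<close>

text \<open>\<open>KF a b c d\<close> stands for \<open>a + b i + (c + d i) \<phi>\<close> with \<open>\<phi> = (1 + sqrt 5) / 2\<close>.\<close>

codatatype kf = KF (k0: rat) (k1: rat) (k2: rat) (k3: rat)

lemma kf_eq_iff: "x = y \<longleftrightarrow> k0 x = k0 y \<and> k1 x = k1 y \<and> k2 x = k2 y \<and> k3 x = k3 y"
  by (auto intro: kf.expand)

instantiation kf :: comm_ring_1
begin

primcorec zero_kf where "k0 0 = 0" | "k1 0 = 0" | "k2 0 = 0" | "k3 0 = 0"
primcorec one_kf where "k0 1 = 1" | "k1 1 = 0" | "k2 1 = 0" | "k3 1 = 0"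
primcorec plus_kf where
  "k0 (x + y) = k0 x + k0 y" | "k1 (x + y) = k1 x + k1 y"
| "k2 (x + y) = k2 x + k2 y" | "k3 (x + y) = k3 x + k3 y"
primcorec uminus_kf where
  "k0 (- x) = - k0 x" | "k1 (- x) = - k1 x" | "k2 (- x) = - k2 x" | "k3 (- x) = - k3 x"
primcorec minus_kf where
  "k0 (x - y) = k0 x - k0 y" | "k1 (x - y) = k1 x - k1 y"
| "k2 (x - y) = k2 x - k2 y" | "k3 (x - y) = k3 x - k3 y"
primcorec times_kf where
  "k0 (x * y) = k0 x * k0 y - k1 x * k1 y + k2 x * k2 y - k3 x * k3 y"
| "k1 (x * y) = k0 x * k1 y + k1 x * k0 y + k2 x * k3 y + k3 x * k2 y"
| "k2 (x * y) = k0 x * k2 y - k1 x * k3 y + k2 x * k0 y - k3 x * k1 y + k2 x * k2 y - k3 x * k3 y"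
| "k3 (x * y) = k0 x * k3 y + k1 x * k2 y + k2 x * k1 y + k3 x * k0 y + k2 x * k3 y + k3 x * k2 y"

instance
  by standard (simp_all add: kf_eq_iff algebra_simps)

end

definition kconj :: "kf \<Rightarrow> kf" where "kconj x = KF (k0 x) (- k1 x) (k2 x) (- k3 x)"
definition ksig :: "kf \<Rightarrow> kf" where "ksig x = KF (k0 x + k2 x) (k1 x + k3 x) (- k2 x) (- k3 x)"
text \<open>The norm to the rationals in two stages: x times \<open>kconj x\<close> is p + q \<phi>,
  and p^2 + p q - q^2 is the norm of that element of Q(sqrt 5). The map \<open>ksig\<close> sends
  \<phi> to 1 - \<phi>.\<close>

definition knorm :: "kf \<Rightarrow> rat" where
  "knorm x = (let p = k0 x ^ 2 + k1 x ^ 2 + k2 x ^ 2 + k3 x ^ 2;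
     q = 2 * k0 x * k2 x + 2 * k1 x * k3 x + k2 x ^ 2 + k3 x ^ 2 in p ^ 2 + p * q - q ^ 2)"

lemma rat_sq_eq_5:
  fixes p q :: rat
  assumes "p ^ 2 = 5 * q ^ 2"
  shows "q = 0"
proof (rule ccontr)
  assume q: "q \<noteq> 0"
  obtain a b where ab: "quotient_of (p / q) = (a, b)" by fastforce
  have b: "b > 0" "coprime a b" "p / q = of_int a / of_int b"
    using quotient_of_denom_pos[OF ab] quotient_of_coprime[OF ab] quotient_of_div[OF ab] by auto
  have "(p / q) ^ 2 = 5" using assms q by (simp add: power_divide)
  then have "(of_int a :: rat) ^ 2 = 5 * of_int b ^ 2" using b by (simp add: field_simps)
  then have e: "a ^ 2 = 5 * b ^ 2"
    by (metis of_int_eq_iff of_int_mult of_int_numeral of_int_power)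
  have p5: "prime (5::int)" by simp
  have "5 dvd a" using e p5 by (metis dvd_triv_left prime_dvd_power)
  then obtain c where "a = 5 * c" by blast
  then have "b ^ 2 = 5 * c ^ 2" using e by (simp add: power2_eq_square)
  then have "5 dvd b" using p5 by (metis dvd_triv_left prime_dvd_power)
  then have "is_unit (5::int)" using coprime_common_divisor[OF b(2) \<open>5 dvd a\<close>] by simp
  then show False by simp
qed

lemma knorm_eq_0_iff [simp]: "knorm x = 0 \<longleftrightarrow> x = 0"
proof
  assume A: "knorm x = 0"
  define p where "p = k0 x ^ 2 + k1 x ^ 2 + k2 x ^ 2 + k3 x ^ 2"
  define q where "q = 2 * k0 x * k2 x + 2 * k1 x * k3 x + k2 x ^ 2 + k3 x ^ 2"
  have z: "p ^ 2 + p * q - q ^ 2 = 0" using A by (simp add: knorm_def p_def q_def Let_def)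
  \<comment> \<open>Four times the norm form with the square completed.\<close>
  then have "(2 * p + q) ^ 2 = 5 * q ^ 2" by Groebner_Basis.algebra
  then have "q = 0" by (rule rat_sq_eq_5)
  then have "p = 0" using z by simp
  then have "k0 x = 0 \<and> k1 x = 0 \<and> k2 x = 0 \<and> k3 x = 0"
    unfolding p_def using zero_le_power2[of "k0 x"] zero_le_power2[of "k1 x"]
      zero_le_power2[of "k2 x"] zero_le_power2[of "k3 x"]
    by (smt (verit, best) power2_eq_square mult_eq_0_iff power_zero_numeral add_nonneg_eq_0_iff add_nonneg_nonneg)
  then show "x = 0" by (simp add: kf_eq_iff)
qed (simp add: knorm_def)

text \<open>The product of the other three Galois conjugates, so that multiplication by x gives the
  norm.\<close>

definition kinv_aux :: "kf \<Rightarrow> kf" where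
  "kinv_aux x = kconj x * ksig x * ksig (kconj x)"

lemma kconj_hom:
  "kconj (x + y) = kconj x + kconj y" "kconj (x - y) = kconj x - kconj y" "kconj (- x) = - kconj x"
  "kconj (x * y) = kconj x * kconj y" "kconj 0 = 0" "kconj 1 = 1" "kconj (kconj x) = x"
  by (simp_all add: kf_eq_iff kconj_def algebra_simps)

lemma ksig_hom:
  "ksig (x + y) = ksig x + ksig y" "ksig (x - y) = ksig x - ksig y" "ksig (- x) = - ksig x"
  "ksig (x * y) = ksig x * ksig y" "ksig 0 = 0" "ksig 1 = 1" "ksig (ksig x) = x"
  by (simp_all add: kf_eq_iff ksig_def algebra_simps)

lemma kconj_ksig: "kconj (ksig x) = ksig (kconj x)"
  by (simp add: kf_eq_iff ksig_def kconj_def)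

lemma mult_kinv_aux: "x * kinv_aux x = KF (knorm x) 0 0 0"
proof -
  define p where "p = k0 x ^ 2 + k1 x ^ 2 + k2 x ^ 2 + k3 x ^ 2"
  define q where "q = 2 * k0 x * k2 x + 2 * k1 x * k3 x + k2 x ^ 2 + k3 x ^ 2"
  have e: "x * kconj x = KF p 0 q 0"
    by (simp add: kf_eq_iff kconj_def p_def q_def power2_eq_square)
  have "x * kinv_aux x = (x * kconj x) * ksig (x * kconj x)"
    unfolding kinv_aux_def ksig_hom by (simp add: mult.assoc)
  also have "\<dots> = KF (p ^ 2 + p * q - q ^ 2) 0 0 0"
    unfolding e by (simp add: kf_eq_iff ksig_def power2_eq_square algebra_simps)
  finally show ?thesis by (simp add: knorm_def p_def q_def Let_def)
qed

lemma KF_inverse: "r \<noteq> 0 \<Longrightarrow> KF r 0 0 0 * KF (1 / r) 0 0 0 = 1"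
  by (simp add: kf_eq_iff)

instantiation kf :: field_char_0
begin

definition inverse_kf :: "kf \<Rightarrow> kf" where
  "inverse x = kinv_aux x * KF (1 / knorm x) 0 0 0"
definition divide_kf :: "kf \<Rightarrow> kf \<Rightarrow> kf" where
  "x div y = x * inverse (y :: kf)"

lemma of_nat_kf: "of_nat n = KF (of_nat n) 0 0 0"
  by (induction n) (simp_all add: kf_eq_iff)

instance
proof
  fix x y :: kf
  show "x \<noteq> 0 \<Longrightarrow> inverse x * x = 1"
    using mult_kinv_aux[of x] KF_inverse[of "knorm x"]
    by (metis inverse_kf_def knorm_eq_0_iff mult.assoc mult.commute)
  show "x div y = x * inverse y" by (rule divide_kf_def)
  show "inverse (0::kf) = 0" by (simp add: inverse_kf_def kf_eq_iff knorm_def)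
  show "inj (of_nat :: nat \<Rightarrow> kf)" by (rule injI) (simp add: of_nat_kf)
qed

end

lemma k_of_nat [simp]: "k0 (of_nat n) = of_nat n" "k1 (of_nat n) = 0" "k2 (of_nat n) = 0" "k3 (of_nat n) = 0"
  by (simp_all add: of_nat_kf)
lemma k_numeral [simp]: "k0 (numeral n) = numeral n" "k1 (numeral n) = 0" "k2 (numeral n) = 0" "k3 (numeral n) = 0"
  using k_of_nat[of "numeral n"] by simp_all
lemma k_neg_numeral [simp]: "k0 (- numeral n) = - numeral n" "k1 (- numeral n) = 0" "k2 (- numeral n) = 0" "k3 (- numeral n) = 0"
  by simp_all

definition krat :: "rat \<Rightarrow> kf" where "krat r = KF r 0 0 0"
definition ki :: kf where "ki = KF 0 1 0 0"
definition kphi :: kf where "kphi = KF 0 0 1 0"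

text \<open>A prime element \<open>\<pi>\<close> of a subring whose field of fractions is the whole field defines a
  discrete valuation.\<close>

locale prime_element =
  fixes R :: "'a::field set" and \<pi> :: 'a
  assumes one_R: "1 \<in> R" and add_R: "x \<in> R \<Longrightarrow> y \<in> R \<Longrightarrow> x + y \<in> R"
    and mult_R: "x \<in> R \<Longrightarrow> y \<in> R \<Longrightarrow> x * y \<in> R" and minus_R: "x \<in> R \<Longrightarrow> - x \<in> R"
    and pi_R: "\<pi> \<in> R" and pi_nz: "\<pi> \<noteq> 0"
    and fraction: "\<exists>w m. w \<in> R \<and> m \<in> R \<and> m \<noteq> 0 \<and> x = w / m"
    and factor: "w \<in> R \<Longrightarrow> w \<noteq> 0 \<Longrightarrow> \<exists>j w'. w = \<pi> ^ j * w' \<and> w' \<in> R \<and> w' / \<pi> \<notin> R"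
    and prime_pi: "x \<in> R \<Longrightarrow> y \<in> R \<Longrightarrow> x / \<pi> \<notin> R \<Longrightarrow> y / \<pi> \<notin> R \<Longrightarrow> x * y / \<pi> \<notin> R"
    and one_pi: "1 / \<pi> \<notin> R"
begin

text \<open>Units of the localization of R at \<pi>. Divisibility of w by \<pi> is phrased inside
  the field, as w / \<pi> \<in> R.\<close>

definition local_units :: "'a set" where
  "local_units = {w / m | w m. w \<in> R \<and> m \<in> R \<and> w / \<pi> \<notin> R \<and> m / \<pi> \<notin> R}"

lemma zero_R: "0 \<in> R" using add_R[OF one_R minus_R[OF one_R]] by simp

lemma pi_power_R: "\<pi> ^ n \<in> R" by (induction n) (simp_all add: one_R mult_R pi_R)

lemma local_units_nz: "u \<in> local_units \<Longrightarrow> u \<noteq> 0"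
  unfolding local_units_def using zero_R by auto

lemma local_units_mult: "u \<in> local_units \<Longrightarrow> u' \<in> local_units \<Longrightarrow> u * u' \<in> local_units"
proof -
  assume "u \<in> local_units" "u' \<in> local_units"
  then obtain w m w' m' where "u = w / m" "w \<in> R" "m \<in> R" "w / \<pi> \<notin> R" "m / \<pi> \<notin> R"
    "u' = w' / m'" "w' \<in> R" "m' \<in> R" "w' / \<pi> \<notin> R" "m' / \<pi> \<notin> R"
    unfolding local_units_def by blast
  then show ?thesis unfolding local_units_def
    by (intro CollectI exI[of _ "w * w'"] exI[of _ "m * m'"]) (simp add: mult_R prime_pi)
qed

lemma local_units_inverse: "u \<in> local_units \<Longrightarrow> 1 / u \<in> local_units"
proof -
  assume "u \<in> local_units"
  then obtain w m where "u = w / m" "w \<in> R" "m \<in> R" "w / \<pi> \<notin> R" "m / \<pi> \<notin> R"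
    unfolding local_units_def by blast
  then show ?thesis unfolding local_units_def by (intro CollectI exI[of _ m] exI[of _ w]) simp
qed

lemma local_unitsI: "w \<in> R \<Longrightarrow> w / \<pi> \<notin> R \<Longrightarrow> w \<in> local_units"
  unfolding local_units_def using one_R one_pi
  by (intro CollectI exI[of _ w] exI[of _ 1]) simp

lemma pi_power_not_unit:
  assumes "n > 0" shows "\<pi> ^ n \<notin> local_units"
proof
  assume "\<pi> ^ n \<in> local_units"
  then obtain w m where A: "\<pi> ^ n = w / m" "w \<in> R" "m \<in> R" "w / \<pi> \<notin> R" "m / \<pi> \<notin> R"
    unfolding local_units_def by auto
  have "m \<noteq> 0" using A(5) zero_R by auto
  then have "w = \<pi> ^ n * m" using A(1) by (simp add: field_simps)
  then have "w / \<pi> = \<pi> ^ (n - 1) * m" using assms pi_nz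
    by (cases n) simp_all
  then show False using A pi_power_R mult_R by metis
qed

lemma decomposition:
  assumes "x \<noteq> 0"
  shows "\<exists>k::int. \<exists>u\<in>local_units. x = \<pi> powi k * u"
proof -
  obtain w m where A: "w \<in> R" "m \<in> R" "m \<noteq> 0" "x = w / m" using fraction by blast
  with assms have "w \<noteq> 0" by auto
  obtain j w' where w: "w = \<pi> ^ j * w'" "w' \<in> R" "w' / \<pi> \<notin> R" using factor[OF A(1) \<open>w \<noteq> 0\<close>] by blast
  obtain l m' where m: "m = \<pi> ^ l * m'" "m' \<in> R" "m' / \<pi> \<notin> R" using factor[OF A(2,3)] by blast
  have "w' / m' \<in> local_units" unfolding local_units_def using w m by blast
  moreover have "x = \<pi> powi (int j - int l) * (w' / m')"
    using A(4) w(1) m(1) pi_nz by (simp add: power_int_diff)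
  ultimately show ?thesis by blast
qed

lemma decomposition_unique:
  assumes "u \<in> local_units" "u' \<in> local_units" "\<pi> powi k * u = \<pi> powi l * u'"
  shows "k = l"
proof -
  have *: "\<not> k < l" if "u \<in> local_units" "u' \<in> local_units" "\<pi> powi k * u = \<pi> powi l * u'" for u u' k l
  proof
    assume "k < l"
    have "u = \<pi> powi (l - k) * u'" using that(3) pi_nz by (simp add: power_int_diff field_simps)
    then have "\<pi> powi (l - k) = u * (1 / u')" using local_units_nz[OF that(2)] by (simp add: field_simps)
    then have "\<pi> ^ nat (l - k) \<in> local_units"
      using \<open>k < l\<close> local_units_mult[OF that(1) local_units_inverse[OF that(2)]] by (simp add: power_int_def)
    then show False using pi_power_not_unit[of "nat (l - k)"] \<open>k < l\<close> by simp
  qed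
  from *[OF assms] *[OF assms(2,1) assms(3)[symmetric]] show ?thesis by simp
qed

text \<open>The value at 0 is unspecified; \<open>vge\<close> below restores the convention that 0
  has infinite valuation.\<close>

definition val :: "'a \<Rightarrow> int" where
  "val x = (THE k. \<exists>u\<in>local_units. x = \<pi> powi k * u)"

lemma valI: "u \<in> local_units \<Longrightarrow> x = \<pi> powi k * u \<Longrightarrow> val x = k"
  unfolding val_def
  by (rule the_equality, blast) (metis decomposition_unique)

lemma val_eq:
  assumes "x \<noteq> 0" shows "\<exists>u\<in>local_units. x = \<pi> powi (val x) * u"
proof -
  obtain k u where "u \<in> local_units" "x = \<pi> powi k * u" using decomposition[OF assms] by blast
  with valI[OF this] show ?thesis by blast
qed

lemma val_mult:
  assumes "x \<noteq> 0" "y \<noteq> 0" shows "val (x * y) = val x + val y"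
proof -
  obtain u where u: "u \<in> local_units" "x = \<pi> powi (val x) * u" using val_eq assms(1) by blast
  obtain u' where u': "u' \<in> local_units" "y = \<pi> powi (val y) * u'" using val_eq assms(2) by blast
  have "x * y = (\<pi> powi (val x) * u) * (\<pi> powi (val y) * u')"
    by (simp only: u(2)[symmetric] u'(2)[symmetric])
  also have "\<dots> = \<pi> powi (val x + val y) * (u * u')"
    using pi_nz by (simp add: power_int_add)
  finally show ?thesis by (intro valI[of "u * u'"] local_units_mult u(1) u'(1))
qed

lemma val_R: "w \<in> R \<Longrightarrow> w \<noteq> 0 \<Longrightarrow> val w \<ge> 0"
proof -
  assume "w \<in> R" "w \<noteq> 0"
  then obtain j w' where w: "w = \<pi> ^ j * w'" "w' \<in> R" "w' / \<pi> \<notin> R" using factor by blast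
  then have "val w = int j" using valI[of w' w "int j"] local_unitsI by simp
  then show ?thesis by simp
qed

lemma val_unit: "w \<in> R \<Longrightarrow> w / \<pi> \<notin> R \<Longrightarrow> val w = 0"
  using valI[of w w 0] local_unitsI by simp

lemma val_pi: "val \<pi> = 1"
  using valI[of 1 \<pi> 1] local_unitsI one_R one_pi by simp

lemma val_add_aux:
  assumes nz: "x \<noteq> 0" "y \<noteq> 0" "x + y \<noteq> 0" and le: "val x \<le> val y"
  shows "val x \<le> val (x + y)"
proof -
  define a where "a = val x"
  define n where "n = nat (val y - val x)"
  have b: "val y = a + int n" using le by (simp add: n_def a_def)
  obtain u where U: "u \<in> local_units" "x = \<pi> powi a * u"
    using val_eq[OF nz(1)] unfolding a_def by blast
  obtain u' where U': "u' \<in> local_units" "y = \<pi> powi (a + int n) * u'"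
    using val_eq[OF nz(2)] unfolding b by blast
  obtain w m where u: "u = w / m" "w \<in> R" "m \<in> R" "m / \<pi> \<notin> R"
    using U unfolding local_units_def by blast
  obtain w' m' where u': "u' = w' / m'" "w' \<in> R" "m' \<in> R" "m' / \<pi> \<notin> R"
    using U' unfolding local_units_def by blast
  have m: "m \<noteq> 0" "m' \<noteq> 0" using u(4) u'(4) zero_R by auto
  \<comment> \<open>The numerator of the sum over the common denominator, after the smaller power of
    \<pi> is taken out. It lies in R, so its valuation is nonnegative.\<close>
  define z where "z = w * m' + \<pi> ^ n * w' * m"
  have "y = \<pi> powi a * (\<pi> ^ n * u')" unfolding U'(2) using pi_nz by (simp add: power_int_add)
  then have e: "x + y = \<pi> powi a * (z * (1 / (m * m')))"
    unfolding U(2) u(1) u'(1) z_def using m by (simp add: field_simps)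
  have z: "z \<in> R" using u u' by (simp add: z_def add_R mult_R pi_power_R)
  have z0: "z \<noteq> 0" using e nz(3) by auto
  have "m * m' \<in> R" "m * m' / \<pi> \<notin> R" using u u' mult_R prime_pi by auto
  then have 1: "val (1 / (m * m')) = 0"
    using valI[of "1 / (m * m')" "1 / (m * m')" 0] local_units_inverse local_unitsI by simp
  have 2: "1 / (m * m') \<noteq> 0" using m by simp
  have 3: "val (\<pi> powi a) = a"
    using valI[of 1 "\<pi> powi a" a] local_unitsI[OF one_R one_pi] by simp
  have 4: "\<pi> powi a \<noteq> 0" using pi_nz by simp
  have "val (x + y) = a + (val z + 0)"
    unfolding e by (simp only: val_mult[OF 4] val_mult[OF z0 2] mult_eq_0_iff z0 2 1 3 simp_thms)
  then show ?thesis using val_R[OF z z0] by (simp add: a_def)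
qed

lemma val_add:
  assumes "x \<noteq> 0" "y \<noteq> 0" "x + y \<noteq> 0"
  shows "min (val x) (val y) \<le> val (x + y)"
  using val_add_aux[OF assms] val_add_aux[OF assms(2,1)] assms(3) by (simp add: add.commute min_def)

end

section \<open>Torsion and the kernel of reduction\<close>

definition field_closed :: "'a::field set \<Rightarrow> bool" where
  "field_closed K \<longleftrightarrow> 1 \<in> K \<and> (\<forall>x\<in>K. \<forall>y\<in>K. x - y \<in> K \<and> x * y \<in> K) \<and> (\<forall>x\<in>K. inverse x \<in> K)"

lemma field_closed_UNIV [simp]: "field_closed UNIV" by (simp add: field_closed_def)

lemma field_closed_simps:
  assumes "field_closed K"
  shows "1 \<in> K" "0 \<in> K" "x \<in> K \<Longrightarrow> y \<in> K \<Longrightarrow> x - y \<in> K" "x \<in> K \<Longrightarrow> y \<in> K \<Longrightarrow> x * y \<in> K"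
    "x \<in> K \<Longrightarrow> - x \<in> K" "x \<in> K \<Longrightarrow> y \<in> K \<Longrightarrow> x + y \<in> K" "x \<in> K \<Longrightarrow> y \<in> K \<Longrightarrow> x / y \<in> K"
    "x \<in> K \<Longrightarrow> x ^ n \<in> K" "numeral k \<in> K"
proof -
  show 1: "1 \<in> K" and d: "\<And>x y. x \<in> K \<Longrightarrow> y \<in> K \<Longrightarrow> x - y \<in> K"
    and m: "\<And>x y. x \<in> K \<Longrightarrow> y \<in> K \<Longrightarrow> x * y \<in> K"
    using assms by (auto simp: field_closed_def)
  show 0: "0 \<in> K" using d[OF 1 1] by simp
  show n: "\<And>x. x \<in> K \<Longrightarrow> - x \<in> K" using d[OF 0] by fastforce
  show a: "\<And>x y. x \<in> K \<Longrightarrow> y \<in> K \<Longrightarrow> x + y \<in> K" using d n by (metis diff_minus_eq_add)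
  show "x \<in> K \<Longrightarrow> y \<in> K \<Longrightarrow> x / y \<in> K"
    using assms m by (simp add: field_closed_def divide_inverse)
  show "x \<in> K \<Longrightarrow> x ^ n \<in> K" by (induction n) (simp_all add: 1 m)
  show "numeral k \<in> K" by (induction k) (simp_all only: numeral.simps 1 a)
qed

lemma mw_carrier:
  "P \<in> carrier (mordell_weil_group K E) \<longleftrightarrow>
     on_curve E P \<and> (case P of Infinity \<Rightarrow> True | Affine x y \<Rightarrow> x \<in> K \<and> y \<in> K)"
  by (cases P) (auto simp: mordell_weil_group_def)

lemma mw_simps [simp]:
  "x \<otimes>\<^bsub>mordell_weil_group K E\<^esub> y = point_add E x y" "\<one>\<^bsub>mordell_weil_group K E\<^esub> = Infinity"
  by (simp_all add: mordell_weil_group_def)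

lemma point_add_closed:
  assumes K: "field_closed K" and c: "{a1 E, a2 E, a3 E, a4 E, a6 E} \<subseteq> K"
    and "P \<in> carrier (mordell_weil_group K E)" "Q \<in> carrier (mordell_weil_group K E)"
  shows "point_add E P Q \<in> carrier (mordell_weil_group K E)"
proof (cases P)
  case P: (Affine x1 y1)
  show ?thesis
  proof (cases Q)
    case Q: (Affine x2 y2)
    have on: "on_curve E (point_add E P Q)" using assms by (intro add_on_curve) (simp_all add: mw_carrier)
    have "x1 \<in> K" "y1 \<in> K" "x2 \<in> K" "y2 \<in> K" using assms P Q by (auto simp: mw_carrier)
    then show ?thesis using on c unfolding mw_carrier P Q
      by (auto simp: Let_def field_closed_simps[OF K])
  qed (use assms in simp)
qed (use assms in simp)

lemma mw_comm_group:
  assumes K: "field_closed K" and c: "{a1 E, a2 E, a3 E, a4 E, a6 E} \<subseteq> K" and d: "discriminant E \<noteq> 0"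
  shows "comm_group (mordell_weil_group K E)"
proof (rule comm_groupI)
  fix P Q R
  assume P: "P \<in> carrier (mordell_weil_group K E)"
  show "\<exists>Q\<in>carrier (mordell_weil_group K E). Q \<otimes>\<^bsub>mordell_weil_group K E\<^esub> P = \<one>\<^bsub>mordell_weil_group K E\<^esub>"
  proof (rule bexI)
    have on: "on_curve E P" "on_curve E (point_neg E P)" using P neg_on_curve by (auto simp: mw_carrier)
    show "point_neg E P \<otimes>\<^bsub>mordell_weil_group K E\<^esub> P = \<one>\<^bsub>mordell_weil_group K E\<^esub>"
      using add_comm[OF d on] add_neg[of E P] by simp
    show "point_neg E P \<in> carrier (mordell_weil_group K E)"
      using on P c by (cases P) (auto simp: mw_carrier field_closed_simps[OF K])
  qed
  assume Q: "Q \<in> carrier (mordell_weil_group K E)"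
  show "P \<otimes>\<^bsub>mordell_weil_group K E\<^esub> Q \<in> carrier (mordell_weil_group K E)"
    using point_add_closed[OF K c P Q] by simp
  show "P \<otimes>\<^bsub>mordell_weil_group K E\<^esub> Q = Q \<otimes>\<^bsub>mordell_weil_group K E\<^esub> P"
    using add_comm[OF d] P Q by (simp add: mw_carrier)
  assume R: "R \<in> carrier (mordell_weil_group K E)"
  show "P \<otimes>\<^bsub>mordell_weil_group K E\<^esub> Q \<otimes>\<^bsub>mordell_weil_group K E\<^esub> R
    = P \<otimes>\<^bsub>mordell_weil_group K E\<^esub> (Q \<otimes>\<^bsub>mordell_weil_group K E\<^esub> R)"
    using add_assoc[OF d] P Q R by (simp add: mw_carrier)
qed (simp_all add: mw_carrier)

abbreviation MW :: "'a::field weierstrass \<Rightarrow> 'a point monoid" where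
  "MW E \<equiv> mordell_weil_group UNIV E"

lemma MW_carrier [simp]: "P \<in> carrier (MW E) \<longleftrightarrow> on_curve E P"
  by (cases P) (auto simp: mw_carrier)

lemma MW_comm_group: "discriminant E \<noteq> 0 \<Longrightarrow> comm_group (MW E)"
  by (rule mw_comm_group) simp_all

lemma MW_group: "discriminant E \<noteq> 0 \<Longrightarrow> group (MW E)"
  using MW_comm_group comm_group.axioms(2) by blast

lemma MW_inv:
  assumes "discriminant E \<noteq> 0" "on_curve E P"
  shows "inv\<^bsub>MW E\<^esub> P = point_neg E P"
proof (rule group.inv_equality[OF MW_group[OF assms(1)]])
  show "point_neg E P \<otimes>\<^bsub>MW E\<^esub> P = \<one>\<^bsub>MW E\<^esub>"
    using add_comm[OF assms neg_on_curve[OF assms(2)]] add_neg[of E P] by simp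
qed (simp_all add: assms neg_on_curve)

section \<open>Torsion elements\<close>

definition is_torsion :: "('a, 'b) monoid_scheme \<Rightarrow> 'a \<Rightarrow> bool" where
  "is_torsion G x \<longleftrightarrow> (\<exists>n::nat. n > 0 \<and> x [^]\<^bsub>G\<^esub> n = \<one>\<^bsub>G\<^esub>)"

lemma (in comm_group) torsion_mult:
  assumes "x \<in> carrier G" "y \<in> carrier G" "is_torsion G x" "is_torsion G y"
  shows "is_torsion G (x \<otimes> y)"
proof -
  obtain m n :: nat where m: "m > 0" "x [^] m = \<one>" and n: "n > 0" "y [^] n = \<one>"
    using assms unfolding is_torsion_def by blast
  have "x [^] (m * n) = \<one>" using m assms by (simp add: nat_pow_pow[symmetric])
  moreover have "y [^] (m * n) = \<one>" using n assms by (simp add: nat_pow_pow[symmetric] mult.commute[of m])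
  ultimately have "(x \<otimes> y) [^] (m * n) = \<one>" using assms by (simp add: pow_mult_distrib m_comm)
  then show ?thesis unfolding is_torsion_def using m n by (metis nat_0_less_mult_iff)
qed

lemma (in group) torsion_inv:
  assumes "x \<in> carrier G" "is_torsion G x"
  shows "is_torsion G (inv x)"
  using assms unfolding is_torsion_def by (metis inv_one nat_pow_inv)

lemma (in group) torsion_one [simp]: "is_torsion G \<one>"
  unfolding is_torsion_def by (metis nat_pow_one zero_less_one)

text \<open>A torsion point has a finite orbit under multiplication by \<open>m\<close>.\<close>

lemma (in group) no_torsion_if_descending:
  fixes \<mu> :: "'a \<Rightarrow> int" and m :: nat
  assumes S: "\<And>x. x \<in> S \<Longrightarrow> x \<in> carrier G"
    and step: "\<And>x. x \<in> S \<Longrightarrow> x [^] m \<in> S \<and> \<mu> (x [^] m) < \<mu> x"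
    and x: "x \<in> S"
  shows "\<not> is_torsion G x"
proof
  assume "is_torsion G x"
  then obtain n :: nat where n: "n > 0" "x [^] n = \<one>" unfolding is_torsion_def by blast
  define f where "f k = x [^] (m ^ k)" for k :: nat
  have f: "f k \<in> S \<and> \<mu> (f (Suc k)) < \<mu> (f k)" for k
  proof -
    have "f k \<in> S"
    proof (induction k)
      case (Suc k)
      have "f (Suc k) = f k [^] m" unfolding f_def using x S by (simp add: nat_pow_pow mult.commute)
      then show ?case using step Suc by simp
    qed (use x S in \<open>simp add: f_def\<close>)
    moreover have "f (Suc k) = f k [^] m" unfolding f_def using x S by (simp add: nat_pow_pow mult.commute)
    ultimately show ?thesis using step by simp
  qed
  have "strict_mono (\<lambda>k. - \<mu> (f k))" using f by (simp add: strict_mono_Suc_iff)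
  then have "inj (\<lambda>k. - \<mu> (f k))" by (rule strict_mono_imp_inj_on)
  then have "inj f" unfolding inj_def by metis
  have "f k \<in> (\<lambda>i. x [^] i) ` {..<n}" for k
  proof -
    have "x [^] (m ^ k) = x [^] (n * (m ^ k div n) + m ^ k mod n)" by simp
    also have "\<dots> = (x [^] n) [^] (m ^ k div n) \<otimes> x [^] (m ^ k mod n)"
      using x S by (simp only: nat_pow_mult nat_pow_pow)
    also have "\<dots> = x [^] (m ^ k mod n)" using n x S by simp
    finally show ?thesis unfolding f_def using n by auto
  qed
  then have "range f \<subseteq> (\<lambda>i. x [^] i) ` {..<n}" by blast
  then have "finite (range f)" by (rule finite_subset) simp
  then show False using \<open>inj f\<close> by (simp add: finite_image_iff)
qed

text \<open>The classical duplication formula with its denominator cleared. The denominator equals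
  (2 y + c1 x + c3)^2 on the curve, which is what removes the slope l.\<close>

lemma duplication_poly:
  fixes x y c1 c2 c3 c4 c6 l z :: "'a::field"
  assumes on: "y^2 + c1*x*y + c3*y - (x^3 + c2*x^2 + c4*x + c6) = 0"
    and l: "l * (y + y + c1*x + c3) = x^2 + x*x + x^2 + c2*(x+x) + c4 - c1*y"
    and z: "z = l^2 + c1*l - c2 - x - x"
  shows "z * (4*x^3 + (c1^2+4*c2)*x^2 + 2*(2*c4+c1*c3)*x + (c3^2+4*c6))
    = x^4 - (2*c4+c1*c3)*x^2 - 2*(c3^2+4*c6)*x
      - (c1^2*c6+4*c2*c6-c1*c3*c4+c2*c3^2-c4^2)"
proof -
  define d where "d = 2*y + c1*x + c3"
  define n where "n = 3*x^2 + 2*c2*x + c4 - c1*y"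
  have ln: "l * d = n" unfolding d_def n_def using l by Groebner_Basis.algebra
  have d2: "4*x^3 + (c1^2+4*c2)*x^2 + 2*(2*c4+c1*c3)*x + (c3^2+4*c6) = d^2"
    unfolding d_def using on by Groebner_Basis.algebra
  have "z * d^2 = n^2 + c1*n*d - (c2+2*x)*d^2" unfolding z ln[symmetric] by Groebner_Basis.algebra
  also have "\<dots> = x^4 - (2*c4+c1*c3)*x^2 - 2*(c3^2+4*c6)*x
      - (c1^2*c6+4*c2*c6-c1*c3*c4+c2*c3^2-c4^2)"
    unfolding d_def n_def using on by Groebner_Basis.algebra
  finally show ?thesis unfolding d2 .
qed

text \<open>Expresses x(P + Q) x(P - Q) through x(P) and x(Q). For Q = 2 P the difference is -P, so
  this yields x(3 P) without a tripling formula.\<close>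

lemma sum_difference_poly:
  fixes x y x' y' c1 c2 c3 c4 c6 l m z w :: "'a::field"
  assumes on: "y^2 + c1*x*y + c3*y - (x^3 + c2*x^2 + c4*x + c6) = 0"
    "y'^2 + c1*x'*y' + c3*y' - (x'^3 + c2*x'^2 + c4*x' + c6) = 0"
    and l: "l * (x' - x) = y' - y" and m: "m * (x' - x) = (- y' - c1*x' - c3) - y"
    and z: "z = l^2 + c1*l - c2 - x - x'" and w: "w = m^2 + c1*m - c2 - x - x'" and ne: "x \<noteq> x'"
  shows "z * w * (x - x')^2 = (x*x')^2 - (2*c4+c1*c3)*(x*x') - (c3^2+4*c6)*(x+x')
    - (c1^2*c6+4*c2*c6-c1*c3*c4+c2*c3^2-c4^2)" (is "_ = ?r")
proof -
  define n where "n = - y' - c1*x' - c3"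
  define d where "d = x' - x"
  have x': "x' = x + d" by (simp add: d_def)
  have a: "z * d^2 = (y'-y)^2 + c1*(y'-y)*d - (c2+x+x')*d^2"
    unfolding z using l[folded d_def] by Groebner_Basis.algebra
  have b: "w * d^2 = (n-y)^2 + c1*(n-y)*d - (c2+x+x')*d^2"
    unfolding w using m[folded d_def n_def] by Groebner_Basis.algebra
  have "((y'-y)^2 + c1*(y'-y)*d - (c2+x+x')*d^2) * ((n-y)^2 + c1*(n-y)*d - (c2+x+x')*d^2) = ?r * d^2"
    unfolding d_def n_def using on by Groebner_Basis.algebra
  then have "(z * w * (x - x')^2 - ?r) * d^2 = 0"
    using a b x' by Groebner_Basis.algebra
  then show ?thesis using ne by (simp add: d_def)
qed

definition wb2 :: "'a::field weierstrass \<Rightarrow> 'a" where "wb2 E = a1 E ^ 2 + 4 * a2 E"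
definition wb4 :: "'a::field weierstrass \<Rightarrow> 'a" where "wb4 E = 2 * a4 E + a1 E * a3 E"
definition wb6 :: "'a::field weierstrass \<Rightarrow> 'a" where "wb6 E = a3 E ^ 2 + 4 * a6 E"
definition wb8 :: "'a::field weierstrass \<Rightarrow> 'a" where
  "wb8 E = a1 E ^ 2 * a6 E + 4 * a2 E * a6 E - a1 E * a3 E * a4 E + a2 E * a3 E ^ 2 - a4 E ^ 2"

lemma double_x:
  assumes "weierstrass_eval E x y = 0" "point_add E (Affine x y) (Affine x y) = Affine z w"
  shows "z * (4*x^3 + wb2 E*x^2 + 2*wb4 E*x + wb6 E) = x^4 - wb4 E*x^2 - 2*wb6 E*x - wb8 E"
proof -
  have "\<not> (x = x \<and> y = - y - a1 E * x - a3 E)" using assms(2) add_neg_eq[of x x y y E] by auto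
  then obtain l where l: "is_slope E l x y x y" "Affine z w = chord_sum E l x y x"
    using slope_exists[OF assms(1,1)] assms(2) by auto
  show ?thesis unfolding wb2_def wb4_def wb6_def wb8_def
    by (rule duplication_poly[of y _ _ _ _ _ _ l])
      (use l assms(1) in \<open>simp_all add: is_slope_def weierstrass_eval_def chord_sum_def third_x_def\<close>)
qed

lemma two_torsion_poly:
  assumes "weierstrass_eval E x y = 0"
  shows "4*x^3 + wb2 E*x^2 + 2*wb4 E*x + wb6 E = (2*y + a1 E*x + a3 E)^2"
proof -
  have *: "4*x^3 + (c1^2+4*c2)*x^2 + 2*(2*c4+c1*c3)*x + (c3^2+4*c6) = (2*y+c1*x+c3)^2"
    if "y^2 + c1*x*y + c3*y - (x^3 + c2*x^2 + c4*x + c6) = 0" for c1 c2 c3 c4 c6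
    using that by Groebner_Basis.algebra
  show ?thesis using assms unfolding wb2_def wb4_def wb6_def weierstrass_eval_def by (rule *)
qed

lemma double_Infinity:
  fixes E :: "'a::field weierstrass"
  assumes "point_add E (Affine x y) (Affine x y) = Infinity" "weierstrass_eval E x y = 0"
  shows "2*y + a1 E*x + a3 E = 0" "4*x^3 + wb2 E*x^2 + 2*wb4 E*x + wb6 E = 0"
proof -
  have "y = - y - a1 E * x - a3 E"
    using assms add_eq_Infinity_iff[of E "Affine x y" "Affine x y"] by simp
  then show "2*y + a1 E*x + a3 E = 0" by Groebner_Basis.algebra
  then show "4*x^3 + wb2 E*x^2 + 2*wb4 E*x + wb6 E = 0" by (simp add: two_torsion_poly[OF assms(2)])
qed

lemma sum_difference_x:
  assumes on: "weierstrass_eval E x y = 0" "weierstrass_eval E x' y' = 0" and ne: "x \<noteq> x'"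
    and s: "point_add E (Affine x y) (Affine x' y') = Affine z z'"
    and d: "point_add E (Affine x y) (point_neg E (Affine x' y')) = Affine w w'"
  shows "z * w * (x - x')^2 = (x*x')^2 - wb4 E*(x*x') - wb6 E*(x+x') - wb8 E"
proof -
  have on': "weierstrass_eval E x' (- y' - a1 E * x' - a3 E) = 0"
    using neg_on_curve[of E "Affine x' y'"] on by simp
  obtain l where l: "is_slope E l x y x' y'" "Affine z z' = chord_sum E l x y x'"
    using slope_exists[OF on] ne s by auto
  obtain m where m: "is_slope E m x y x' (- y' - a1 E * x' - a3 E)" "Affine w w' = chord_sum E m x y x'"
    using slope_exists[OF on(1) on'] ne d by auto
  show ?thesis unfolding wb4_def wb6_def wb8_def
    by (rule sum_difference_poly[of y _ _ _ _ _ _ y' x' l m])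
      (use l m on ne in \<open>simp_all add: is_slope_def weierstrass_eval_def chord_sum_def third_x_def\<close>)
qed

section \<open>Multiplication in the kernel of reduction\<close>

context prime_element
begin

definition vge :: "int \<Rightarrow> 'a \<Rightarrow> bool" where
  "vge n x \<longleftrightarrow> x = 0 \<or> n \<le> val x"

lemma vge_0 [simp]: "vge n 0" by (simp add: vge_def)

lemma vge_val [simp]: "vge (val x) x" by (simp add: vge_def)

lemma vge_mono: "vge n x \<Longrightarrow> m \<le> n \<Longrightarrow> vge m x" by (auto simp: vge_def)

lemma vge_add: "vge n x \<Longrightarrow> vge n y \<Longrightarrow> vge n (x + y)"
  using val_add[of x y] by (cases "x = 0"; cases "y = 0"; cases "x + y = 0") (auto simp: vge_def)

lemma vge_mult: "vge m x \<Longrightarrow> vge n y \<Longrightarrow> vge (m + n) (x * y)"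
  by (cases "x = 0"; cases "y = 0") (auto simp: vge_def val_mult)

lemma vge_R: "x \<in> R \<Longrightarrow> vge 0 x" using val_R by (auto simp: vge_def)

lemma val_uminus [simp]: "val (- x) = val x"
proof (cases "x = 0")
  case False
  have m: "- 1 \<in> R" using one_R minus_R by simp
  have "val (- 1) \<ge> 0" using val_R[OF m] by simp
  moreover have "val ((- 1) * (- 1)) = val (- 1) + val (- 1)" by (rule val_mult) simp_all
  moreover have "val 1 = 0" using val_unit one_R one_pi by blast
  ultimately have "val (- 1) = 0" by simp
  then show ?thesis using val_mult[of "- 1" x] False by simp
qed simp

lemma vge_uminus [simp]: "vge n (- x) \<longleftrightarrow> vge n x" by (simp add: vge_def)

lemma vge_diff: "vge n x \<Longrightarrow> vge n y \<Longrightarrow> vge n (x - y)"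
  using vge_add[of n x "- y"] by simp

lemma vge_mult0: "vge 0 x \<Longrightarrow> vge n y \<Longrightarrow> vge n (x * y)"
  using vge_mult[of 0 x n y] by simp

lemma val_one [simp]: "val 1 = 0" using val_unit one_R one_pi by blast

lemma vge_power: "vge n x \<Longrightarrow> vge (int k * n) (x ^ k)"
proof (induction k)
  case (Suc k)
  have "vge (n + int k * n) (x * x ^ k)" by (intro vge_mult Suc)
  then show ?case by (simp add: algebra_simps)
qed (simp add: vge_def)

lemma val_power: "x \<noteq> 0 \<Longrightarrow> val (x ^ k) = int k * val x"
  by (induction k) (simp_all add: val_mult algebra_simps)

lemma vge_numeral: "vge 0 (numeral k)"
proof (rule vge_R)
  show "numeral k \<in> R" by (induction k) (simp_all only: numeral.simps add_R one_R)
qed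

lemma val_dominant:
  assumes "x \<noteq> 0" "vge (val x + 1) y"
  shows "x + y \<noteq> 0" "val (x + y) = val x"
proof -
  show nz: "x + y \<noteq> 0"
  proof
    assume "x + y = 0"
    then have "y = - x" by (simp add: eq_neg_iff_add_eq_0 add.commute)
    then show False using assms by (simp add: vge_def)
  qed
  have "val x \<le> val (x + y)" using vge_add[of "val x" x y] assms nz vge_mono[OF assms(2)] by (simp add: vge_def)
  moreover have "\<not> val x + 1 \<le> val (x + y)"
  proof
    assume "val x + 1 \<le> val (x + y)"
    then have "vge (val x + 1) (x + y - y)" using assms by (intro vge_diff) (simp_all add: vge_def)
    then show False using assms(1) by (simp add: vge_def)
  qed
  ultimately show "val (x + y) = val x" by simp
qed

text \<open>The affine points that reduce to the point at infinity.\<close>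

definition kernel_points :: "'a weierstrass \<Rightarrow> 'a point set" where
  "kernel_points E = {Affine x y | x y. weierstrass_eval E x y = 0 \<and> x \<noteq> 0 \<and> val x < 0}"

definition integral_curve :: "'a weierstrass \<Rightarrow> bool" where
  "integral_curve E \<longleftrightarrow> vge 0 (a1 E) \<and> vge 0 (a2 E) \<and> vge 0 (a3 E) \<and> vge 0 (a4 E) \<and> vge 0 (a6 E)"

lemma integral_b:
  assumes "integral_curve E"
  shows "vge 0 (wb2 E)" "vge 0 (wb4 E)" "vge 0 (wb6 E)" "vge 0 (wb8 E)"
  using assms unfolding integral_curve_def wb2_def wb4_def wb6_def wb8_def power2_eq_square
  by (auto intro!: vge_add vge_diff vge_mult0 vge_numeral)

lemma val_double_numerator:
  assumes "integral_curve E" "x \<noteq> 0" "val x < 0"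
  shows "x^4 - wb4 E*x^2 - 2*wb6 E*x - wb8 E \<noteq> 0" "val (x^4 - wb4 E*x^2 - 2*wb6 E*x - wb8 E) = 4 * val x"
proof -
  note b = integral_b[OF assms(1)]
  have m: "vge (2 * val x) x" "vge (2 * val x) (wb8 E)"
    using vge_mono[OF vge_val, of "2 * val x" x] vge_mono[OF b(4), of "2 * val x"] assms(3) by auto
  have "vge (2 * val x) (- (wb4 E*x^2 + 2*wb6 E*x + wb8 E))"
    unfolding vge_uminus
    using vge_power[OF vge_val, of 2 x] b m
    by (intro vge_add) (auto intro!: vge_mult0 vge_numeral simp: mult.assoc)
  then have 1: "vge (val (x^4) + 1) (- (wb4 E*x^2 + 2*wb6 E*x + wb8 E))"
    by (rule vge_mono) (use assms in \<open>simp add: val_power\<close>)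
  have e: "x^4 + - (wb4 E*x^2 + 2*wb6 E*x + wb8 E) = x^4 - wb4 E*x^2 - 2*wb6 E*x - wb8 E" by simp
  show "x^4 - wb4 E*x^2 - 2*wb6 E*x - wb8 E \<noteq> 0" "val (x^4 - wb4 E*x^2 - 2*wb6 E*x - wb8 E) = 4 * val x"
    using val_dominant[OF _ 1] assms(2) unfolding e by (simp_all add: val_power)
qed

lemma vge_double_denominator:
  assumes "integral_curve E" "x \<noteq> 0" "val x < 0" "vge 1 4"
  shows "vge (3 * val x + 1) (4*x^3 + wb2 E*x^2 + 2*wb4 E*x + wb6 E)"
proof -
  note b = integral_b[OF assms(1)]
  have "vge (1 + 3 * val x) (4 * x^3)" by (intro vge_mult assms) (use vge_power[OF vge_val, of 3 x] in simp)
  moreover have "vge (3 * val x + 1) (wb2 E*x^2)"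
    by (intro vge_mult0 b, rule vge_mono[OF vge_power[OF vge_val]]) (use assms in simp)
  moreover have "vge (3 * val x + 1) (2*wb4 E*x)" unfolding mult.assoc
    by (intro vge_mult0 vge_numeral b, rule vge_mono[OF vge_val]) (use assms in simp)
  moreover have "vge (3 * val x + 1) (wb6 E)"
    by (rule vge_mono[OF b(3)]) (use assms in simp)
  ultimately show ?thesis by (intro vge_add) (simp_all add: add.commute)
qed

text \<open>For v = val x < 0 the numerator of the duplication formula has valuation 4 v, from x^4,
  and the denominator at least 3 v + 1, because \<pi> divides 4.\<close>

lemma double_kernel_descending:
  assumes E: "integral_curve E" and v: "vge 1 4" and on: "weierstrass_eval E x y = 0"
    and x: "x \<noteq> 0" "val x < 0" and d: "point_add E (Affine x y) (Affine x y) = Affine z w"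
  shows "z \<noteq> 0" "val z < val x"
proof -
  define den where "den = 4*x^3 + wb2 E*x^2 + 2*wb4 E*x + wb6 E"
  define num where "num = x^4 - wb4 E*x^2 - 2*wb6 E*x - wb8 E"
  have e: "z * den = num" unfolding den_def num_def by (rule double_x[OF on d])
  have n: "num \<noteq> 0" "val num = 4 * val x" unfolding num_def using val_double_numerator[OF E x] by blast+
  show z: "z \<noteq> 0" using e n by auto
  have den: "den \<noteq> 0" using e n by auto
  have "vge (3 * val x + 1) den" unfolding den_def by (rule vge_double_denominator[OF E x v])
  then have "3 * val x + 1 \<le> val den" using den by (simp add: vge_def)
  then show "val z < val x" using val_mult[OF z den] e n(2) by simp
qed

text \<open>y^2 and x^3 are the dominant terms of the equation. What is used later is that val x is
  even, hence at most -2.\<close>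

lemma val_kernel_le:
  assumes E: "integral_curve E" and on: "weierstrass_eval E x y = 0" and x: "x \<noteq> 0" "val x < 0"
  shows "y \<noteq> 0" "2 * val y = 3 * val x"
proof -
  have c: "vge 0 (a1 E)" "vge 0 (a2 E)" "vge 0 (a3 E)" "vge 0 (a4 E)" "vge 0 (a6 E)"
    using E by (auto simp: integral_curve_def)
  have "vge (2 * val x) (a2 E * x^2 + a4 E * x + a6 E)"
    using vge_power[OF vge_val, of 2 x] vge_mono[OF vge_val, of "2 * val x" x] x
      vge_mono[OF c(5), of "2 * val x"] by (intro vge_add vge_mult0 c) auto
  then have "vge (val (x^3) + 1) (a2 E * x^2 + a4 E * x + a6 E)"
    by (rule vge_mono) (use x in \<open>simp add: val_power\<close>)
  from val_dominant[OF _ this] x have rhs: "x^3 + (a2 E * x^2 + a4 E * x + a6 E) \<noteq> 0"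
    "val (x^3 + (a2 E * x^2 + a4 E * x + a6 E)) = 3 * val x" by (simp_all add: val_power)
  have e: "y^2 + (a1 E * x * y + a3 E * y) = x^3 + (a2 E * x^2 + a4 E * x + a6 E)"
    using on by (simp add: weierstrass_eval_def algebra_simps)
  show y: "y \<noteq> 0" using e rhs by auto
  have m: "vge (val x + val y) (a1 E * x * y + a3 E * y)"
  proof (rule vge_add)
    show "vge (val x + val y) (a1 E * x * y)" unfolding mult.assoc
      by (intro vge_mult0 c vge_mult vge_val)
    show "vge (val x + val y) (a3 E * y)"
      by (intro vge_mult0 c, rule vge_mono[OF vge_val]) (use x in simp)
  qed
  show "2 * val y = 3 * val x"
  proof (cases "val y < val x")
    case True
    have "vge (val (y^2) + 1) (a1 E * x * y + a3 E * y)"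
      by (rule vge_mono[OF m]) (use True y in \<open>simp add: val_power\<close>)
    from val_dominant(2)[OF _ this] y e rhs show ?thesis by (simp add: val_power)
  next
    case False
    have "vge (3 * val x + 1) (y^2 + (a1 E * x * y + a3 E * y))"
    proof (rule vge_add)
      show "vge (3 * val x + 1) (y^2)"
        by (rule vge_mono[OF vge_power[OF vge_val]]) (use False x in simp)
      show "vge (3 * val x + 1) (a1 E * x * y + a3 E * y)"
        by (rule vge_mono[OF m]) (use False x in simp)
    qed
    then show ?thesis using rhs unfolding e by (simp add: vge_def)
  qed
qed

fun xval :: "'a point \<Rightarrow> int" where
  "xval (Affine x y) = val x" | "xval Infinity = 0"

lemma kernel_double:
  assumes "integral_curve E" "vge 1 4" "P \<in> kernel_points E"
  shows "point_add E P P = Infinity \<or>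
    point_add E P P \<in> kernel_points E \<and> xval (point_add E P P) < xval P"
proof (cases "point_add E P P")
  case (Affine z w)
  obtain x y where P: "P = Affine x y" "weierstrass_eval E x y = 0" "x \<noteq> 0" "val x < 0"
    using assms(3) by (auto simp: kernel_points_def)
  have "on_curve E (Affine z w)" using Affine add_on_curve[of E P P] P by simp
  moreover have "z \<noteq> 0" "val z < val x"
    using double_kernel_descending[OF assms(1,2) P(2-4)] Affine P(1) by blast+
  ultimately show ?thesis using Affine P by (simp add: kernel_points_def)
qed simp

text \<open>Above 3 the number 4 is a unit and doubling preserves v = val x, so the descent has to
  triple: val x(2 P) = v and val (x(P) - x(2 P)) = v + 1 give val x(3 P) = v - 2.\<close>

lemma kernel_triple:
  assumes E: "integral_curve E" and d: "discriminant E \<noteq> 0" and 3: "val 3 = 1" "(3::'a) \<noteq> 0"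
    and 4: "val 4 = 0" "(4::'a) \<noteq> 0"
    and P: "P \<in> kernel_points E"
  shows "point_add E P (point_add E P P) \<in> kernel_points E \<and>
    xval (point_add E P (point_add E P P)) < xval P"
proof -
  note b = integral_b[OF E]
  obtain x y where P: "P = Affine x y" and on: "weierstrass_eval E x y = 0" and x: "x \<noteq> 0" "val x < 0"
    using P by (auto simp: kernel_points_def)
  define v where "v = val x"
  have v: "v \<le> - 2" using val_kernel_le(2)[OF E on x] x unfolding v_def by presburger
  have pw: "vge (int k * v) (x ^ k)" for k unfolding v_def by (rule vge_power[OF vge_val])
  have x1: "vge v x" by (simp add: v_def)
  define den where "den = 4*x^3 + wb2 E*x^2 + 2*wb4 E*x + wb6 E"
  define num where "num = x^4 - wb4 E*x^2 - 2*wb6 E*x - wb8 E"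
  \<comment> \<open>The 3-division polynomial. Its term 3 x^4 dominates the cubic term because v is
    at most -2; at v = -1 the two could cancel.\<close>
  define \<psi> where "\<psi> = 3*x^4 + (wb2 E*x^3 + 3*wb4 E*x^2 + 3*wb6 E*x + wb8 E)"
  have v4: "val (4 * x^3) = 3 * v" using val_mult[of 4 "x^3"] 4 x by (simp add: val_power v_def)
  have "vge (2 * v) (wb2 E*x^2 + 2*wb4 E*x + wb6 E)"
    using pw[of 2] vge_mono[OF x1, of "2*v"] vge_mono[OF b(3), of "2*v"] v
    by (auto intro!: vge_add vge_mult0 b vge_numeral simp: mult.assoc)
  then have 1: "vge (val (4*x^3) + 1) (wb2 E*x^2 + 2*wb4 E*x + wb6 E)"
    by (rule vge_mono) (use v in \<open>simp add: v4\<close>)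
  have den: "den \<noteq> 0" "val den = 3 * v"
    using val_dominant[OF _ 1] 4 x v4 by (simp_all add: den_def add.assoc)
  have num: "num \<noteq> 0" "val num = 4 * v" using val_double_numerator[OF E x] by (simp_all add: num_def v_def)
  have v3: "val (3 * x^4) = 1 + 4 * v" using val_mult[of 3 "x^4"] 3 x by (simp add: val_power v_def)
  have "vge (3 * v) (wb2 E*x^3 + 3*wb4 E*x^2 + 3*wb6 E*x + wb8 E)"
    using pw[of 3] vge_mono[OF pw[of 2], of "3*v"] vge_mono[OF x1, of "3*v"] vge_mono[OF b(4), of "3*v"] v
    by (auto intro!: vge_add vge_mult0 b vge_numeral simp: mult.assoc)
  then have 2: "vge (val (3*x^4) + 1) (wb2 E*x^3 + 3*wb4 E*x^2 + 3*wb6 E*x + wb8 E)"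
    by (rule vge_mono) (use v in \<open>simp add: v3\<close>)
  have psi: "\<psi> \<noteq> 0" "val \<psi> = 1 + 4 * v"
    using val_dominant[OF _ 2] 3 x v3 by (simp_all add: \<psi>_def)
  have "x * den - num = \<psi>" unfolding den_def num_def \<psi>_def by Groebner_Basis.algebra
  have "point_add E P P \<noteq> Infinity" using double_Infinity(2)[OF _ on] den P by (auto simp: den_def)
  then obtain x2 y2 where P2: "point_add E P P = Affine x2 y2" by (cases "point_add E P P") auto
  have on2: "weierstrass_eval E x2 y2 = 0" using add_on_curve[of E P P] P2 P on by simp
  have e2: "x2 * den = num" using double_x[OF on] P2 P by (simp add: den_def num_def)
  have x2: "x2 \<noteq> 0" "val x2 = v"
    using e2 num val_mult[of x2 den] den by (cases "x2 = 0"; simp)+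
  have e3: "(x - x2) * den = \<psi>" using e2 \<open>x * den - num = \<psi>\<close> by (simp add: algebra_simps)
  have xx: "x - x2 \<noteq> 0" using e3 psi(1) by auto
  have vxx: "val (x - x2) = 1 + v" using e3 val_mult[OF xx den(1)] psi den by simp
  have "point_add E P (Affine x2 y2) \<noteq> Infinity"
    using add_eq_Infinity_iff[of E P "Affine x2 y2"] P on on2 xx by auto
  then obtain z w where P3: "point_add E P (Affine x2 y2) = Affine z w"
    by (cases "point_add E P (Affine x2 y2)") auto
  have on3: "weierstrass_eval E z w = 0" using add_on_curve[of E P "Affine x2 y2"] P3 P on on2 by simp
  have on': "on_curve E P" "on_curve E (Affine x2 y2)" using P on on2 by simp_all
  have "point_add E P (point_neg E (Affine x2 y2)) = point_neg E P"
  proof -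
    interpret comm_group "MW E" using d by (rule MW_comm_group)
    have "P \<otimes>\<^bsub>MW E\<^esub> inv\<^bsub>MW E\<^esub> (P \<otimes>\<^bsub>MW E\<^esub> P) = inv\<^bsub>MW E\<^esub> P"
    proof -
      have "inv\<^bsub>MW E\<^esub> (P \<otimes>\<^bsub>MW E\<^esub> P) = inv\<^bsub>MW E\<^esub> P \<otimes>\<^bsub>MW E\<^esub> inv\<^bsub>MW E\<^esub> P"
        by (rule inv_mult) (simp_all only: MW_carrier on')
      moreover have "P \<otimes>\<^bsub>MW E\<^esub> (inv\<^bsub>MW E\<^esub> P \<otimes>\<^bsub>MW E\<^esub> inv\<^bsub>MW E\<^esub> P) = inv\<^bsub>MW E\<^esub> P"
      proof -
        have c: "P \<in> carrier (MW E)" using on' by (simp only: MW_carrier)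
        show ?thesis by (simp only: m_assoc[symmetric] r_inv l_one c inv_closed)
      qed
      ultimately show ?thesis by simp
    qed
    then show ?thesis using MW_inv[OF d on'(1)] MW_inv[OF d on'(2)] P2 by simp
  qed
  then have P1: "point_add E (Affine x y) (point_neg E (Affine x2 y2)) = Affine x (- y - a1 E * x - a3 E)"
    using P by simp
  have e: "z * x * (x - x2)^2 = (x*x2)^2 - wb4 E*(x*x2) - wb6 E*(x+x2) - wb8 E"
    using sum_difference_x[OF on on2 _ _ P1] xx P3 P by simp
  have m: "vge (2*v) (x*x2)" using vge_mult[OF vge_val vge_val, of x x2] x2 by (simp add: v_def)
  have "vge (2*v) (wb4 E*(x*x2) + wb6 E*(x+x2) + wb8 E)"
  proof (rule vge_add[OF vge_add[OF vge_mult0[OF b(2) m] vge_mult0[OF b(3) vge_add]]])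
    show "vge (2*v) x" "vge (2*v) (wb8 E)"
      using vge_mono[OF x1, of "2*v"] vge_mono[OF b(4), of "2*v"] v by simp_all
    show "vge (2*v) x2" using x2 v by (simp add: vge_def)
  qed
  then have "vge (2*v) (- (wb4 E*(x*x2) + wb6 E*(x+x2) + wb8 E))" unfolding vge_uminus .
  then have 5: "vge (val ((x*x2)^2) + 1) (- (wb4 E*(x*x2) + wb6 E*(x+x2) + wb8 E))"
    by (rule vge_mono) (use v x x2 in \<open>simp add: val_power val_mult v_def\<close>)
  have "(x*x2)^2 + - (wb4 E*(x*x2) + wb6 E*(x+x2) + wb8 E) = z * x * (x - x2)^2" using e by simp
  with val_dominant[OF _ 5] have nz: "z * x * (x - x2)^2 \<noteq> 0" and vz: "val (z * x * (x - x2)^2) = val ((x*x2)^2)"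
    using x x2 by auto
  have z0: "z \<noteq> 0" using nz by auto
  have "val (z * x * (x - x2)^2) = val z + v + 2 * (1 + v)"
    using z0 x xx by (simp add: val_mult val_power vxx v_def)
  moreover have "val ((x*x2)^2) = 4 * v" using x x2 by (simp add: val_power val_mult v_def)
  ultimately have "val z = v - 2" using vz by simp
  then show ?thesis using P2 P3 P on3 z0 v by (simp add: kernel_points_def v_def)
qed

lemma y_integral:
  assumes E: "integral_curve E" and on: "weierstrass_eval E x y = 0" and x: "vge 0 x"
  shows "vge 0 y"
proof (rule ccontr)
  assume "\<not> vge 0 y"
  then have y: "y \<noteq> 0" "val y < 0" by (auto simp: vge_def)
  have c: "vge 0 (a1 E)" "vge 0 (a2 E)" "vge 0 (a3 E)" "vge 0 (a4 E)" "vge 0 (a6 E)"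
    using E by (auto simp: integral_curve_def)
  have "vge (val y) ((a1 E * x + a3 E) * y)"
    by (intro vge_mult0 vge_add c x vge_val)
  then have "vge (val (y^2) + 1) ((a1 E * x + a3 E) * y)"
    by (rule vge_mono) (use y in \<open>simp add: val_power\<close>)
  from val_dominant[OF _ this] y have "y^2 + (a1 E * x + a3 E) * y \<noteq> 0" "val (y^2 + (a1 E * x + a3 E) * y) < 0"
    by (simp_all add: val_power)
  moreover have "y^2 + (a1 E * x + a3 E) * y = x^3 + a2 E * x^2 + a4 E * x + a6 E"
    using on by (simp add: weierstrass_eval_def algebra_simps)
  moreover have "vge 0 (x^3 + a2 E * x^2 + a4 E * x + a6 E)"
    using vge_power[OF x, of 2] vge_power[OF x, of 3] by (intro vge_add vge_mult0 c x) simp_all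
  ultimately show False by (simp add: vge_def)
qed

text \<open>Injectivity of reduction, stated without a reduced curve. The chord from the first point
  to the negative of the second has l (x2 - x1) = y' - y1, where \<pi> divides x2 - x1 but not y' -
  y1. So l is not integral, and l^2 dominates the abscissa of the difference.\<close>

lemma close_points:
  assumes E: "integral_curve E" and on: "weierstrass_eval E x1 y1 = 0" "weierstrass_eval E x2 y2 = 0"
    and i: "vge 0 x1" "vge 0 x2" and c: "vge 1 (x1 - x2)" "vge 1 (y1 - y2)"
    and s: "\<not> vge 1 (2*y1 + a1 E*x1 + a3 E)" and ne: "\<not> (x1 = x2 \<and> y1 = y2)"
  shows "point_add E (Affine x1 y1) (point_neg E (Affine x2 y2)) \<in> kernel_points E"
proof -
  have a: "vge 0 (a1 E)" "vge 0 (a2 E)" "vge 0 (a3 E)" "vge 0 (a4 E)" "vge 0 (a6 E)"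
    using E by (auto simp: integral_curve_def)
  define y' where "y' = - y2 - a1 E * x2 - a3 E"
  have on': "weierstrass_eval E x2 y' = 0"
    using neg_on_curve[of E "Affine x2 y2"] on by (simp add: y'_def)
  have "\<not> (x1 = x2 \<and> y' = - y1 - a1 E * x1 - a3 E)" using ne by (auto simp: y'_def)
  then obtain l where l: "is_slope E l x1 y1 x2 y'" "point_add E (Affine x1 y1) (Affine x2 y') = chord_sum E l x1 y1 x2"
    using slope_exists[OF on(1) on'] by blast
  have sl: "l * (x2 - x1) = y' - y1" using l(1) by (simp add: is_slope_def)
  have nl: "\<not> vge 0 l"
  proof
    assume "vge 0 l"
    moreover have "vge 1 (x2 - x1)" using c(1) vge_uminus[of 1 "x1 - x2"] unfolding minus_diff_eq by blast
    ultimately have "vge 1 (l * (x2 - x1))" by (rule vge_mult0)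
    then have "vge 1 (y' - y1)" unfolding sl .
    from vge_diff[OF vge_add[OF c(2) vge_mult0[OF a(1) c(1)]] this]
    have "vge 1 ((y1 - y2) + a1 E * (x1 - x2) - (y' - y1))" .
    moreover have "(y1 - y2) + a1 E * (x1 - x2) - (y' - y1) = 2*y1 + a1 E*x1 + a3 E"
      by (simp add: y'_def algebra_simps)
    ultimately show False using s by simp
  qed
  then have l0: "l \<noteq> 0" "val l < 0" by (auto simp: vge_def)
  have "vge (val l) (a1 E * l - a2 E - x1 - x2)"
    using vge_mono[OF a(2), of "val l"] vge_mono[OF i(1), of "val l"] vge_mono[OF i(2), of "val l"] l0
    by (intro vge_diff vge_mult0 a vge_val) simp_all
  then have "vge (val (l^2) + 1) (a1 E * l - a2 E - x1 - x2)"
    by (rule vge_mono) (use l0 in \<open>simp add: val_power\<close>)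
  from val_dominant[OF _ this] l0
  have "l^2 + (a1 E * l - a2 E - x1 - x2) \<noteq> 0" "val (l^2 + (a1 E * l - a2 E - x1 - x2)) < 0"
    by (simp_all add: val_power)
  moreover have "l^2 + (a1 E * l - a2 E - x1 - x2) = third_x E l x1 x2" by (simp add: third_x_def)
  moreover have "on_curve E (chord_sum E l x1 y1 x2)" by (rule chord_sum_on_curve[OF on(1) l(1)])
  ultimately show ?thesis using l(2) unfolding y'_def by (simp add: kernel_points_def chord_sum_def)
qed

lemma vge1_iff: "x \<in> R \<Longrightarrow> vge 1 x \<longleftrightarrow> x / \<pi> \<in> R"
proof
  assume x: "x \<in> R" "x / \<pi> \<in> R"
  then have "vge (1 + 0) (\<pi> * (x / \<pi>))"
    by (intro vge_mult vge_R) (simp_all add: vge_def val_pi)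
  then show "vge 1 x" using pi_nz by simp
next
  assume "x \<in> R" "vge 1 x"
  then show "x / \<pi> \<in> R" using val_unit[of x] zero_R by (fastforce simp: vge_def)
qed

text \<open>The denominator m of x is prime to \<pi>; a representative that inverts m modulo \<pi>
  replaces x by an element of R with the same residue.\<close>

lemma integral_residue:
  assumes T: "T \<subseteq> R" and res: "\<And>w. w \<in> R \<Longrightarrow> \<exists>t\<in>T. vge 1 (w - t)"
    and inv: "\<And>t. t \<in> T \<Longrightarrow> \<not> vge 1 t \<Longrightarrow> \<exists>t'\<in>T. vge 1 (t * t' - 1)"
    and x: "vge 0 x"
  shows "\<exists>t\<in>T. vge 1 (x - t)"
proof (cases "x = 0")
  case True
  then show ?thesis using res[OF zero_R] by simp
next
  case False
  define k where "k = nat (val x)"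
  have "val x = int k" using x False by (simp add: vge_def k_def)
  then obtain u where u: "u \<in> local_units" "x = \<pi> ^ k * u" using val_eq[OF False] by auto
  then obtain w m where w: "u = w / m" "w \<in> R" "m \<in> R" "m / \<pi> \<notin> R"
    unfolding local_units_def by blast
  have m0: "m \<noteq> 0" "val m = 0" using w zero_R val_unit by auto
  obtain t where t: "t \<in> T" "vge 1 (m - t)" using res w by blast
  have "\<not> vge 1 t"
  proof
    assume "vge 1 t"
    then have "vge 1 (m - t + t)" using t by (intro vge_add)
    then show False using vge1_iff w by simp
  qed
  then obtain t' where t': "t' \<in> T" "vge 1 (t * t' - 1)" using inv t by blast
  have wR: "\<pi> ^ k * w * t' \<in> R" using w t' T by (intro mult_R pi_power_R) auto
  have "vge 1 ((m - t) * t' + (t * t' - 1))"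
    using t t' T vge_R vge_mult0[of t' 1 "m - t"] by (intro vge_add) (auto simp: mult.commute)
  then have 1: "vge 1 (m * t' - 1)" by (simp add: algebra_simps)
  have "vge 0 (\<pi> ^ k * w / m)"
    using vge_R[of "\<pi> ^ k * w"] mult_R[OF pi_power_R w(2)] m0 val_mult[of "\<pi> ^ k * w / m" m]
    by (cases "\<pi> ^ k * w = 0") (auto simp: vge_def)
  then have "vge 1 (- ((\<pi> ^ k * w / m) * (m * t' - 1)))" unfolding vge_uminus by (rule vge_mult0[OF _ 1])
  moreover have "- ((\<pi> ^ k * w / m) * (m * t' - 1)) = x - \<pi> ^ k * w * t'"
    using m0 by (simp add: u w(1) field_simps)
  ultimately have 2: "vge 1 (x - \<pi> ^ k * w * t')" by metis
  obtain r where r: "r \<in> T" "vge 1 (\<pi> ^ k * w * t' - r)" using res[OF wR] by blast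
  have "vge 1 ((x - \<pi> ^ k * w * t') + (\<pi> ^ k * w * t' - r))" by (intro vge_add 2 r)
  then show ?thesis using r by auto
qed

end

section \<open>Primes above 2 and 3\<close>

definition KI :: "int \<Rightarrow> int \<Rightarrow> int \<Rightarrow> int \<Rightarrow> kf" where
  "KI a b c d = KF (of_int a) (of_int b) (of_int c) (of_int d)"

definition kint :: "kf set" where "kint = {KI a b c d | a b c d. True}"

lemma KI_kint [simp]: "KI a b c d \<in> kint" by (auto simp: kint_def)

lemma KI_sel [simp]: "k0 (KI a b c d) = of_int a" "k1 (KI a b c d) = of_int b"
  "k2 (KI a b c d) = of_int c" "k3 (KI a b c d) = of_int d"
  by (simp_all add: KI_def)

lemma KI_eq_iff [simp]: "KI a b c d = KI a' b' c' d' \<longleftrightarrow> a = a' \<and> b = b' \<and> c = c' \<and> d = d'"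
  by (simp add: kf_eq_iff)

lemma KI_arith:
  "KI a b c d + KI a' b' c' d' = KI (a + a') (b + b') (c + c') (d + d')"
  "KI a b c d - KI a' b' c' d' = KI (a - a') (b - b') (c - c') (d - d')"
  "- KI a b c d = KI (- a) (- b) (- c) (- d)"
  "KI a b c d * KI a' b' c' d' = KI (a*a' - b*b' + c*c' - d*d') (a*b' + b*a' + c*d' + d*c')
     (a*c' - b*d' + c*a' - d*b' + c*c' - d*d') (a*d' + b*c' + c*b' + d*a' + c*d' + d*c')"
  by (simp_all add: kf_eq_iff)

lemma KI_0: "0 = KI 0 0 0 0" by (simp add: kf_eq_iff)
lemma KI_1: "1 = KI 1 0 0 0" by (simp add: kf_eq_iff)
lemma KI_numeral: "numeral n = KI (numeral n) 0 0 0" by (simp add: kf_eq_iff)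

lemma kint_cases: "x \<in> kint \<Longrightarrow> (\<And>a b c d. x = KI a b c d \<Longrightarrow> P) \<Longrightarrow> P"
  by (auto simp: kint_def)

lemma kint_ring: "1 \<in> kint" "x \<in> kint \<Longrightarrow> y \<in> kint \<Longrightarrow> x + y \<in> kint"
  "x \<in> kint \<Longrightarrow> y \<in> kint \<Longrightarrow> x * y \<in> kint" "x \<in> kint \<Longrightarrow> - x \<in> kint"
  by (auto simp: KI_arith KI_1 elim!: kint_cases)

lemma knorm_mult: "knorm (x * y) = knorm x * knorm y"
proof -
  have "kinv_aux (x * y) = kinv_aux x * kinv_aux y"
    by (simp add: kinv_aux_def kconj_hom ksig_hom ac_simps)
  then have "KF (knorm (x * y)) 0 0 0 = (x * kinv_aux x) * (y * kinv_aux y)"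
    by (simp add: mult_kinv_aux[symmetric] ac_simps)
  also have "\<dots> = KF (knorm x * knorm y) 0 0 0" by (simp add: mult_kinv_aux kf_eq_iff)
  finally show ?thesis by (simp add: kf_eq_iff)
qed

lemma knorm_kint: "x \<in> kint \<Longrightarrow> \<exists>n. knorm x = of_int n"
proof (elim kint_cases)
  fix a b c d assume "x = KI a b c d"
  then have "knorm x = of_int (let p = a^2+b^2+c^2+d^2; q = 2*a*c+2*b*d+c^2+d^2 in p^2+p*q-q^2)"
    by (simp add: knorm_def Let_def)
  then show "\<exists>n. knorm x = of_int n" by blast
qed

lemma kint_fraction: "\<exists>w m. w \<in> kint \<and> m \<in> kint \<and> m \<noteq> 0 \<and> x = w / m"
proof -
  obtain a b where 0: "k0 x = of_int a / of_int b" "b > 0" by (metis quotient_of_unique Fract_of_int_quotient quotient_of_denom_pos quotient_of_div surj_pair)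
  obtain c d where 1: "k1 x = of_int c / of_int d" "d > 0" by (metis quotient_of_denom_pos quotient_of_div surj_pair)
  obtain e f where 2: "k2 x = of_int e / of_int f" "f > 0" by (metis quotient_of_denom_pos quotient_of_div surj_pair)
  obtain g h where 3: "k3 x = of_int g / of_int h" "h > 0" by (metis quotient_of_denom_pos quotient_of_div surj_pair)
  define m where "m = KI (b * d * f * h) 0 0 0"
  have m: "m \<noteq> 0" "m \<in> kint" using 0 1 2 3 by (simp_all add: m_def KI_0)
  have "x * m = KI (a*d*f*h) (c*b*f*h) (e*b*d*h) (g*b*d*f)"
    using 0 1 2 3 by (simp add: kf_eq_iff m_def)
  then have "x * m \<in> kint" by simp
  moreover have "x = (x * m) / m" using m by simp
  ultimately show ?thesis using m by blast
qed

text \<open>Division by \<pi> lowers the absolute norm, a positive integer, so it can be repeated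
  only finitely often.\<close>

lemma kint_factor:
  assumes \<pi>: "\<bar>knorm \<pi>\<bar> > 1" and w: "w \<in> kint" "w \<noteq> 0"
  shows "\<exists>j w'. w = \<pi> ^ j * w' \<and> w' \<in> kint \<and> w' / \<pi> \<notin> kint"
proof -
  have p0: "\<pi> \<noteq> 0" using \<pi> knorm_eq_0_iff[of \<pi>] by linarith
  have "\<exists>j w'. w = \<pi> ^ j * w' \<and> w' \<in> kint \<and> w' / \<pi> \<notin> kint"
    if "w \<in> kint" "w \<noteq> 0" "\<bar>knorm w\<bar> = of_nat n" for n w
    using that
  proof (induction n arbitrary: w rule: less_induct)
    case (less n)
    show ?case
    proof (cases "w / \<pi> \<in> kint")
      case False
      then show ?thesis using less.prems by (intro exI[of _ 0] exI[of _ w]) simp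
    next
      case True
      obtain m where "knorm (w / \<pi>) = of_int m" using knorm_kint[OF True] by blast
      then have m: "\<bar>knorm (w / \<pi>)\<bar> = of_nat (nat \<bar>m\<bar>)" by simp
      have nz: "w / \<pi> \<noteq> 0" using less.prems p0 by simp
      have "knorm w = knorm (w / \<pi>) * knorm \<pi>" using p0 by (simp add: knorm_mult[symmetric])
      then have "\<bar>knorm w\<bar> = \<bar>knorm (w / \<pi>)\<bar> * \<bar>knorm \<pi>\<bar>" by (simp add: abs_mult)
      moreover have "\<bar>knorm (w / \<pi>)\<bar> > 0" using nz by simp
      ultimately have "\<bar>knorm (w / \<pi>)\<bar> < \<bar>knorm w\<bar>" using \<pi> by simp
      then have "nat \<bar>m\<bar> < n" using m less.prems(3) by (metis of_nat_less_iff)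
      from less.IH[OF this True nz m] obtain j w' where
        "w / \<pi> = \<pi> ^ j * w'" "w' \<in> kint" "w' / \<pi> \<notin> kint" by blast
      then show ?thesis using p0 by (intro exI[of _ "Suc j"] exI[of _ w']) (simp add: field_simps)
    qed
  qed
  moreover obtain m where "knorm w = of_int m" using knorm_kint[OF w(1)] by blast
  then have "\<bar>knorm w\<bar> = of_nat (nat \<bar>m\<bar>)" by simp
  ultimately show ?thesis using w by blast
qed

text \<open>A factor of 3, which splits into two primes of norm 9, and the element 1 + i of norm 4
  above 2. The residue fields have nine and four elements.\<close>

definition pi3 :: kf where "pi3 = KI 0 (-1) 1 1"
definition pi2 :: kf where "pi2 = KI 1 1 0 0"

lemma knorm_pi: "knorm pi3 = 9" "knorm pi2 = 4"
  by (simp_all add: knorm_def pi3_def pi2_def Let_def)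

lemma pi_nz: "pi3 \<noteq> 0" "pi2 \<noteq> 0"
  by (simp_all add: pi3_def pi2_def KI_0)

text \<open>Modulo \<open>pi3\<close> one has \<phi> = -1 - i; the congruences say that the real and
  the imaginary part of the residue vanish modulo 3.\<close>

lemma KI_div_pi3: "KI a b c d / pi3 \<in> kint \<longleftrightarrow> 3 dvd (a - c + d) \<and> 3 dvd (b - c - d)"
proof
  assume "KI a b c d / pi3 \<in> kint"
  then obtain e f g h where "KI a b c d / pi3 = KI e f g h" by (elim kint_cases)
  then have "KI a b c d = KI e f g h * pi3" using pi_nz by (simp add: field_simps)
  then have "a = f + g - h" "b = - e + g + h" "c = e - f + g" "d = e + f + h"
    unfolding pi3_def KI_arith by simp_all
  then have "a - c + d = 3 * f" "b - c - d = 3 * (- e)" by simp_all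
  then show "3 dvd (a - c + d) \<and> 3 dvd (b - c - d)" by simp
next
  assume "3 dvd (a - c + d) \<and> 3 dvd (b - c - d)"
  then obtain s t where st: "a - c + d = 3 * s" "b - c - d = 3 * t" by (elim conjE dvdE)
  have "a = 3*s + c - d" "b = 3*t + c + d" using st by simp_all
  then have "KI a b c d = KI (- t) s (s + t + c) (t - s + d) * pi3"
    unfolding pi3_def KI_arith by simp
  then have "KI a b c d / pi3 = KI (- t) s (s + t + c) (t - s + d)" using pi_nz by simp
  then show "KI a b c d / pi3 \<in> kint" by simp
qed

text \<open>Modulo 1 + i one has i = 1, so the residue is (a + b) + (c + d) \<phi> with coefficients
  modulo 2.\<close>

lemma KI_div_pi2: "KI a b c d / pi2 \<in> kint \<longleftrightarrow> even (a + b) \<and> even (c + d)"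
proof
  assume "KI a b c d / pi2 \<in> kint"
  then obtain e f g h where "KI a b c d / pi2 = KI e f g h" by (elim kint_cases)
  then have "KI a b c d = KI e f g h * pi2" using pi_nz by (simp add: field_simps)
  then show "even (a + b) \<and> even (c + d)" unfolding pi2_def KI_arith by simp
next
  assume "even (a + b) \<and> even (c + d)"
  then obtain s t where st: "a + b = 2 * s" "c + d = 2 * t" by (elim conjE evenE)
  then have "a = 2 * s - b" "c = 2 * t - d" by simp_all
  then have "KI a b c d = KI s (b - s) t (d - t) * pi2"
    unfolding pi2_def KI_arith by simp
  then have "KI a b c d / pi2 = KI s (b - s) t (d - t)" using pi_nz by simp
  then show "KI a b c d / pi2 \<in> kint" by simp
qed

text \<open>Since -1 is not a square modulo 3, p + q i vanishes in the field with nine elements as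
  soon as its norm p^2 + q^2 does. This is what makes \<open>pi3\<close> prime.\<close>

lemma sum_squares_3:
  fixes p q :: int
  assumes "3 dvd p^2 + q^2" shows "3 dvd p \<and> 3 dvd q"
proof -
  define r s k l where d: "r = p mod 3" "s = q mod 3" "k = p div 3" "l = q div 3"
  have "p = 3 * k + r" "q = 3 * l + s" by (simp_all add: d)
  then have "p^2 + q^2 = (r^2 + s^2) + 3 * (3*k^2 + 2*k*r + 3*l^2 + 2*l*s)" by Groebner_Basis.algebra
  then have "3 dvd r^2 + s^2" using assms by (metis dvd_add_left_iff dvd_triv_left)
  moreover have "r = 0 \<or> r = 1 \<or> r = 2" "s = 0 \<or> s = 1 \<or> s = 2" unfolding d by presburger+
  ultimately have "r = 0 \<and> s = 0" by auto
  then show ?thesis unfolding d by auto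
qed

interpretation v3: prime_element kint pi3
proof
  show "pi3 \<in> kint" by (simp add: pi3_def)
  show "\<exists>j w'. w = pi3 ^ j * w' \<and> w' \<in> kint \<and> w' / pi3 \<notin> kint" if "w \<in> kint" "w \<noteq> 0" for w
    by (rule kint_factor[OF _ that]) (simp add: knorm_pi)
  show "1 / pi3 \<notin> kint" by (simp add: KI_1 KI_div_pi3)
  fix x y assume "x \<in> kint" "y \<in> kint" and n: "x / pi3 \<notin> kint" "y / pi3 \<notin> kint"
  then obtain a b c d a' b' c' d' where x: "x = KI a b c d" and y: "y = KI a' b' c' d'" by (elim kint_cases)
  \<comment> \<open>p + q i and p' + q' i are the residues of x and y; their norms multiply.\<close>
  define p q p' q' where pq: "p = a - c + d" "q = b - c - d" "p' = a' - c' + d'" "q' = b' - c' - d'"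
  have "\<not> 3 dvd p^2 + q^2" "\<not> 3 dvd p'^2 + q'^2"
    using n sum_squares_3 unfolding x y KI_div_pi3 pq by blast+
  moreover have "prime (3::int)" by simp
  ultimately have "\<not> 3 dvd (p^2 + q^2) * (p'^2 + q'^2)" using prime_dvd_mult_iff by blast
  moreover have "(p^2 + q^2) * (p'^2 + q'^2) = (p*p' - q*q')^2 + (p*q' + q*p')^2"
    by Groebner_Basis.algebra
  ultimately have *: "\<not> (3 dvd p*p' - q*q' \<and> 3 dvd p*q' + q*p')"
    by (auto simp: power2_eq_square)
  show "x * y / pi3 \<notin> kint"
  proof
    assume "x * y / pi3 \<in> kint"
    then have "3 dvd a*a' - b*b' + c*c' - d*d' - (a*c' - b*d' + c*a' - d*b' + c*c' - d*d') + (a*d' + b*c' + c*b' + d*a' + c*d' + d*c')"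
      "3 dvd a*b' + b*a' + c*d' + d*c' - (a*c' - b*d' + c*a' - d*b' + c*c' - d*d') - (a*d' + b*c' + c*b' + d*a' + c*d' + d*c')"
      unfolding x y KI_arith KI_div_pi3 by blast+
    moreover have "p*p' - q*q' = a*a' - b*b' + c*c' - d*d' - (a*c' - b*d' + c*a' - d*b' + c*c' - d*d') + (a*d' + b*c' + c*b' + d*a' + c*d' + d*c') + 3 * (- (c*d') - d*c')"
      unfolding pq by Groebner_Basis.algebra
    moreover have "p*q' + q*p' = a*b' + b*a' + c*d' + d*c' - (a*c' - b*d' + c*a' - d*b' + c*c' - d*d') - (a*d' + b*c' + c*b' + d*a' + c*d' + d*c') + 3 * (c*c' - d*d')"
      unfolding pq by Groebner_Basis.algebra
    ultimately show False using * by (metis dvd_add dvd_triv_left)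
  qed
qed (use kint_ring kint_fraction pi_nz in auto)

interpretation v2: prime_element kint pi2
proof
  show "pi2 \<in> kint" by (simp add: pi2_def)
  show "\<exists>j w'. w = pi2 ^ j * w' \<and> w' \<in> kint \<and> w' / pi2 \<notin> kint" if "w \<in> kint" "w \<noteq> 0" for w
    by (rule kint_factor[OF _ that]) (simp add: knorm_pi)
  show "1 / pi2 \<notin> kint" by (simp add: KI_1 KI_div_pi2)
  fix x y assume "x \<in> kint" "y \<in> kint" and n: "x / pi2 \<notin> kint" "y / pi2 \<notin> kint"
  then obtain a b c d a' b' c' d' where x: "x = KI a b c d" and y: "y = KI a' b' c' d'" by (elim kint_cases)
  \<comment> \<open>p + q \<phi> and p' + q' \<phi> are the residues of x and y in the field with
    four elements.\<close>
  define p q p' q' where pq: "p = a + b" "q = c + d" "p' = a' + b'" "q' = c' + d'"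
  have "\<not> (even p \<and> even q)" "\<not> (even p' \<and> even q')"
    using n unfolding x y KI_div_pi2 pq by blast+
  then have *: "\<not> (even (p*p' + q*q') \<and> even (p*q' + q*p' + q*q'))"
    by (cases "even p"; cases "even q"; cases "even p'"; cases "even q'") simp_all
  show "x * y / pi2 \<notin> kint"
  proof
    assume "x * y / pi2 \<in> kint"
    then have "even (a*a' - b*b' + c*c' - d*d' + (a*b' + b*a' + c*d' + d*c'))"
      "even (a*c' - b*d' + c*a' - d*b' + c*c' - d*d' + (a*d' + b*c' + c*b' + d*a' + c*d' + d*c'))"
      unfolding x y KI_arith KI_div_pi2 by blast+
    moreover have "p*p' + q*q' = a*a' - b*b' + c*c' - d*d' + (a*b' + b*a' + c*d' + d*c') + 2 * (b*b' + d*d')"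
      unfolding pq by Groebner_Basis.algebra
    moreover have "p*q' + q*p' + q*q' = a*c' - b*d' + c*a' - d*b' + c*c' - d*d' + (a*d' + b*c' + c*b' + d*a' + c*d' + d*c') + 2 * (b*d' + d*b' + d*d')"
      unfolding pq by Groebner_Basis.algebra
    ultimately show False using * by (metis dvd_add dvd_triv_left)
  qed
qed (use kint_ring kint_fraction pi_nz in auto)

section \<open>The curve with torsion subgroup of order 15\<close>

lemma (in group) cyclic_torsion_iso:
  fixes n :: nat
  assumes x: "x \<in> carrier G" and n: "n > 0" "x [^] n = \<one>"
    and inj: "inj_on (\<lambda>i::nat. x [^] i) {..<n}"
    and tor: "\<And>y. y \<in> carrier G \<Longrightarrow> is_torsion G y \<Longrightarrow> \<exists>i::nat. y = x [^] i"
  shows "torsion_subgroup G \<cong> integer_mod_group n"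
proof -
  define f where "f k = x [^] nat k" for k :: int
  have mod: "x [^] m = x [^] (m mod n)" for m :: nat
  proof -
    have "x [^] m = x [^] (n * (m div n) + m mod n)" by simp
    also have "\<dots> = (x [^] n) [^] (m div n) \<otimes> x [^] (m mod n)" using x by (simp only: nat_pow_mult nat_pow_pow)
    finally show ?thesis using n x by simp
  qed
  have tors: "is_torsion G (x [^] m)" for m :: nat
  proof -
    have "(x [^] m) [^] n = (x [^] n) [^] m" using x by (simp add: nat_pow_pow mult.commute)
    then show ?thesis unfolding is_torsion_def using n by auto
  qed
  have "f \<in> iso (integer_mod_group n) (torsion_subgroup G)"
  proof (rule isoI)
    show "f \<in> hom (integer_mod_group n) (torsion_subgroup G)"
    proof (rule homI)
      fix i j assume ij: "i \<in> carrier (integer_mod_group n)" "j \<in> carrier (integer_mod_group n)"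
      then have ij': "0 \<le> i" "0 \<le> j" using n by (auto simp: carrier_integer_mod_group)
      show "f i \<in> carrier (torsion_subgroup G)"
        using tors x by (simp add: torsion_subgroup_def f_def is_torsion_def)
      have "nat ((i + j) mod int n) = (nat i + nat j) mod n"
        using ij' by (simp add: nat_mod_distrib nat_add_distrib)
      then show "f (i \<otimes>\<^bsub>integer_mod_group n\<^esub> j) = f i \<otimes>\<^bsub>torsion_subgroup G\<^esub> f j"
        using mod[of "nat i + nat j"] x by (simp add: f_def torsion_subgroup_def nat_pow_mult)
    qed
    show "bij_betw f (carrier (integer_mod_group n)) (carrier (torsion_subgroup G))"
    proof (rule bij_betw_imageI)
      show "inj_on f (carrier (integer_mod_group n))"
      proof (rule inj_onI)
        fix i j assume ij: "i \<in> carrier (integer_mod_group n)" "j \<in> carrier (integer_mod_group n)" "f i = f j"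
        then have "0 \<le> i" "i < int n" "0 \<le> j" "j < int n" using n by (auto simp: carrier_integer_mod_group)
        moreover from this have "nat i = nat j" using inj_onD[OF inj, of "nat i" "nat j"] ij(3) by (auto simp: f_def)
        ultimately show "i = j" by simp
      qed
      show "f ` carrier (integer_mod_group n) = carrier (torsion_subgroup G)"
      proof (intro equalityI subsetI)
        fix y assume "y \<in> f ` carrier (integer_mod_group n)"
        then show "y \<in> carrier (torsion_subgroup G)"
          using tors x by (auto simp: torsion_subgroup_def f_def is_torsion_def)
      next
        fix y assume "y \<in> carrier (torsion_subgroup G)"
        then have "y \<in> carrier G" "is_torsion G y" by (auto simp: torsion_subgroup_def is_torsion_def)
        then obtain i where "y = x [^] (i::nat)" using tor by blast
        then have "y = f (int (i mod n))" using mod[of i] by (simp add: f_def)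
        moreover have "int (i mod n) \<in> carrier (integer_mod_group n)" using n by (simp add: carrier_integer_mod_group)
        ultimately show "y \<in> f ` carrier (integer_mod_group n)" by blast
      qed
    qed
  qed
  then have "integer_mod_group n \<cong> torsion_subgroup G" by (auto simp: is_iso_def)
  then show ?thesis by (rule group.iso_sym[OF group_integer_mod_group])
qed

definition E0 :: "kf weierstrass" where
  "E0 = \<lparr>a1 = 1, a2 = 1, a3 = 1, a4 = - 3, a6 = 1\<rparr>"

lemma E0_sel: "a1 E0 = 1" "a2 E0 = 1" "a3 E0 = 1" "a4 E0 = - 3" "a6 E0 = 1"
  by (simp_all add: E0_def)

lemma E0_discriminant: "discriminant E0 \<noteq> 0"
  by (simp add: discriminant_def E0_sel)

lemma E0_integral: "v3.integral_curve E0"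
  unfolding v3.integral_curve_def E0_sel by (simp add: v3.vge_numeral v3.vge_R kint_ring)

lemmas KI_eval = KI_numeral KI_1 power2_eq_square power3_eq_cube KI_arith

text \<open>Entry n is the n-th multiple of entry 1, a point of order 15 with abscissa - sqrt 5. All
  entries are defined over Q(sqrt 5).\<close>

definition E0_torsion :: "kf point list" where
  "E0_torsion = [Infinity,
    Affine (KI 1 0 (-2) 0) (KI (-4) 0 2 0),
    Affine (KI 3 0 4 0) (KI 6 0 12 0),
    Affine (KI (-1) 0 0 0) (KI (-2) 0 0 0),
    Affine (KI (-1) 0 2 0) (KI 2 0 0 0),
    Affine (KI 0 0 0 0) (KI 0 0 (-1) 0),
    Affine (KI 1 0 0 0) (KI 0 0 0 0),
    Affine (KI 7 0 (-4) 0) (KI 18 0 (-12) 0),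
    Affine (KI 7 0 (-4) 0) (KI (-26) 0 16 0),
    Affine (KI 1 0 0 0) (KI (-2) 0 0 0),
    Affine (KI 0 0 0 0) (KI (-1) 0 1 0),
    Affine (KI (-1) 0 2 0) (KI (-2) 0 (-2) 0),
    Affine (KI (-1) 0 0 0) (KI 2 0 0 0),
    Affine (KI 3 0 4 0) (KI (-10) 0 (-16) 0),
    Affine (KI 1 0 (-2) 0) (KI 2 0 0 0)]"

lemma E0_eval: "weierstrass_eval E0 x y = y^2 + x*y + y - (x^3 + x^2 - 3*x + 1)"
  by (simp add: weierstrass_eval_def E0_sel)

lemma E0_torsion_on_curve: "P \<in> set E0_torsion \<Longrightarrow> on_curve E0 P"
  unfolding E0_torsion_def by (auto simp: E0_eval KI_eval KI_0)

lemma E0_add: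
  assumes "weierstrass_eval E0 x1 y1 = 0" "weierstrass_eval E0 x2 y2 = 0"
    "l * (x2 - x1) = y2 - y1" "l * (y1 + y2 + x2 + 1) = x1 ^ 2 + x1 * x2 + x2 ^ 2 + (x1 + x2) - 3 - y1"
    "x3 = l ^ 2 + l - 1 - x1 - x2" "y3 = - (y1 + l * (x3 - x1)) - x3 - 1"
  shows "point_add E0 (Affine x1 y1) (Affine x2 y2) = Affine x3 y3"
  using add_slope[OF E0_discriminant assms(1,2), of l] assms(3-)
  unfolding is_slope_def chord_sum_def third_x_def E0_sel by simp

lemma E0_torsion_add:
  assumes "n < 14"
  shows "point_add E0 (E0_torsion ! n) (E0_torsion ! 1) = E0_torsion ! Suc n"
proof -
  \<comment> \<open>Each witness l is the slope of the chord or tangent in question, so only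
    identities between explicit elements remain.\<close>
  have 1: "point_add E0 (Affine (KI 1 0 (-2) 0) (KI (-4) 0 2 0)) (Affine (KI 1 0 (-2) 0) (KI (-4) 0 2 0)) = Affine (KI 3 0 4 0) (KI 6 0 12 0)"
    by (rule E0_add[where l = "KI (-3) 0 0 0"]) (simp_all add: E0_eval KI_eval KI_0)
  have 2: "point_add E0 (Affine (KI 3 0 4 0) (KI 6 0 12 0)) (Affine (KI 1 0 (-2) 0) (KI (-4) 0 2 0)) = Affine (KI (-1) 0 0 0) (KI (-2) 0 0 0)"
    by (rule E0_add[where l = "KI (-1) 0 2 0"]) (simp_all add: E0_eval KI_eval KI_0)
  have 3: "point_add E0 (Affine (KI (-1) 0 0 0) (KI (-2) 0 0 0)) (Affine (KI 1 0 (-2) 0) (KI (-4) 0 2 0)) = Affine (KI (-1) 0 2 0) (KI 2 0 0 0)"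
    by (rule E0_add[where l = "KI (-1) 0 0 0"]) (simp_all add: E0_eval KI_eval KI_0)
  have 4: "point_add E0 (Affine (KI (-1) 0 2 0) (KI 2 0 0 0)) (Affine (KI 1 0 (-2) 0) (KI (-4) 0 2 0)) = Affine (KI 0 0 0 0) (KI 0 0 (-1) 0)"
    by (rule E0_add[where l = "KI (-1) 0 1 0"]) (simp_all add: E0_eval KI_eval KI_0)
  have 5: "point_add E0 (Affine (KI 0 0 0 0) (KI 0 0 (-1) 0)) (Affine (KI 1 0 (-2) 0) (KI (-4) 0 2 0)) = Affine (KI 1 0 0 0) (KI 0 0 0 0)"
    by (rule E0_add[where l = "KI (-2) 0 1 0"]) (simp_all add: E0_eval KI_eval KI_0)
  have 6: "point_add E0 (Affine (KI 1 0 0 0) (KI 0 0 0 0)) (Affine (KI 1 0 (-2) 0) (KI (-4) 0 2 0)) = Affine (KI 7 0 (-4) 0) (KI 18 0 (-12) 0)"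
    by (rule E0_add[where l = "KI (-3) 0 2 0"]) (simp_all add: E0_eval KI_eval KI_0)
  have 7: "point_add E0 (Affine (KI 7 0 (-4) 0) (KI 18 0 (-12) 0)) (Affine (KI 1 0 (-2) 0) (KI (-4) 0 2 0)) = Affine (KI 7 0 (-4) 0) (KI (-26) 0 16 0)"
    by (rule E0_add[where l = "KI 3 0 (-2) 0"]) (simp_all add: E0_eval KI_eval KI_0)
  have 8: "point_add E0 (Affine (KI 7 0 (-4) 0) (KI (-26) 0 16 0)) (Affine (KI 1 0 (-2) 0) (KI (-4) 0 2 0)) = Affine (KI 1 0 0 0) (KI (-2) 0 0 0)"
    by (rule E0_add[where l = "KI (-3) 0 2 0"]) (simp_all add: E0_eval KI_eval KI_0)
  have 9: "point_add E0 (Affine (KI 1 0 0 0) (KI (-2) 0 0 0)) (Affine (KI 1 0 (-2) 0) (KI (-4) 0 2 0)) = Affine (KI 0 0 0 0) (KI (-1) 0 1 0)"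
    by (rule E0_add[where l = "KI (-2) 0 1 0"]) (simp_all add: E0_eval KI_eval KI_0)
  have 10: "point_add E0 (Affine (KI 0 0 0 0) (KI (-1) 0 1 0)) (Affine (KI 1 0 (-2) 0) (KI (-4) 0 2 0)) = Affine (KI (-1) 0 2 0) (KI (-2) 0 (-2) 0)"
    by (rule E0_add[where l = "KI (-1) 0 1 0"]) (simp_all add: E0_eval KI_eval KI_0)
  have 11: "point_add E0 (Affine (KI (-1) 0 2 0) (KI (-2) 0 (-2) 0)) (Affine (KI 1 0 (-2) 0) (KI (-4) 0 2 0)) = Affine (KI (-1) 0 0 0) (KI 2 0 0 0)"
    by (rule E0_add[where l = "KI (-1) 0 0 0"]) (simp_all add: E0_eval KI_eval KI_0)
  have 12: "point_add E0 (Affine (KI (-1) 0 0 0) (KI 2 0 0 0)) (Affine (KI 1 0 (-2) 0) (KI (-4) 0 2 0)) = Affine (KI 3 0 4 0) (KI (-10) 0 (-16) 0)"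
    by (rule E0_add[where l = "KI (-1) 0 2 0"]) (simp_all add: E0_eval KI_eval KI_0)
  have 13: "point_add E0 (Affine (KI 3 0 4 0) (KI (-10) 0 (-16) 0)) (Affine (KI 1 0 (-2) 0) (KI (-4) 0 2 0)) = Affine (KI 1 0 (-2) 0) (KI 2 0 0 0)"
    by (rule E0_add[where l = "KI (-3) 0 0 0"]) (simp_all add: E0_eval KI_eval KI_0)
  have "n = 0 \<or> n = 1 \<or> n = 2 \<or> n = 3 \<or> n = 4 \<or> n = 5 \<or> n = 6 \<or> n = 7 \<or> n = 8 \<or> n = 9 \<or> n = 10
    \<or> n = 11 \<or> n = 12 \<or> n = 13" using assms by presburger
  then show ?thesis
    by (elim disjE) (simp_all add: E0_torsion_def 1 2 3 4 5 6 7 8 9 10 11 12 13 del: point_add.simps(3))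
qed

lemma E0_pow:
  fixes n :: nat
  assumes "n \<le> 14"
  shows "(E0_torsion ! 1) [^]\<^bsub>MW E0\<^esub> n = E0_torsion ! n"
  using assms
proof (induction n)
  case 0
  then show ?case by (simp add: E0_torsion_def)
next
  case (Suc n)
  then show ?case using E0_torsion_add[of n] by (simp add: nat_pow_def[symmetric])
qed

lemma E0_torsion_length: "length E0_torsion = 15" by (simp add: E0_torsion_def)

lemma E0_torsion_distinct: "distinct E0_torsion"
  by (simp add: E0_torsion_def)

section \<open>Reduction modulo a prime above 3\<close>

definition residues3 :: "kf set" where
  "residues3 = {KI a b 0 0 | a b. a \<in> {-1,0,1} \<and> b \<in> {-1,0,1}}"

lemma vge3_KI: "v3.vge 1 (KI a b c d) \<longleftrightarrow> 3 dvd (a - c + d) \<and> 3 dvd (b - c - d)"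
  by (simp add: v3.vge1_iff KI_div_pi3)

lemma residues3_integral:
  assumes "v3.vge 0 x" shows "\<exists>t\<in>residues3. v3.vge 1 (x - t)"
proof (rule v3.integral_residue[OF _ _ _ assms])
  show "residues3 \<subseteq> kint" by (auto simp: residues3_def)
  have red: "\<exists>r\<in>{-1,0,1}. 3 dvd m - r" for m :: int by (simp; presburger)
  show "\<exists>t\<in>residues3. v3.vge 1 (w - t)" if "w \<in> kint" for w
  proof -
    from that obtain a b c d where w: "w = KI a b c d" by (elim kint_cases)
    obtain r where r: "r \<in> {-1,0,1}" "3 dvd (a - c + d) - r" using red by blast
    obtain s where s: "s \<in> {-1,0,1}" "3 dvd (b - c - d) - s" using red by blast
    have "v3.vge 1 (w - KI r s 0 0)"
      unfolding w KI_arith vge3_KI using r(2) s(2) by (simp add: algebra_simps)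
    moreover have "KI r s 0 0 \<in> residues3" using r s by (auto simp: residues3_def)
    ultimately show ?thesis by blast
  qed
  show "\<exists>t'\<in>residues3. v3.vge 1 (t * t' - 1)" if "t \<in> residues3" "\<not> v3.vge 1 t" for t
  proof -
    from that obtain a b where t: "t = KI a b 0 0"
      and r: "a = -1 \<or> a = 0 \<or> a = 1" "b = -1 \<or> b = 0 \<or> b = 1" by (auto simp: residues3_def)
    have "\<exists>a'\<in>{-1,0,1}. \<exists>b'\<in>{-1,0,1}. v3.vge 1 (t * KI a' b' 0 0 - 1)"
      using that(2) unfolding t
      by (simp add: KI_eval vge3_KI) (use r in \<open>elim disjE; simp\<close>)
    then show ?thesis unfolding residues3_def by blast
  qed
qed

text \<open>A search over the 81 pairs of residues: every affine point over the field with nine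
  elements is the reduction of a listed point, and 2 y + x + 1 stays nonzero there, as
  \<open>close_points\<close> requires.\<close>

lemma E0_residue_covered:
  assumes "t \<in> residues3" "t' \<in> residues3" "v3.vge 1 (weierstrass_eval E0 t t')"
  shows "\<exists>P\<in>set E0_torsion. \<exists>x y. P = Affine x y \<and> v3.vge 1 (x - t) \<and> v3.vge 1 (y - t') \<and> \<not> v3.vge 1 (2*y + x + 1)"
proof -
  obtain a b c d where t: "t = KI a b 0 0" "t' = KI c d 0 0"
    and r: "a = -1 \<or> a = 0 \<or> a = 1" "b = -1 \<or> b = 0 \<or> b = 1" "c = -1 \<or> c = 0 \<or> c = 1" "d = -1 \<or> d = 0 \<or> d = 1"
    using assms(1,2) by (auto simp: residues3_def)
  show ?thesis using assms(3) unfolding t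
    by (simp add: E0_torsion_def E0_eval KI_eval vge3_KI) (use r in \<open>elim disjE; simp\<close>)
qed

lemma E0_v3: "v3.val 3 = 1" "v3.val 4 = 0"
proof -
  have "v3.val (KI 0 1 1 (-1)) = 0" by (rule v3.val_unit) (simp_all add: KI_div_pi3)
  moreover have "v3.val (pi3 * KI 0 1 1 (-1)) = v3.val pi3 + v3.val (KI 0 1 1 (-1))"
    by (rule v3.val_mult[OF pi_nz(1)]) (simp add: KI_0)
  moreover have "3 = pi3 * KI 0 1 1 (-1)" by (simp add: pi3_def KI_arith KI_numeral)
  ultimately show "v3.val 3 = 1" by (simp add: v3.val_pi)
  show "v3.val 4 = 0" by (rule v3.val_unit) (simp_all add: KI_numeral KI_div_pi3)
qed

lemma E0_no_kernel_torsion: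
  assumes "P \<in> v3.kernel_points E0" shows "\<not> is_torsion (MW E0) P"
proof (rule group.no_torsion_if_descending[OF MW_group[OF E0_discriminant], where m = 3 and \<mu> = v3.xval, OF _ _ assms])
  show "x \<in> carrier (MW E0)" if "x \<in> v3.kernel_points E0" for x
    using that by (auto simp: v3.kernel_points_def)
  show "x [^]\<^bsub>MW E0\<^esub> (3::nat) \<in> v3.kernel_points E0 \<and> v3.xval (x [^]\<^bsub>MW E0\<^esub> (3::nat)) < v3.xval x"
    if x: "x \<in> v3.kernel_points E0" for x
  proof -
    have on: "on_curve E0 x" using x by (auto simp: v3.kernel_points_def)
    have "x [^]\<^bsub>MW E0\<^esub> (3::nat) = point_add E0 (point_add E0 x x) x"
      by (simp add: numeral_3_eq_3)
    also have "\<dots> = point_add E0 x (point_add E0 x x)"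
      using add_comm[OF E0_discriminant on] add_on_curve[OF on on] by metis
    finally show ?thesis
      using v3.kernel_triple[OF E0_integral E0_discriminant E0_v3(1) _ E0_v3(2) _ x] by simp
  qed
qed

lemma E0_torsion_is_torsion:
  assumes "P \<in> set E0_torsion" shows "is_torsion (MW E0) P"
proof -
  interpret G: comm_group "MW E0" by (rule MW_comm_group[OF E0_discriminant])
  obtain n where n: "n < 15" "P = E0_torsion ! n" using assms E0_torsion_length by (metis in_set_conv_nth)
  have on: "E0_torsion ! 1 \<in> carrier (MW E0)" using E0_torsion_on_curve E0_torsion_length by simp
  have 15: "(E0_torsion ! 1) [^]\<^bsub>MW E0\<^esub> (15::nat) = \<one>\<^bsub>MW E0\<^esub>"
    using E0_pow[of 14] G.nat_pow_Suc[of "E0_torsion ! 1" 14] by (simp add: E0_torsion_def E0_sel KI_eval)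
  have "P [^]\<^bsub>MW E0\<^esub> (15::nat) = ((E0_torsion ! 1) [^]\<^bsub>MW E0\<^esub> n) [^]\<^bsub>MW E0\<^esub> (15::nat)"
    using n E0_pow[of n] by simp
  also have "\<dots> = ((E0_torsion ! 1) [^]\<^bsub>MW E0\<^esub> (15::nat)) [^]\<^bsub>MW E0\<^esub> n"
    by (simp only: G.nat_pow_pow[OF on] mult.commute)
  also have "\<dots> = \<one>\<^bsub>MW E0\<^esub>" unfolding 15 by (rule G.nat_pow_one)
  finally show ?thesis unfolding is_torsion_def by (intro exI[of _ 15]) simp
qed

text \<open>A torsion point is integral at \<open>pi3\<close>, so it shares its residue with a
  listed point. Their difference is torsion and, if nonzero, would lie in the kernel of
  reduction.\<close>

lemma E0_torsion_complete:
  assumes Q: "on_curve E0 Q" "is_torsion (MW E0) Q"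
  shows "Q \<in> set E0_torsion"
proof (cases Q)
  case Infinity
  then show ?thesis by (simp add: E0_torsion_def)
next
  case Q': (Affine x y)
  interpret G: comm_group "MW E0" by (rule MW_comm_group[OF E0_discriminant])
  have on: "weierstrass_eval E0 x y = 0" using Q Q' by simp
  have "Q \<notin> v3.kernel_points E0" using E0_no_kernel_torsion Q by blast
  then have x: "v3.vge 0 x" using on Q' by (auto simp: v3.kernel_points_def v3.vge_def)
  have y: "v3.vge 0 y" by (rule v3.y_integral[OF E0_integral on x])
  obtain t where t: "t \<in> residues3" "v3.vge 1 (x - t)" using residues3_integral[OF x] by blast
  obtain t' where t': "t' \<in> residues3" "v3.vge 1 (y - t')" using residues3_integral[OF y] by blast
  have ti: "v3.vge 0 t" "v3.vge 0 t'" using t(1) t'(1) by (auto simp: residues3_def intro: v3.vge_R)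
  \<comment> \<open>The difference of the equation at (x, y) and (t, t') is a combination of y - t'
    and x - t; hence the residues again satisfy the equation.\<close>
  have "weierstrass_eval E0 t t' = weierstrass_eval E0 x y
      - ((y + t' + x + 1) * (y - t') + (t' - (x^2 + x*t + t^2 + x + t - 3)) * (x - t))"
    unfolding E0_eval by Groebner_Basis.algebra
  moreover have "v3.vge 1 ((y + t' + x + 1) * (y - t') + (t' - (x^2 + x*t + t^2 + x + t - 3)) * (x - t))"
    unfolding power2_eq_square
    by (intro v3.vge_add v3.vge_mult0 t(2) t'(2) v3.vge_diff)
      (simp_all add: v3.vge_mult0 x y ti v3.vge_numeral v3.vge_R kint_ring)
  ultimately have "v3.vge 1 (weierstrass_eval E0 t t')"
    by (metis on diff_0 v3.vge_uminus)
  from E0_residue_covered[OF t(1) t'(1) this] obtain px py where P: "Affine px py \<in> set E0_torsion"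
    "v3.vge 1 (px - t)" "v3.vge 1 (py - t')" "\<not> v3.vge 1 (2*py + px + 1)" by blast
  have onP: "weierstrass_eval E0 px py = 0" using E0_torsion_on_curve[OF P(1)] by simp
  have pi: "v3.vge 0 px"
    using v3.vge_add[OF v3.vge_mono[OF P(2), of 0] ti(1)] by simp
  have "v3.vge 1 ((px - t) - (x - t))" "v3.vge 1 ((py - t') - (y - t'))"
    by (intro v3.vge_diff P t t')+
  then have c: "v3.vge 1 (px - x)" "v3.vge 1 (py - y)" by simp_all
  have "Affine px py = Affine x y"
  proof (rule ccontr)
    assume "Affine px py \<noteq> Affine x y"
    then have "point_add E0 (Affine px py) (point_neg E0 (Affine x y)) \<in> v3.kernel_points E0"
      using v3.close_points[OF E0_integral onP on pi x c] P(4) by (simp add: E0_sel)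
    moreover have "is_torsion (MW E0) (Affine px py \<otimes>\<^bsub>MW E0\<^esub> inv\<^bsub>MW E0\<^esub> (Affine x y))"
      using Q Q' onP on E0_torsion_is_torsion[OF P(1)]
      by (intro G.torsion_mult G.torsion_inv G.inv_closed) simp_all
    ultimately show False using E0_no_kernel_torsion MW_inv[OF E0_discriminant, of "Affine x y"] on by simp
  qed
  then show ?thesis using P Q' by simp
qed

lemma E0_torsion_subgroup: "torsion_subgroup (MW E0) \<cong> integer_mod_group 15"
proof (rule group.cyclic_torsion_iso[OF MW_group[OF E0_discriminant], of "E0_torsion ! 1"])
  show "E0_torsion ! 1 \<in> carrier (MW E0)" using E0_torsion_on_curve E0_torsion_length by simp
  show "(E0_torsion ! 1) [^]\<^bsub>MW E0\<^esub> (15::nat) = \<one>\<^bsub>MW E0\<^esub>"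
    using E0_pow[of 14] monoid.nat_pow_Suc[OF group.is_monoid[OF MW_group[OF E0_discriminant]], of "E0_torsion ! 1" 14] by (simp add: E0_torsion_def E0_sel KI_eval)
  show "inj_on (\<lambda>i::nat. (E0_torsion ! 1) [^]\<^bsub>MW E0\<^esub> i) {..<15}"
    using E0_pow E0_torsion_distinct E0_torsion_length
    by (intro inj_onI) (simp add: nth_eq_iff_index_eq)
  show "\<exists>i::nat. y = (E0_torsion ! 1) [^]\<^bsub>MW E0\<^esub> i" if "y \<in> carrier (MW E0)" "is_torsion (MW E0) y" for y
  proof -
    have "y \<in> set E0_torsion" using E0_torsion_complete that by simp
    then obtain n where "n < 15" "y = E0_torsion ! n" using E0_torsion_length by (metis in_set_conv_nth)
    then show ?thesis using E0_pow[of n] by (intro exI[of _ n]) simp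
  qed
qed simp

lemma E0_nontorsion:
  "on_curve E0 (Affine (KI (-5) 0 0 0) (KI 2 (-4) 0 8))"
  "\<not> is_torsion (MW E0) (Affine (KI (-5) 0 0 0) (KI 2 (-4) 0 8))"
proof -
  show on: "on_curve E0 (Affine (KI (-5) 0 0 0) (KI 2 (-4) 0 8))" by (simp add: E0_eval KI_eval KI_0)
  show "\<not> is_torsion (MW E0) (Affine (KI (-5) 0 0 0) (KI 2 (-4) 0 8))"
    using E0_torsion_complete[OF on] by (auto simp: E0_torsion_def)
qed

section \<open>Descent over the rationals\<close>

lemma int_coprime_square:
  fixes a b z :: int
  assumes "coprime a b" "a * b = z ^ 2" "a > 0" "b > 0"
  shows "\<exists>s. a = s ^ 2" "\<exists>s. b = s ^ 2"
proof -
  have "nat a * nat b = nat \<bar>z\<bar> ^ 2"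
    using assms by (metis nat_mult_distrib nat_power_eq abs_ge_zero power2_abs less_imp_le)
  then have p: "is_nth_power 2 (nat a * nat b)" by (metis is_nth_power_nth_power)
  have c: "coprime (nat a) (nat b)" using assms by (simp add: coprime_int_iff[symmetric])
  have "is_nth_power 2 (nat a)" "is_nth_power 2 (nat b)"
    using is_nth_power_mult_coprime_natD[OF c p] assms by simp_all
  then show "\<exists>s. a = s ^ 2" "\<exists>s. b = s ^ 2"
    using assms by (metis is_nth_powerE int_nat_eq less_imp_le of_nat_power)+
qed

lemma squarefree_dvd_square:
  fixes b z :: int
  assumes sf: "squarefree b" and d: "b dvd z ^ 2"
  shows "b dvd z"
proof -
  define g where "g = gcd b z"
  have "b \<noteq> 0" using sf by auto
  then have g0: "g \<noteq> 0" by (simp add: g_def)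
  obtain b' z' where bz: "b = g * b'" "z = g * z'" "coprime b' z'"
    using gcd_coprime_exists[of b z] g0 unfolding g_def by (metis mult.commute)
  have "g * b' dvd g * (g * z' ^ 2)" using d unfolding bz by (simp add: power2_eq_square algebra_simps)
  then have "b' dvd g * z' ^ 2" using g0 by simp
  then have "b' dvd g" using bz(3) by (simp add: coprime_dvd_mult_left_iff)
  then have "b' ^ 2 dvd b" unfolding bz(1) power2_eq_square by (rule mult_dvd_mono) simp
  then have "b' dvd 1" by (rule squarefreeD[OF sf])
  then have "b' dvd z'" by (rule dvd_trans) simp
  then show ?thesis unfolding bz by (intro mult_dvd_mono) simp_all
qed

lemma squarefree_times_square:
  fixes b k z :: int
  assumes sf: "squarefree b" and e: "b * k = z ^ 2"
  shows "\<exists>w. k = b * w ^ 2"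
proof -
  have "b dvd z" by (rule squarefree_dvd_square[OF sf]) (metis e dvd_triv_left)
  then obtain w where "z = b * w" by blast
  then have "b * k = b * (b * w ^ 2)" using e by (simp add: power2_eq_square algebra_simps)
  then show ?thesis using sf by (metis mult_cancel_left not_squarefree_0)
qed

text \<open>The first step of a descent by 2-isogeny. With xx = m / n in lowest terms, n m k is a
  square and n is coprime to m k, so n = N^2 and m k is a square. The squarefree part b of m divides
  k, hence f n^2, hence f. Positivity of xx leaves only positive b.\<close>

lemma torsor:
  fixes xx yy :: rat and e f :: int
  assumes eq: "yy ^ 2 = xx * (xx ^ 2 + of_int e * xx + of_int f)" and xx: "xx > 0" and yy: "yy \<noteq> 0"
  shows "\<exists>b M N w. M \<noteq> 0 \<and> N \<noteq> 0 \<and> b > 0 \<and> squarefree b \<and> b dvd f \<and> coprime (b * M ^ 2) (N ^ 2) \<and>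
    xx = of_int (b * M ^ 2) / of_int (N ^ 2) \<and>
    b ^ 2 * M ^ 4 + e * b * M ^ 2 * N ^ 2 + f * N ^ 4 = b * w ^ 2 \<and>
    xx ^ 2 + of_int e * xx + of_int f = of_int (b * w ^ 2) / of_int (N ^ 4)"
proof -
  obtain m n where mn: "quotient_of xx = (m, n)" by fastforce
  have n: "n > 0" "coprime m n" "xx = of_int m / of_int n"
    using quotient_of_denom_pos[OF mn] quotient_of_coprime[OF mn] quotient_of_div[OF mn] by auto
  have m: "m > 0" using xx n by (simp add: zero_less_divide_iff)
  define k where "k = m ^ 2 + e * m * n + f * n ^ 2"
  have k: "xx ^ 2 + of_int e * xx + of_int f = of_int k / of_int (n ^ 2)"
    unfolding n(3) k_def using n(1) by (simp add: field_simps power2_eq_square)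
  have kpos: "xx ^ 2 + of_int e * xx + of_int f > 0"
    using eq xx yy by (metis zero_less_mult_pos zero_less_power2)
  then have k0: "k > 0" using n unfolding k by (simp add: zero_less_divide_iff)
  have "(yy * of_int (n ^ 2)) ^ 2 = of_int (n * (m * k))"
  proof -
    have "(yy * of_int (n ^ 2)) ^ 2 = (of_int m / of_int n) * (of_int k / of_int (n ^ 2)) * of_int (n ^ 2) ^ 2"
      unfolding power_mult_distrib eq k using n by simp
    also have "\<dots> = of_int (n * (m * k))" using n by (simp add: field_simps power2_eq_square)
    finally show ?thesis .
  qed
  moreover have "\<exists>z. q = of_int z" if "q ^ 2 = of_int a" for q :: rat and a
  proof -
    obtain c d where cd: "quotient_of q = (c, d)" by fastforce
    have d: "d > 0" "coprime c d" "q = of_int c / of_int d"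
      using quotient_of_denom_pos[OF cd] quotient_of_coprime[OF cd] quotient_of_div[OF cd] by auto
    have "(of_int (c ^ 2) :: rat) = of_int (a * d ^ 2)"
      using that d by (simp add: field_simps power2_eq_square)
    then have "c ^ 2 = a * d ^ 2" by (simp only: of_int_eq_iff)
    then have "d ^ 2 dvd c ^ 2" by simp
    then have "d dvd c" by simp
    then have "d dvd 1" using d(2) by (metis coprime_common_divisor dvd_refl)
    then have "d = 1" using d(1) by (simp add: zdvd1_eq)
    then show ?thesis using d by auto
  qed
  ultimately obtain z where "yy * of_int (n ^ 2) = of_int z" by blast
  then have "(of_int (z ^ 2) :: rat) = of_int (n * (m * k))"
    using \<open>(yy * of_int (n ^ 2)) ^ 2 = of_int (n * (m * k))\<close> by simp
  then have z: "n * (m * k) = z ^ 2" by (simp only: of_int_eq_iff)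
  have "k = (e * m + f * n) * n + m ^ 2" by (simp add: k_def algebra_simps power2_eq_square)
  then have "gcd n k = gcd n (m ^ 2)" by (metis gcd_add_mult)
  then have "coprime n k" using n(2) by (simp add: coprime_iff_gcd_eq_1[symmetric] coprime_commute)
  then have "coprime n (m * k)" using n(2) by (simp add: coprime_commute)
  from int_coprime_square[OF this z n(1)] m k0 obtain N z1 where N: "n = N ^ 2" and z1: "m * k = z1 ^ 2" by auto
  define b M where "b = squarefree_part m" and "M = square_part m"
  have bM: "m = b * M ^ 2" and sf: "squarefree b" using squarefree_decompose[of m] by (simp_all add: b_def M_def)
  have M0: "M \<noteq> 0" using m bM by auto
  have b0: "b > 0" using m unfolding bM by (metis zero_less_mult_pos2 zero_less_power2 M0)
  have "M ^ 2 dvd z1 ^ 2" using z1 bM by (metis dvd_triv_left mult.assoc mult.commute)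
  then have "M dvd z1" by simp
  then obtain z2 where "z1 = M * z2" by blast
  then have "M ^ 2 * (b * k) = M ^ 2 * z2 ^ 2" using z1 bM by (simp add: power2_eq_square algebra_simps)
  then have "b * k = z2 ^ 2" using M0 by simp
  from squarefree_times_square[OF sf this] obtain w where w: "k = b * w ^ 2" by blast
  have "b dvd f * n ^ 2"
  proof -
    have "f * n ^ 2 = k - m * (m + e * n)" by (simp add: k_def power2_eq_square algebra_simps)
    then show ?thesis using w bM by (simp add: dvd_diff)
  qed
  moreover have "coprime b (n ^ 2)" using n(2) bM by simp
  ultimately have bf: "b dvd f" by (simp add: coprime_dvd_mult_left_iff)
  have "b ^ 2 * M ^ 4 + e * b * M ^ 2 * N ^ 2 + f * N ^ 4 = b * w ^ 2"
    unfolding w[symmetric] k_def N bM by Groebner_Basis.algebra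
  moreover have "N \<noteq> 0" using n N by auto
  moreover have "xx ^ 2 + of_int e * xx + of_int f = of_int (b * w ^ 2) / of_int (N ^ 4)"
    unfolding k w N by simp
  ultimately show ?thesis using M0 b0 sf bf n(2,3) N bM by (intro exI[of _ b] exI[of _ M] exI[of _ N] exI[of _ w]) simp
qed

text \<open>The equation is four times a torsor equation with the square completed. Modulo 3 it
  equates a square with twice a square, so both vanish; then 9 divides 15 d^2 V^2, which gives V and
  then U.\<close>

lemma not_dvd_square_sum_3:
  fixes U V z b d :: int
  assumes b: "b mod 3 = 2" and d: "\<not> 3 dvd d"
    and e: "(2*b*U - 7*d*V)^2 + 15*d^2*V^2 = 4*b*z^2"
  shows "3 dvd U \<and> 3 dvd V"
proof -
  define p where "p = 2*b*U - 7*d*V"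
  have sq: "x mod 3 = 0 \<and> x^2 mod 3 = 0 \<or> x^2 mod 3 = 1" for x :: int
  proof -
    define k where "k = x div 3"
    have "x = 3 * k \<or> x = 3 * k + 1 \<or> x = 3 * k + 2" unfolding k_def by presburger
    moreover have "(3*k)^2 = 3 * (3*k^2)" "(3*k+1)^2 = 1 + 3*(3*k^2 + 2*k)" "(3*k+2)^2 = 1 + 3*(3*k^2+4*k+1)"
      by Groebner_Basis.algebra+
    moreover have "x^2 mod 3 = 1" if "x^2 = 1 + 3*t" for t using that by presburger
    moreover have "x^2 mod 3 = 0" if "x^2 = 3*t" for t using that by presburger
    moreover have "x mod 3 = 0" if "x = 3*k" using that by presburger
    ultimately show ?thesis by metis
  qed
  have "(p^2 + 15*d^2*V^2) mod 3 = p^2 mod 3"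
  proof -
    have "p^2 + 15*d^2*V^2 = p^2 + 3 * (5*d^2*V^2)" by simp
    then show ?thesis by (metis mod_mult_self2)
  qed
  moreover have "(4*b*z^2) mod 3 = (2 * (z^2 mod 3)) mod 3"
  proof -
    have "b = 3 * (b div 3) + 2" using b by presburger
    then have "4*b*z^2 = 2*z^2 + 3*((4*(b div 3) + 2)*z^2)" by Groebner_Basis.algebra
    then show ?thesis by (metis mod_mult_self2 mod_mult_right_eq)
  qed
  ultimately have m: "p^2 mod 3 = (2 * (z^2 mod 3)) mod 3" using e unfolding p_def by simp
  have "z mod 3 = 0 \<and> p mod 3 = 0" using m sq[of z] sq[of p] by auto
  then have z3: "3 dvd z" and p3: "3 dvd p" by (simp_all add: dvd_eq_mod_eq_0)
  obtain p' z' where pz: "p = 3 * p'" "z = 3 * z'" using z3 p3 by (elim dvdE)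
  have "15*d^2*V^2 = 4*b*z^2 - p^2" using e unfolding p_def by simp
  then have "5*(d^2*V^2) = 3 * (4*b*z'^2 - p'^2)" unfolding pz by (simp add: power2_eq_square)
  then have "3 dvd 5 * (d^2*V^2)" by simp
  moreover have p3: "prime (3::int)" by simp
  moreover have "\<not> 3 dvd (5::int)" by simp
  ultimately have "3 dvd d^2*V^2" using prime_dvd_mult_iff by blast
  then have V: "3 dvd V" using d p3 by (metis prime_dvd_mult_iff prime_dvd_power)
  have "2*b*U = p + 7*d*V" by (simp add: p_def)
  then have "3 dvd 2*(b*U)" using V pz by (simp add: mult.assoc)
  moreover have "\<not> 3 dvd (2::int)" "\<not> 3 dvd b" using b by (simp_all add: dvd_eq_mod_eq_0)
  ultimately have "3 dvd U" using p3 prime_dvd_mult_iff by blast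
  with V show ?thesis by blast
qed

lemma small_squarefree:
  fixes b :: int
  assumes "squarefree b" "b > 0" "b dvd 20"
  shows "b = 1 \<or> b = 2 \<or> b = 5 \<or> b = 10"
proof -
  have "b \<le> 20" using assms by (intro zdvd_imp_le) simp_all
  then have "b \<in> set [1..20]" using assms by simp
  moreover have "\<forall>b\<in>set [1..20::int]. b dvd 20 \<longrightarrow> b = 1 \<or> b = 2 \<or> b = 5 \<or> b = 10 \<or> b = 4 \<or> b = 20" by code_simp
  moreover have "b \<noteq> 4" "b \<noteq> 20" using squarefreeD[OF assms(1), of 2] by auto
  ultimately show ?thesis using assms(3) by blast
qed

lemma small_squarefree':
  fixes b :: int
  assumes "squarefree b" "b > 0" "b dvd 75"
  shows "b = 1 \<or> b = 3 \<or> b = 5 \<or> b = 15"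
proof -
  have "b \<le> 75" using assms by (intro zdvd_imp_le) simp_all
  then have "b \<in> set [1..75]" using assms by simp
  moreover have "\<forall>b\<in>set [1..75::int]. b dvd 75 \<longrightarrow> b = 1 \<or> b = 3 \<or> b = 5 \<or> b = 15 \<or> b = 25 \<or> b = 75" by code_simp
  moreover have "b \<noteq> 25" "b \<noteq> 75" using squarefreeD[OF assms(1), of 5] by auto
  ultimately show ?thesis using assms(3) by blast
qed

lemma form_mod:
  fixes a b c u v m :: int
  shows "(a*u^2 + b*u*v + c*v^2) mod m = (a*(u mod m)^2 + b*(u mod m)*(v mod m) + c*(v mod m)^2) mod m"
proof -
  define k l r s where d: "k = u div m" "l = v div m" "r = u mod m" "s = v mod m"
  have "u = m*k + r" "v = m*l + s" by (simp_all add: d)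
  then have "a*u^2 + b*u*v + c*v^2 = (a*r^2 + b*r*s + c*s^2) + m * (a*(m*k^2+2*k*r) + b*(m*k*l + k*s + l*r) + c*(m*l^2 + 2*l*s))"
    by Groebner_Basis.algebra
  then show ?thesis unfolding d by (metis mod_mult_self2)
qed

lemma square_mod:
  fixes u m :: int
  shows "u^2 mod m = (u mod m)^2 mod m"
  using form_mod[of 1 u 0 0 0 m] by simp

definition squares64 :: "int list" where "squares64 = [0,1,4,9,16,17,25,33,36,41,49,57]"

lemma square_mod_64:
  fixes u :: int
  shows "u^2 mod 64 \<in> set squares64"
proof -
  have "u mod 64 \<in> set [0..63]" by simp
  moreover have "\<forall>r\<in>set [0..63::int]. r^2 mod 64 \<in> set squares64" by code_simp
  ultimately show ?thesis using square_mod[of u 64] by simp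
qed

text \<open>Insolubility at 2 of a M^4 + b M^2 N^2 + c N^4 = w^2, tested modulo 64 with u and v in
  place of M^2 and N^2.\<close>

definition torsor_obstruction :: "int \<Rightarrow> int \<Rightarrow> int \<Rightarrow> bool" where
  "torsor_obstruction a b c \<longleftrightarrow> (\<forall>u\<in>set squares64. \<forall>v\<in>set squares64. \<not> (even u \<and> even v) \<longrightarrow>
     (a*u^2 + b*u*v + c*v^2) mod 64 \<notin> set squares64)"

lemma torsor_obstruction:
  fixes M N w a b c :: int
  assumes "torsor_obstruction a b c" "a * M^4 + b * M^2 * N^2 + c * N^4 = w^2" "\<not> (even M \<and> even N)"
  shows False
proof -
  have ev: "even (u^2 mod 64) \<longleftrightarrow> even u" for u :: int
  proof -
    have "even (x mod 64) \<longleftrightarrow> even x" for x :: int by presburger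
    from this[of "u^2"] show ?thesis by simp
  qed
  have "a * M^4 + b * M^2 * N^2 + c * N^4 = a * (M^2)^2 + b * M^2 * N^2 + c * (N^2)^2"
    by (simp add: power_mult[symmetric])
  then have "w^2 mod 64 = (a*(M^2 mod 64)^2 + b*(M^2 mod 64)*(N^2 mod 64) + c*(N^2 mod 64)^2) mod 64"
    using assms(2) form_mod[of a "M^2" b "N^2" c 64] by simp
  then show False using assms(1,3) square_mod_64[of w] square_mod_64[of M] square_mod_64[of N] ev[of M] ev[of N]
    unfolding torsor_obstruction_def by metis
qed

text \<open>Two triples (b, 14 d, -15 d^2 / b) for each of d = 1, -1, 5, -5 in turn: the positive
  classes b that have to be excluded.\<close>

lemma torsor_obstructions:
  "torsor_obstruction 3 14 (-5)" "torsor_obstruction 15 14 (-1)"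
  "torsor_obstruction 3 (-14) (-5)" "torsor_obstruction 5 (-14) (-3)"
  "torsor_obstruction 3 70 (-125)" "torsor_obstruction 15 70 (-25)"
  "torsor_obstruction 5 (-70) (-75)" "torsor_obstruction 15 (-70) (-25)"
  by code_simp+

text \<open>Modulo 5 the form is 2 (u + 3 s v)^2 with u = M^2 and v = N^2, so a zero has M^2 = 2 s
  N^2; but neither 2 nor -2 is a square modulo 5.\<close>

lemma form_mod_5:
  fixes M N w s :: int
  assumes e: "2 * M^4 + 7 * s * M^2 * N^2 + 8 * N^4 = 5 * w" and s: "s = 1 \<or> s = -1"
  shows "5 dvd M \<and> 5 dvd N"
proof -
  have sq: "u^2 mod 5 \<in> set [0,1,4] \<and> (u^2 mod 5 = 0 \<longrightarrow> 5 dvd u)" for u :: int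
  proof -
    have 1: "u mod 5 \<in> set [0..4]" by simp
    have 2: "\<forall>r\<in>set [0..4::int]. r^2 mod 5 \<in> set [0,1,4] \<and> (r^2 mod 5 = 0 \<longrightarrow> r = 0)" by code_simp
    show ?thesis using bspec[OF 2 1] unfolding square_mod[of u 5, symmetric] dvd_eq_mod_eq_0 .
  qed
  have "2 * M^4 + 7 * s * M^2 * N^2 + 8 * N^4 = 2 * (M^2)^2 + (7 * s) * M^2 * N^2 + 8 * (N^2)^2"
    by (simp add: power_mult[symmetric])
  then have m: "(2*(M^2 mod 5)^2 + (7*s)*(M^2 mod 5)*(N^2 mod 5) + 8*(N^2 mod 5)^2) mod 5 = 0"
    using e form_mod[of 2 "M^2" "7*s" "N^2" 8 5] by simp
  have 3: "\<forall>s\<in>set [1,-1::int]. \<forall>u\<in>set [0,1,4::int]. \<forall>v\<in>set [0,1,4]. (2*u^2 + (7*s)*u*v + 8*v^2) mod 5 = 0 \<longrightarrow> u = 0 \<and> v = 0"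
    by code_simp
  have 4: "s \<in> set [1,-1]" using s by auto
  have "M^2 mod 5 = 0 \<and> N^2 mod 5 = 0"
    by (rule mp[OF bspec[OF bspec[OF bspec[OF 3 4] conjunct1[OF sq[of M]]] conjunct1[OF sq[of N]]] m])
  then show ?thesis
    using mp[OF conjunct2[OF sq[of M]]] mp[OF conjunct2[OF sq[of N]]] by simp
qed

text \<open>With \<open>X = 4 d (x + 1)\<close> the twist of \<open>J\<close> by \<open>d\<close> becomes \<open>Y\<^sup>2 = X (X\<^sup>2 - 7 d X + 16 d\<^sup>2)\<close>; the quotient by
  the 2-torsion point \<open>X = 0\<close> is \<open>Y\<^sup>2 = A (A\<^sup>2 + 14 d A - 15 d\<^sup>2)\<close>.\<close>

lemma twist_abscissa_square:
  fixes d :: int and x y :: rat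
  assumes d: "d \<in> {1, -1, 5, -5}"
    and eq: "y^2 = x * (x^2 - 7 * of_int d * x + 16 * of_int d^2)" and x0: "x \<noteq> 0"
  shows "\<exists>\<alpha> n. \<alpha> \<noteq> 0 \<and> x = \<alpha>^2 \<and> n^2 = x^2 - 7 * of_int d * x + 16 * of_int d^2"
proof -
  \<comment> \<open>The discriminant -15 d^2 is negative, so the quadratic factor is positive and x
    has to be positive too.\<close>
  have "x^2 - 7 * of_int d * x + 16 * of_int d^2 = (x - 7/2 * of_int d)^2 + 15/4 * of_int d^2"
    by (simp add: power2_eq_square algebra_simps)
  moreover have "(of_int d :: rat)^2 > 0" using d by auto
  moreover have "(x - 7/2 * of_int d)^2 \<ge> 0" by simp
  ultimately have pos: "x^2 - 7 * of_int d * x + 16 * of_int d^2 > 0" by linarith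
  then have y0: "y \<noteq> 0" using eq x0 by auto
  then have xpos: "x > 0" using eq pos by (metis zero_less_mult_pos2 zero_less_power2)
  have "y^2 = x * (x^2 + of_int (-7*d) * x + of_int (16*d^2))" using eq by simp
  from torsor[OF this xpos y0] obtain b M N w where t: "M \<noteq> 0" "N \<noteq> 0" "b > 0" "squarefree b" "b dvd 16*d^2"
    "coprime (b * M ^ 2) (N ^ 2)" "x = of_int (b * M ^ 2) / of_int (N ^ 2)"
    "b ^ 2 * M ^ 4 + (-7*d) * b * M ^ 2 * N ^ 2 + (16*d^2) * N ^ 4 = b * w ^ 2"
    "x ^ 2 + of_int (-7*d) * x + of_int (16*d^2) = of_int (b * w ^ 2) / of_int (N ^ 4)" by blast
  have cop: "coprime M N" using t(6) by simp
  have "b dvd (4*d)^2" using t(5) by (simp add: power_mult_distrib)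
  then have "b dvd 4*d" by (rule squarefree_dvd_square[OF t(4)])
  then have "b dvd 20" using d by (auto elim: dvd_trans)
  from small_squarefree[OF t(4,3) this] have b: "b = 1 \<or> b = 2 \<or> b = 5 \<or> b = 10" .
  \<comment> \<open>Both values are 2 modulo 3, where the torsor has no primitive solution; the
    value 10 is excluded modulo 5 instead.\<close>
  have "b \<noteq> 2 \<and> b \<noteq> 5"
  proof (rule ccontr)
    assume "\<not> ?thesis"
    then have "b mod 3 = 2" by auto
    moreover have "\<not> 3 dvd d" using d by auto
    moreover have "(2*b*M^2 - 7*d*N^2)^2 + 15*d^2*(N^2)^2 = 4*b*w^2"
      using t(8) by Groebner_Basis.algebra
    ultimately have "3 dvd M^2 \<and> 3 dvd N^2" by (rule not_dvd_square_sum_3)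
    then have "3 dvd M" "3 dvd N" using prime_dvd_power[of "3::int"] by auto
    then have "(3::int) dvd 1" using coprime_common_divisor[OF cop] by blast
    then show False by simp
  qed
  moreover have "b \<noteq> 10"
  proof
    assume b: "b = 10"
    have d5: "d = 5 \<or> d = -5" using \<open>b dvd 4*d\<close> b d by auto
    obtain s where s: "d = 5 * s" "s = 1 \<or> s = -1" using d5 by (elim disjE) auto
    have s2: "s^2 = 1" using s(2) by auto
    have w1: "w^2 = 10*M^4 - 35*s*M^2*N^2 + 40*N^4" using t(8) s2 unfolding b s(1) by Groebner_Basis.algebra
    then have "w^2 = 5 * (2*M^4 - 7*s*M^2*N^2 + 8*N^4)" by simp
    then have "5 dvd w^2" by simp
    then have "5 dvd w" using prime_dvd_power[of "5::int"] by simp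
    then obtain v where "w = 5 * v" by blast
    then have "2*M^4 + 7*(-s)*M^2*N^2 + 8*N^4 = 5*v^2" using w1 by Groebner_Basis.algebra
    from form_mod_5[OF this] s(2) have "5 dvd M" "5 dvd N" by auto
    then have "(5::int) dvd 1" using coprime_common_divisor[OF cop] by blast
    then show False by simp
  qed
  ultimately have b1: "b = 1" using b by blast
  have "x = (of_int M / of_int N)^2" using t(7) b1 by (simp add: power_divide)
  moreover have "(of_int w / of_int (N^2))^2 = x^2 - 7 * of_int d * x + 16 * of_int d^2"
    using t(9) b1 by (simp add: power_divide power_mult[symmetric])
  moreover have "of_int M / of_int N \<noteq> (0::rat)" using t by simp
  ultimately show ?thesis by blast
qed

text \<open>The one positive class besides 1 that survives modulo 64. For d \<noteq> 1 it is the
  class of the positive root of A^2 + 14 d A - 15 d^2 = (A - d) (A + 15 d), where 75 counts as 3.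
  For d = 1 that root is 1, and 5 comes from the 4-torsion point (0, 0) of J, which has A =
  5.\<close>

definition twist_class :: "int \<Rightarrow> int" where
  "twist_class d = (if d = 1 then 5 else if d = -1 then 15 else if d = 5 then 5 else 3)"

lemma isogenous_twist_abscissa:
  fixes d :: int and A y :: rat
  assumes d: "d \<in> {1, -1, 5, -5}"
    and eq: "y^2 = A * (A^2 + 14 * of_int d * A - 15 * of_int d^2)" and A: "A > 0" and y: "y \<noteq> 0"
  shows "\<exists>\<beta>. \<beta> \<noteq> 0 \<and> (A = \<beta>^2 \<or> A = of_int (twist_class d) * \<beta>^2)"
proof -
  have "y^2 = A * (A^2 + of_int (14*d) * A + of_int (-15*d^2))" using eq by simp
  from torsor[OF this A y] obtain b M N w where t: "M \<noteq> 0" "N \<noteq> 0" "b > 0" "squarefree b" "b dvd -15*d^2"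
    "coprime (b * M ^ 2) (N ^ 2)" "A = of_int (b * M ^ 2) / of_int (N ^ 2)"
    "b ^ 2 * M ^ 4 + (14*d) * b * M ^ 2 * N ^ 2 + (-15*d^2) * N ^ 4 = b * w ^ 2" by blast
  have "-15*d^2 dvd (15*d)^2" by (simp add: power_mult_distrib)
  then have "b dvd (15*d)^2" using t(5) dvd_trans by blast
  then have "b dvd 15*d" by (rule squarefree_dvd_square[OF t(4)])
  then have "b dvd 75" using d by (auto elim: dvd_trans)
  from small_squarefree'[OF t(4,3) this] have b: "b = 1 \<or> b = 3 \<or> b = 5 \<or> b = 15" .
  have odd: "\<not> (even M \<and> even N)" using t(6) by auto
  have no: False if "torsor_obstruction b (14*d) c" "b * c = -15*d^2" for c
  proof (rule torsor_obstruction[OF that(1) _ odd])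
    have "b * (b * M ^ 4 + 14*d * M ^ 2 * N ^ 2 + c * N ^ 4) = b * w^2"
      using t(8) that(2) by Groebner_Basis.algebra
    then show "b * M ^ 4 + 14*d * M ^ 2 * N ^ 2 + c * N ^ 4 = w^2" using t(3) by simp
  qed
  have "b = 1 \<or> b = twist_class d"
    using d b no[of "-5"] no[of "-1"] no[of "-3"] no[of "-125"] no[of "-25"] no[of "-75"]
    by (auto simp: twist_class_def torsor_obstructions)
  moreover have "A = of_int b * (of_int M / of_int N)^2" using t(7) by (simp add: power_divide)
  moreover have "of_int M / of_int N \<noteq> (0::rat)" using t by simp
  ultimately show ?thesis by (metis mult_1 of_int_1)
qed

section \<open>Points of the modular curve\<close>

locale field_hom =
  fixes h :: "'a::field \<Rightarrow> 'b::field"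
  assumes h_add: "h (x + y) = h x + h y" and h_mult: "h (x * y) = h x * h y" and h_one: "h 1 = 1"
begin

lemma h_zero: "h 0 = 0" using h_add[of 0 0] by (metis add_cancel_right_left add.right_neutral)

lemma h_minus: "h (- x) = - h x" using h_add[of x "- x"] h_zero by (simp add: eq_neg_iff_add_eq_0 add.commute)

lemma h_diff: "h (x - y) = h x - h y" using h_add[of x "- y"] h_minus by simp

lemma h_eq_0: "h x = 0 \<longleftrightarrow> x = 0"
proof
  assume "h x = 0"
  show "x = 0"
  proof (rule ccontr)
    assume "x \<noteq> 0"
    then have "h x * h (inverse x) = 1" unfolding h_mult[symmetric] by (simp add: h_one)
    then show False using \<open>h x = 0\<close> by simp
  qed
qed (simp add: h_zero)

lemma h_eq: "h x = h y \<longleftrightarrow> x = y"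
  using h_eq_0[of "x - y"] by (simp add: h_diff)

lemma h_divide: "h (x / y) = h x / h y"
proof (cases "y = 0")
  case False
  then have "h (x / y) * h y = h x" unfolding h_mult[symmetric] by simp
  then show ?thesis using False h_eq_0 by (simp add: field_simps)
qed (simp add: h_zero)

lemma h_power: "h (x ^ n) = h x ^ n" by (induction n) (simp_all add: h_one h_mult)

lemma h_numeral: "h (numeral n) = numeral n"
  by (induction n) (simp_all only: numeral.simps h_add h_one)

lemmas h_simps = h_add h_mult h_one h_zero h_minus h_diff h_divide h_power h_numeral

definition map_curve :: "'a weierstrass \<Rightarrow> 'b weierstrass" where
  "map_curve E = \<lparr>a1 = h (a1 E), a2 = h (a2 E), a3 = h (a3 E), a4 = h (a4 E), a6 = h (a6 E)\<rparr>"

lemma map_curve_sel: "a1 (map_curve E) = h (a1 E)" "a2 (map_curve E) = h (a2 E)"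
  "a3 (map_curve E) = h (a3 E)" "a4 (map_curve E) = h (a4 E)" "a6 (map_curve E) = h (a6 E)"
  by (simp_all add: map_curve_def)

lemma map_curve_eval: "weierstrass_eval (map_curve E) (h x) (h y) = h (weierstrass_eval E x y)"
  by (simp add: weierstrass_eval_def map_curve_sel h_simps)

lemma map_curve_on_curve: "on_curve (map_curve E) (map_point h P) \<longleftrightarrow> on_curve E P"
  by (cases P) (simp_all add: map_curve_eval h_eq_0)

lemma map_curve_discriminant: "discriminant (map_curve E) = h (discriminant E)"
  by (simp add: discriminant_def Let_def map_curve_sel h_simps)

lemma map_point_neg: "point_neg (map_curve E) (map_point h P) = map_point h (point_neg E P)"
  by (cases P) (simp_all add: map_curve_sel h_simps)

lemma map_point_add: "point_add (map_curve E) (map_point h P) (map_point h Q) = map_point h (point_add E P Q)"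
proof (cases P)
  case P: (Affine x1 y1)
  show ?thesis
  proof (cases Q)
    case Q: (Affine x2 y2)
    have "h x1 = h x2 \<and> h y2 = - h y1 - h (a1 E) * h x1 - h (a3 E) \<longleftrightarrow>
       x1 = x2 \<and> y2 = - y1 - a1 E * x1 - a3 E"
      by (simp add: h_simps[symmetric] h_eq)
    then show ?thesis unfolding P Q by (simp add: Let_def map_curve_sel h_eq h_simps)
  qed simp
qed simp

end

section \<open>The modular curve J and its twists\<close>

definition J :: "kf weierstrass" where
  "J = \<lparr>a1 = 1, a2 = 1, a3 = 1, a4 = 0, a6 = 0\<rparr>"

lemma J_sel: "a1 J = 1" "a2 J = 1" "a3 J = 1" "a4 J = 0" "a6 J = 0" by (simp_all add: J_def)

lemma J_discriminant: "discriminant J \<noteq> 0" by (simp add: discriminant_def J_sel)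

lemma J_eval: "weierstrass_eval J x y = y^2 + x*y + y - (x^3 + x^2)"
  by (simp add: weierstrass_eval_def J_sel)

lemma J_b: "wb2 J = 5" "wb4 J = 1" "wb6 J = 1" "wb8 J = 1"
  by (simp_all add: wb2_def wb4_def wb6_def wb8_def J_sel)

lemma J_square: "weierstrass_eval J x y = 0 \<longleftrightarrow> (2*y + x + 1)^2 = 4*x^3 + 5*x^2 + 2*x + 1"
proof -
  have "(2*y + x + 1)^2 - (4*x^3 + 5*x^2 + 2*x + 1) = 4 * weierstrass_eval J x y"
    unfolding J_eval by Groebner_Basis.algebra
  then show ?thesis by (metis eq_iff_diff_eq_0 mult_eq_0_iff zero_neq_numeral)
qed

interpretation kconj: field_hom kconj by unfold_locales (simp_all add: kconj_hom)
interpretation ksig: field_hom ksig by unfold_locales (simp_all add: ksig_hom)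

lemma map_J: "kconj.map_curve J = J" "ksig.map_curve J = J"
  by (simp_all add: kconj.map_curve_def ksig.map_curve_def J_def kconj_hom ksig_hom)

text \<open>The points on which complex conjugation and the automorphism \<open>sqrt 5 \<mapsto> - sqrt 5\<close> act
  by signs are the rational points of the twist of the curve by \<open>tw_d\<close>.\<close>

definition eigen :: "(kf \<Rightarrow> kf) \<Rightarrow> bool \<Rightarrow> kf point \<Rightarrow> bool" where
  "eigen c e P \<longleftrightarrow> map_point c P = (if e then P else point_neg J P)"

definition twisted :: "bool \<Rightarrow> bool \<Rightarrow> kf point \<Rightarrow> bool" where
  "twisted e e' P \<longleftrightarrow> on_curve J P \<and> eigen kconj e P \<and> eigen ksig e' P"

definition tw_d :: "bool \<Rightarrow> bool \<Rightarrow> int" where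
  "tw_d e e' = (if e then 1 else -1) * (if e' then 1 else 5)"

definition tw_s :: "bool \<Rightarrow> bool \<Rightarrow> kf" where
  "tw_s e e' = (if e then 1 else ki) * (if e' then 1 else 2 * kphi - 1)"

lemma tw_s_sq: "tw_s e e' ^ 2 = krat (of_int (tw_d e e'))"
  by (simp add: tw_s_def tw_d_def kf_eq_iff krat_def ki_def kphi_def power2_eq_square)

lemma tw_s_conj: "kconj (tw_s e e') = (if e then tw_s e e' else - tw_s e e')"
  "ksig (tw_s e e') = (if e' then tw_s e e' else - tw_s e e')"
  by (simp_all add: tw_s_def kf_eq_iff kconj_def ksig_def ki_def kphi_def)

lemma krat_hom: "krat (a + b) = krat a + krat b" "krat (a - b) = krat a - krat b" "krat (- a) = - krat a"
  "krat (a * b) = krat a * krat b" "krat 0 = 0" "krat 1 = 1" "krat (numeral k) = numeral k"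
  by (simp_all add: kf_eq_iff krat_def)

lemma krat_power: "krat (a ^ n) = krat a ^ n" by (induction n) (simp_all add: krat_hom)

lemma krat_eq_iff [simp]: "krat a = krat b \<longleftrightarrow> a = b" by (simp add: krat_def)

lemma krat_fixed [simp]: "kconj (krat a) = krat a" "ksig (krat a) = krat a"
  by (simp_all add: kf_eq_iff krat_def kconj_def ksig_def)

lemma fixed_krat: "kconj x = x \<Longrightarrow> ksig x = x \<Longrightarrow> x = krat (k0 x)"
  by (auto simp: kf_eq_iff krat_def kconj_def ksig_def)

lemma tw_s_nz: "tw_s e e' \<noteq> 0"
  by (cases e; cases e') (simp_all add: tw_s_def kf_eq_iff ki_def kphi_def)

lemma eigen_krat:
  assumes "kconj z = (if e then z else - z)" "ksig z = (if e' then z else - z)"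
  shows "\<exists>w. z = krat w * tw_s e e'"
proof -
  have "kconj (z / tw_s e e') = z / tw_s e e'" "ksig (z / tw_s e e') = z / tw_s e e'"
    using assms by (simp_all add: kconj.h_divide ksig.h_divide tw_s_conj)
  then have "z / tw_s e e' = krat (k0 (z / tw_s e e'))" by (rule fixed_krat)
  then have "z = krat (k0 (z / tw_s e e')) * tw_s e e'" using tw_s_nz[of e e'] by (simp add: field_simps)
  then show ?thesis by blast
qed

text \<open>Negation fixes x and changes the sign of 2 y + x + 1. On a twisted point x is therefore
  Galois invariant and 2 y + x + 1 transforms like \<open>tw_s e e'\<close>; the last equation is
  that of J with the square completed.\<close>

lemma twisted_coords:
  assumes "twisted e e' (Affine x y)"
  shows "\<exists>q w. x = krat q \<and> 2*y + x + 1 = krat w * tw_s e e' \<and>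
    of_int (tw_d e e') * w^2 = 4*q^3 + 5*q^2 + 2*q + 1"
proof -
  have c: "kconj x = x" "kconj y = (if e then y else - y - x - 1)"
    "ksig x = x" "ksig y = (if e' then y else - y - x - 1)"
    using assms by (auto simp: twisted_def eigen_def J_sel split: if_splits)
  define q where "q = k0 x"
  have x: "x = krat q" unfolding q_def using c by (intro fixed_krat)
  have "kconj (2*y + x + 1) = (if e then 2*y + x + 1 else - (2*y + x + 1))"
    "ksig (2*y + x + 1) = (if e' then 2*y + x + 1 else - (2*y + x + 1))"
    using c by (simp_all add: kconj.h_simps ksig.h_simps)
  from eigen_krat[OF this] obtain w where w: "2*y + x + 1 = krat w * tw_s e e'" by blast
  have "(krat w * tw_s e e')^2 = 4*x^3 + 5*x^2 + 2*x + 1"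
    using assms J_square[of x y] unfolding w by (simp add: twisted_def)
  then have "krat (of_int (tw_d e e') * w^2) = krat (4*q^3 + 5*q^2 + 2*q + 1)"
    unfolding power_mult_distrib tw_s_sq x by (simp add: krat_hom krat_power mult.commute)
  then show ?thesis using x w by auto
qed

lemma twistedI:
  assumes w: "2*y + krat q + 1 = krat w * tw_s e e'"
    and eq: "of_int (tw_d e e') * w^2 = 4*q^3 + 5*q^2 + 2*q + 1"
  shows "twisted e e' (Affine (krat q) y)"
proof -
  have "(krat w * tw_s e e')^2 = krat (of_int (tw_d e e') * w^2)"
    unfolding power_mult_distrib tw_s_sq by (simp add: krat_hom krat_power mult.commute)
  then have on: "weierstrass_eval J (krat q) y = 0"
    unfolding J_square w eq by (simp add: krat_hom krat_power)
  have y: "y = (krat w * tw_s e e' - krat q - 1) / 2" using w by (simp add: field_simps)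
  have ng: "- y - krat q - 1 = (- (krat w * tw_s e e') - krat q - 1) / 2" unfolding y by (simp add: field_simps)
  have "kconj y = (if e then y else - y - krat q - 1)"
    unfolding ng unfolding y by (simp add: kconj.h_simps tw_s_conj)
  moreover have "ksig y = (if e' then y else - y - krat q - 1)"
    unfolding ng unfolding y by (simp add: ksig.h_simps tw_s_conj)
  ultimately show ?thesis using on by (simp add: twisted_def eigen_def J_sel)
qed

lemma point_neg_add:
  assumes d: "discriminant E \<noteq> 0" and on: "on_curve E P" "on_curve E Q"
  shows "point_neg E (point_add E P Q) = point_add E (point_neg E P) (point_neg E Q)"
proof -
  interpret G: comm_group "MW E" by (rule MW_comm_group[OF d])
  have "inv\<^bsub>MW E\<^esub> (P \<otimes>\<^bsub>MW E\<^esub> Q) = inv\<^bsub>MW E\<^esub> P \<otimes>\<^bsub>MW E\<^esub> inv\<^bsub>MW E\<^esub> Q"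
    by (rule G.inv_mult) (simp_all only: MW_carrier on)
  then show ?thesis using MW_inv[OF d] on add_on_curve[OF on] by simp
qed

lemma twisted_add:
  assumes "twisted e e' P" "twisted e e' Q" shows "twisted e e' (point_add J P Q)"
proof -
  have on: "on_curve J P" "on_curve J Q" using assms by (auto simp: twisted_def)
  have "map_point kconj (point_add J P Q) = point_add J (map_point kconj P) (map_point kconj Q)"
    using kconj.map_point_add[of J P Q] map_J by simp
  moreover have "map_point ksig (point_add J P Q) = point_add J (map_point ksig P) (map_point ksig Q)"
    using ksig.map_point_add[of J P Q] map_J by simp
  ultimately show ?thesis using assms add_on_curve[OF on] point_neg_add[OF J_discriminant on]
    unfolding twisted_def eigen_def by (cases e; cases e') simp_all
qed

lemma point_neg_neg [simp]: "point_neg E (point_neg E P) = P" by (cases P) simp_all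

lemma twisted_neg:
  assumes "twisted e e' P" shows "twisted e e' (point_neg J P)"
proof -
  have "map_point kconj (point_neg J P) = point_neg J (map_point kconj P)"
    "map_point ksig (point_neg J P) = point_neg J (map_point ksig P)"
    using kconj.map_point_neg[of J P] ksig.map_point_neg[of J P] map_J by simp_all
  then show ?thesis using assms neg_on_curve[of J P]
    unfolding twisted_def eigen_def by (cases e; cases e') simp_all
qed

lemma twisted_Infinity [simp]: "twisted e e' Infinity" by (simp add: twisted_def eigen_def)

section \<open>Halving twisted points\<close>

lemma same_x:
  assumes "weierstrass_eval E x y = 0" "weierstrass_eval E x z = 0"
  shows "Affine x y = Affine x z \<or> Affine x y = point_neg E (Affine x z)"
  using same_x_poly[of z "a1 E" x "a3 E" "a2 E" "a4 E" "a6 E" y] assms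
  unfolding weierstrass_eval_def by (metis point_neg.simps(2))

text \<open>u is the X-coordinate of the half. A preimage of A = \<beta>^2 under the first isogeny
  satisfies u^2 - (\<beta>^2 + 7 d) u + 16 d^2 = 0, whose discriminant is (2 \<alpha> \<beta>)^2 by
  \<open>g\<close>. The second identity gives the double the X-coordinate \<alpha>^2.\<close>

lemma half_poly:
  fixes \<alpha> \<beta> d u :: "'a::field_char_0"
  assumes g: "\<beta>^4 + 14*d*\<beta>^2 - 15*d^2 = 4*\<alpha>^2*\<beta>^2" and u: "2*u = \<beta>^2 + 7*d + 2*\<alpha>*\<beta>"
  shows "\<beta>^2*u = u^2 - 7*d*u + 16*d^2" "u^2 - 16*d^2 = 2*\<alpha>*\<beta>*u"
proof -
  have "4 * (\<beta>^2*u - (u^2 - 7*d*u + 16*d^2)) = 0" using g u by Groebner_Basis.algebra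
  moreover have "x = 0" if "4 * x = 0" for x :: 'a using that by simp
  ultimately have "\<beta>^2*u - (u^2 - 7*d*u + 16*d^2) = 0" by blast
  then show 1: "\<beta>^2*u = u^2 - 7*d*u + 16*d^2" by (simp only: eq_iff_diff_eq_0[symmetric])
  show "u^2 - 16*d^2 = 2*\<alpha>*\<beta>*u" using 1 u by Groebner_Basis.algebra
qed

text \<open>A point is a double if its abscissa and that of a preimage under the dual 2-isogeny are squares,
  \<open>\<alpha>\<^sup>2\<close> and \<open>\<beta>\<^sup>2\<close>.\<close>

lemma half_exists:
  assumes P: "twisted e e' (Affine (krat q) y)" and d: "d = of_int (tw_d e e')"
    and \<alpha>: "4*d*(q+1) = \<alpha>^2" "\<alpha> \<noteq> 0" and \<beta>: "\<beta> \<noteq> 0" "\<beta>^4 + 14*d*\<beta>^2 - 15*d^2 = 4*\<alpha>^2*\<beta>^2"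
  shows "\<exists>Q. twisted e e' Q \<and> point_add J Q Q = Affine (krat q) y"
proof -
  have d0: "d \<noteq> 0" unfolding d by (auto simp: tw_d_def)
  define u where "u = (\<beta>^2 + 7*d + 2*\<alpha>*\<beta>) / 2"
  have u2: "2*u = \<beta>^2 + 7*d + 2*\<alpha>*\<beta>" by (simp add: u_def)
  note h = half_poly[OF \<beta>(2) u2]
  have u0: "u \<noteq> 0" using h(1) d0 by auto
  \<comment> \<open>(r, w) are the coordinates of the half on the twist, read off from u = 4 d (r +
    1) and Y = \<beta> u = 4 d^2 w.\<close>
  define r where "r = u / (4*d) - 1"
  define w where "w = \<beta> * u / (4*d^2)"
  have ur: "u = 4*d*(r+1)" using d0 by (simp add: r_def)
  have w: "4*d^2*w = \<beta>*u" using d0 by (simp add: w_def)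
  have w0: "w \<noteq> 0" using \<beta> u0 d0 by (simp add: w_def)
  have "16*d^3*(d*w^2) = \<beta>^2*u*u" using w by Groebner_Basis.algebra
  also have "\<dots> = 16*d^3*(4*r^3 + 5*r^2 + 2*r + 1)" unfolding h(1) unfolding ur by Groebner_Basis.algebra
  finally have eq: "d*w^2 = 4*r^3 + 5*r^2 + 2*r + 1" using d0 by simp
  define z where "z = (krat w * tw_s e e' - krat r - 1) / 2"
  have "2*((a - b - 1)/2) + b + 1 = a" for a b :: kf by (simp add: field_simps)
  then have z: "2*z + krat r + 1 = krat w * tw_s e e'" unfolding z_def .
  define Q where "Q = Affine (krat r) z"
  have Q: "twisted e e' Q" unfolding Q_def by (rule twistedI[OF z]) (use eq d in simp)
  have onQ: "weierstrass_eval J (krat r) z = 0" using Q by (simp add: Q_def twisted_def)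
  have "krat w \<noteq> 0" using w0 krat_eq_iff[of w 0] by (simp add: krat_hom(5))
  then have s0: "krat w * tw_s e e' \<noteq> 0" using tw_s_nz by simp
  have "point_add J Q Q \<noteq> Infinity"
    using double_Infinity(1)[OF _ onQ] s0 unfolding Q_def by (auto simp: J_sel z)
  then obtain x2 y2 where x2: "point_add J Q Q = Affine x2 y2" by (cases "point_add J Q Q") auto
  have den: "4*krat r^3 + wb2 J*krat r^2 + 2*wb4 J*krat r + wb6 J = krat (d*w^2)"
    unfolding eq J_b by (simp add: krat_hom krat_power)
  have num: "krat r^4 - wb4 J*krat r^2 - 2*wb6 J*krat r - wb8 J = krat (r^4 - r^2 - 2*r - 1)"
    unfolding J_b by (simp add: krat_hom krat_power)
  have "16*d^4*(r^4 - r^2 - 2*r - 1) = 16*d^4*(q*(d*w^2))"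
  proof -
    have "16*(16*d^4*(r^4 - r^2 - 2*r - 1)) = (u^2 - 16*d^2)^2 - 4*d*(16*d^3*(16*(4*r^3+5*r^2+2*r+1)))/4"
      unfolding ur by Groebner_Basis.algebra
    also have "\<dots> = (2*\<alpha>*\<beta>*u)^2 - 4*d*(16*d^3*(16*(d*w^2)))/4" unfolding h(2) eq ..
    also have "\<dots> = 4*\<alpha>^2*(\<beta>*u)^2 - 256*d^5*w^2" by (simp add: power_mult_distrib power2_eq_square power_def)
    finally show ?thesis unfolding w[symmetric] using \<alpha>(1) by Groebner_Basis.algebra
  qed
  then have qe: "r^4 - r^2 - 2*r - 1 = q*(d*w^2)" using d0 by simp
  have "x2 * krat (d*w^2) = krat (q*(d*w^2))"
    using double_x[OF onQ] x2 unfolding Q_def den num qe by blast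
  moreover have "krat (d*w^2) \<noteq> 0" using w0 d0 krat_eq_iff[of "d*w^2" 0] by (simp add: krat_hom(5))
  ultimately have "x2 = krat q" unfolding krat_hom(4)[of q] by (metis mult_right_cancel)
  have on2: "weierstrass_eval J (krat q) y2 = 0"
    using add_on_curve[of J Q Q] Q x2 \<open>x2 = krat q\<close> by (simp add: twisted_def)
  have onP: "weierstrass_eval J (krat q) y = 0" using P by (simp add: twisted_def)
  \<comment> \<open>The abscissa fixes the double only up to sign; in the second case the half is
    -Q.\<close>
  from same_x[OF on2 onP] show ?thesis
  proof
    assume "Affine (krat q) y2 = Affine (krat q) y"
    then show ?thesis using Q x2 \<open>x2 = krat q\<close> by auto
  next
    assume A: "Affine (krat q) y2 = point_neg J (Affine (krat q) y)"
    have "point_add J (point_neg J Q) (point_neg J Q) = point_neg J (point_add J Q Q)"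
      using point_neg_add[OF J_discriminant] Q by (simp add: twisted_def)
    also have "\<dots> = Affine (krat q) y" using A x2 \<open>x2 = krat q\<close> by (metis point_neg_neg)
    finally show ?thesis using twisted_neg[OF Q] by blast
  qed
qed

text \<open>If \<open>A\<close> lies in the nontrivial class \<open>twist_class d\<close>, translation by \<open>(-1, 0)\<close>, or by \<open>(0, 0)\<close> when
  \<open>d = 1\<close>, moves it to the trivial class.\<close>

lemma good_translate_T:
  fixes \<alpha> \<beta> A d x :: "'a::field_char_0"
  assumes d: "d = -1 \<and> A = 15*\<beta>^2 \<or> d = 5 \<and> A = 5*\<beta>^2 \<or> d = -5 \<and> A = 3*\<beta>^2"
    and nz: "\<alpha> \<noteq> 0" "\<beta> \<noteq> 0" and A: "A^2 + 14*d*A - 15*d^2 = 4*A*\<alpha>^2" and A75: "d = 5 \<Longrightarrow> A \<noteq> - 75"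
  shows "\<exists>\<alpha>' \<beta>'. \<alpha>' \<noteq> 0 \<and> \<beta>' \<noteq> 0 \<and> \<alpha>'*\<alpha> = 4*d \<and> \<beta>'^4 + 14*d*\<beta>'^2 - 15*d^2 = 4*\<alpha>'^2*\<beta>'^2"
proof -
  \<comment> \<open>Translation by (-1, 0) is X \<mapsto> 16 d^2 / X, hence \<alpha> \<mapsto> 4 d /
    \<alpha>.\<close>
  define a where "a = 4*d/\<alpha>"
  have d0: "d \<noteq> 0" using d by auto
  have a: "a \<noteq> 0" "a*\<alpha> = 4*d" using nz d0 by (simp_all add: a_def)
  have goal: ?thesis if b: "b \<noteq> 0" "b^4 + 14*d*b^2 - 15*d^2 = 4*a^2*b^2" for b using a b by blast
  \<comment> \<open>In each case b^2 = e (A - e') / (A - e), the abscissa after translation by the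
    2-torsion point (e, 0) of the isogenous curve; e is the positive and e' the negative root of (A
    - d) (A + 15 d).\<close>
  consider "d = -1" "A = 15*\<beta>^2" | "d = 5" "A = 5*\<beta>^2" | "d = -5" "A = 3*\<beta>^2" using d by blast
  then show ?thesis
  proof cases
    case 1
    have "A - 15 \<noteq> 0"
    proof
      assume "A - 15 = 0"
      then have "A = 15" by simp
      then show False using A nz 1(1) by simp
    qed
    define b where "b = 30*\<alpha>*\<beta>/(A-15)"
    have e: "b*(A-15) = 30*\<alpha>*\<beta>" using \<open>A - 15 \<noteq> 0\<close> by (simp add: b_def)
    have "b \<noteq> 0" using nz \<open>A - 15 \<noteq> 0\<close> by (simp add: b_def)
    moreover have "(b^4 + 14*d*b^2 - 15*d^2 - 4*a^2*b^2) * (\<alpha>^2*(A-15)^4) = 0"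
      using e a(2) A 1 by Groebner_Basis.algebra
    ultimately show ?thesis using goal[of b] nz \<open>A - 15 \<noteq> 0\<close> by simp
  next
    case 2
    define b where "b = (A+75)/(2*\<alpha>*\<beta>)"
    have "A + 75 \<noteq> 0" using A75[OF 2(1)] by (simp add: eq_neg_iff_add_eq_0)
    have e: "b*(2*\<alpha>*\<beta>) = A+75" using nz by (simp add: b_def)
    have "b \<noteq> 0" using nz \<open>A + 75 \<noteq> 0\<close> by (simp add: b_def)
    moreover have "(b^4 + 14*d*b^2 - 15*d^2 - 4*a^2*b^2) * (\<alpha>^4*\<beta>^4*16) = 0"
      using e a(2) A 2 by Groebner_Basis.algebra
    ultimately show ?thesis using goal[of b] nz by simp
  next
    case 3
    have "A - 75 \<noteq> 0"
    proof
      assume "A - 75 = 0"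
      then have "A = 75" by simp
      then show False using A nz 3(1) by simp
    qed
    define b where "b = 30*\<alpha>*\<beta>/(A-75)"
    have e: "b*(A-75) = 30*\<alpha>*\<beta>" using \<open>A - 75 \<noteq> 0\<close> by (simp add: b_def)
    have "b \<noteq> 0" using nz \<open>A - 75 \<noteq> 0\<close> by (simp add: b_def)
    moreover have "(b^4 + 14*d*b^2 - 15*d^2 - 4*a^2*b^2) * (\<alpha>^2*(A-75)^4) = 0"
      using e a(2) A 3 by Groebner_Basis.algebra
    ultimately show ?thesis using goal[of b] nz \<open>A - 75 \<noteq> 0\<close> by simp
  qed
qed

text \<open>Here d = 1. \<alpha>'^2 is the X-coordinate of the translate by (0, 0), and \<beta>'^2
  is the abscissa of the third point on the chord joining (A, 2 \<alpha> A) to (5, 20) on the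
  isogenous curve; the product of the three abscissae is the square of the intercept.\<close>

lemma good_translate_R:
  fixes \<alpha> \<beta> A n x :: "'a::field_char_0"
  assumes A: "A = 5*\<beta>^2" "A^2 + 14*A - 15 = 4*A*\<alpha>^2" and nz: "\<alpha> \<noteq> 0" "\<beta> \<noteq> 0"
    and n: "2*n = A + 7 - 2*\<alpha>^2" and x: "\<alpha>^2 \<noteq> 4"
  shows "\<exists>\<alpha>' \<beta>'. \<alpha>' \<noteq> 0 \<and> \<beta>' \<noteq> 0 \<and> \<alpha>'*(\<alpha>^2 - 4) = 2*(n - \<alpha>) \<and> \<beta>'^4 + 14*\<beta>'^2 - 15 = 4*\<alpha>'^2*\<beta>'^2"
proof -
  have x4: "\<alpha>^2 - 4 \<noteq> 0" using x by simp
  have A5: "A - 5 \<noteq> 0"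
  proof
    assume "A - 5 = 0"
    then have "A = 5" by simp
    then have "20 * \<alpha>^2 = 20 * 4" using A(2) by simp
    then show False using x by simp
  qed
  have a2: "\<alpha> - 2 \<noteq> 0" using x4 by (auto simp: power2_eq_square)
  define a where "a = 2*(n-\<alpha>)/(\<alpha>^2-4)"
  define b where "b = 10*\<beta>*(\<alpha>-2)/(A-5)"
  have ea: "a*(\<alpha>^2-4) = 2*(n-\<alpha>)" using x4 by (simp add: a_def)
  have eb: "b*(A-5) = 10*\<beta>*(\<alpha>-2)" using A5 by (simp add: b_def)
  have b0: "b \<noteq> 0" using A5 a2 nz by (simp add: b_def)
  have a0: "a \<noteq> 0"
  proof
    assume "a = 0"
    then have "n = \<alpha>" using ea by simp
    then have "A = 2*\<alpha>^2 + 2*\<alpha> - 7" using n by (simp add: algebra_simps)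
    then have "4 * (\<alpha>^2 - 4)^2 = 0" using A(2) by Groebner_Basis.algebra
    then show False using x4 by simp
  qed
  define B where "B = b^2"
  have eB: "B*(A-5)^2 = 20*A*(\<alpha>-2)^2" unfolding B_def using eb A(1) by Groebner_Basis.algebra
  have ea2: "a^2*(\<alpha>^2-4)^2 = (A + 7 - 2*\<alpha>^2 - 2*\<alpha>)^2" using ea n by Groebner_Basis.algebra
  \<comment> \<open>The equation required of \<alpha>' and \<beta>', with denominators cleared and
    the common factor (\<alpha> - 2)^2 removed.\<close>
  have key: "400*A^2*(\<alpha>-2)^4*(\<alpha>+2)^2 + 14*20*A*(\<alpha>-2)^2*(\<alpha>+2)^2*(A-5)^2 - 15*(\<alpha>+2)^2*(A-5)^4
     = 80*A*(A-5)^2*(A + 7 - 2*\<alpha>^2 - 2*\<alpha>)^2"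
    using A(2) by Groebner_Basis.algebra
  have "(B^2 + 14*B - 15 - 4*a^2*B) * ((A-5)^4*(\<alpha>^2-4)^2) =
    (\<alpha>-2)^2 * (400*A^2*(\<alpha>-2)^4*(\<alpha>+2)^2 + 14*20*A*(\<alpha>-2)^2*(\<alpha>+2)^2*(A-5)^2 - 15*(\<alpha>+2)^2*(A-5)^4
     - 80*A*(A-5)^2*(A + 7 - 2*\<alpha>^2 - 2*\<alpha>)^2)"
    using eB ea2 by Groebner_Basis.algebra
  also have "\<dots> = 0" unfolding key by simp
  finally have "B^2 + 14*B - 15 - 4*a^2*B = 0" using A5 x4 by simp
  then have "b^4 + 14*b^2 - 15 = 4*a^2*b^2" unfolding B_def by Groebner_Basis.algebra
  then show ?thesis using a0 b0 ea by blast
qed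

section \<open>Translations by torsion points of J\<close>

definition J_T :: "kf point" where "J_T = Affine (-1) 0"
definition J_R :: "kf point" where "J_R = Affine 0 0"

lemma twisted_T: "twisted e e' J_T"
  by (simp add: twisted_def J_T_def J_eval eigen_def J_sel kconj_hom ksig_hom)

lemma twisted_R: "twisted True True J_R"
  by (simp add: twisted_def J_R_def J_eval eigen_def J_sel kconj_hom ksig_hom)

lemma J_T_double: "point_add J J_T J_T = Infinity"
  by (simp add: J_T_def J_sel)

lemma J_R_double: "point_add J J_R J_R = J_T"
  by (simp add: J_R_def J_T_def J_sel Let_def)

lemma add_T_x:
  assumes on: "weierstrass_eval J x y = 0" and x: "x + 1 \<noteq> 0"
  shows "\<exists>y'. point_add J (Affine x y) J_T = Affine (1 / (x+1) - 1) y'"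
proof -
  have "x \<noteq> -1" using x by auto
  define l where "l = y / (x + 1)"
  have l: "l*(x+1) = y" using x by (simp add: l_def)
  have e: "y^2 + x*y + y = x^3 + x^2" using on by (simp add: J_eval)
  have "l*((-1) - x) = 0 - y" unfolding l[symmetric] by (simp add: algebra_simps)
  moreover have "(l*y + y - x^2)*(x+1) = 0"
  proof -
    have "(l*y + y - x^2)*(x+1) = (l*(x+1))*y + y*(x+1) - x^2*(x+1)" by (simp add: algebra_simps)
    also have "\<dots> = 0" unfolding l using e by (simp add: power2_eq_square power3_eq_cube algebra_simps)
    finally show ?thesis .
  qed
  then have "l*y + y - x^2 = 0" using x by (metis mult_eq_0_iff)
  then have "l*y = x^2 - y" by (simp add: algebra_simps)
  then have "l*(y + 0 + 1*(-1) + 1) = x^2 + x*(-1) + (-1)^2 + 1*(x + (-1)) + 0 - 1*y" by simp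
  ultimately have sl: "is_slope J l x y (-1) 0" unfolding is_slope_def J_sel by blast
  have onT: "weierstrass_eval J (-1) 0 = 0" by (simp add: J_eval)
  have "(l^2 + l - 1 - x + 1) * (x+1)^2 = - x * (x+1)"
  proof -
    have "(l^2 + l - 1 - x + 1) * (x+1)^2 = (l*(x+1))^2 + (l*(x+1))*(x+1) - x*(x+1)^2"
      by (simp add: power2_eq_square algebra_simps)
    also have "\<dots> = - x * (x+1)" unfolding l using e by (simp add: power2_eq_square power3_eq_cube algebra_simps)
    finally show ?thesis .
  qed
  moreover have "(1/(x+1) - 1) * (x+1)^2 = (x+1) - (x+1)^2"
    using x by (simp add: left_diff_distrib power2_eq_square)
  ultimately have "(l^2 + l - 1 - x + 1 - (1/(x+1) - 1)) * (x+1)^2 = - x * (x+1) - ((x+1) - (x+1)^2)"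
    by (simp only: left_diff_distrib)
  also have "\<dots> = 0" by (simp add: power2_eq_square algebra_simps)
  finally have "(l^2 + l - 1 - x + 1 - (1/(x+1) - 1)) * (x+1)^2 = 0" .
  then have "third_x J l x (-1) = 1/(x+1) - 1" using x by (simp add: third_x_def J_sel)
  then show ?thesis using add_slope[OF J_discriminant on onT sl] by (simp add: J_T_def chord_sum_def)
qed

lemma add_R_x:
  assumes on: "weierstrass_eval J x y = 0" and x: "x \<noteq> 0"
  shows "\<exists>y'. point_add J (Affine x y) J_R = Affine (- y / x^2) y'"
proof -
  define l where "l = y / x"
  have l: "l*x = y" using x by (simp add: l_def)
  have e: "y^2 + x*y + y = x^3 + x^2" using on by (simp add: J_eval)
  have "l*(0 - x) = 0 - y" unfolding l[symmetric] by (simp add: algebra_simps)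
  moreover have "(l*(y+1) - (x^2 + x - y))*x = 0"
  proof -
    have "(l*(y+1) - (x^2 + x - y))*x = (l*x)*(y+1) - (x^2 + x - y)*x" by (simp add: algebra_simps)
    also have "\<dots> = 0" unfolding l using e by (simp add: power2_eq_square power3_eq_cube algebra_simps)
    finally show ?thesis .
  qed
  then have "l*(y+1) = x^2 + x - y" using x by simp
  then have "l*(y + 0 + 1*0 + 1) = x^2 + x*0 + 0^2 + 1*(x + 0) + 0 - 1*y" by simp
  ultimately have sl: "is_slope J l x y 0 0" unfolding is_slope_def J_sel by blast
  have onR: "weierstrass_eval J 0 0 = 0" by (simp add: J_eval)
  have "(l^2 + l - 1 - x - 0) * x^2 = - y"
  proof -
    have "(l^2 + l - 1 - x - 0) * x^2 = (l*x)^2 + (l*x)*x - x^2 - x^3"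
      by (simp add: power2_eq_square power3_eq_cube algebra_simps)
    also have "\<dots> = - y" unfolding l using e by (simp add: algebra_simps)
    finally show ?thesis .
  qed
  then have "third_x J l x 0 = - y / x^2" using x by (simp add: third_x_def J_sel field_simps)
  then show ?thesis using add_slope[OF J_discriminant on onR sl] by (simp add: J_R_def chord_sum_def)
qed

text \<open>The descent: every twisted point is a point of order dividing 4 plus the double of a point
  of the same twist.\<close>

lemma twisted_descent:
  assumes P: "twisted e e' P"
  shows "\<exists>S Q. twisted e e' S \<and> twisted e e' Q \<and> P = point_add J S (point_add J Q Q) \<and>
    S \<in> {Infinity, J_T, J_R, point_neg J J_R}"
proof (cases P)
  case Infinity
  then show ?thesis by (intro exI[of _ Infinity]) simp
next
  case PA: (Affine x y)
  define d where "d = tw_d e e'"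
  have d: "d \<in> {1,-1,5,-5}" by (auto simp: d_def tw_d_def)
  define D where "D = (of_int d :: rat)"
  have D0: "D \<noteq> 0" using d by (auto simp: D_def)
  obtain q w where q: "x = krat q" and w: "2*y + x + 1 = krat w * tw_s e e'"
    and eq: "D*w^2 = 4*q^3 + 5*q^2 + 2*q + 1" using twisted_coords P PA unfolding D_def d_def by blast
  have onP: "weierstrass_eval J x y = 0" using P PA by (simp add: twisted_def)
  interpret G: comm_group "MW J" by (rule MW_comm_group[OF J_discriminant])
  have onT: "on_curve J J_T" "on_curve J J_R" "on_curve J P"
    using twisted_T[of e e'] twisted_R P by (simp_all add: twisted_def)
  have cancel: "P = point_add J (point_neg J S) (point_add J P S)" if "on_curve J S" for S
    using neg_add_cancel[OF J_discriminant that onT(3)] add_comm[OF J_discriminant onT(3) that] by simp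
  show ?thesis
  proof (cases "q = -1")
    case True
    have "x = -1" unfolding q True by (simp add: krat_hom)
    then have "y^2 = 0" using onP by (simp add: J_eval)
    then have "P = J_T" using PA \<open>x = -1\<close> by (simp add: J_T_def)
    then show ?thesis using twisted_T by (intro exI[of _ J_T] exI[of _ Infinity]) simp
  next
    case q1: False
    define xx where "xx = 4*D*(q+1)"
    have xx0: "xx \<noteq> 0" using D0 q1 by (simp add: xx_def add_eq_0_iff)
    have "(4*D^2*w)^2 = xx * (xx^2 - 7*D*xx + 16*D^2)" unfolding xx_def using eq by Groebner_Basis.algebra
    from twist_abscissa_square[OF d, folded D_def, OF this xx0] obtain \<alpha>0 n0 where
      a0: "\<alpha>0 \<noteq> 0" "xx = \<alpha>0^2" "n0^2 = xx^2 - 7*D*xx + 16*D^2" by blast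
    \<comment> \<open>The factors are the abscissae of the two preimages under the dual isogeny.
      Their product is negative, so a suitable sign of n makes A positive, and only positive classes
      have to be considered.\<close>
    have "(2*xx - 7*D + 2*n0) * (2*xx - 7*D - 2*n0) = - 15 * D^2" using a0(3) by Groebner_Basis.algebra
    moreover have "D^2 > 0" using D0 by simp
    ultimately have "2*xx - 7*D + 2*n0 > 0 \<or> 2*xx - 7*D - 2*n0 > 0"
      using mult_nonpos_nonpos[of "2*xx - 7*D + 2*n0" "2*xx - 7*D - 2*n0"] by linarith
    then obtain n where n: "n^2 = xx^2 - 7*D*xx + 16*D^2" "2*xx - 7*D + 2*n > 0"
      using a0(3) by (metis diff_minus_eq_add mult_minus_right power2_minus uminus_add_conv_diff add.commute diff_conv_add_uminus)
    define A where "A = 2*xx - 7*D + 2*n"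
    have A0: "A > 0" using n by (simp add: A_def)
    have A: "A^2 + 14*D*A - 15*D^2 = 4*A*xx" unfolding A_def using n(1) by Groebner_Basis.algebra
    have "(2*\<alpha>0*A)^2 = A * (A^2 + 14*D*A - 15*D^2)" unfolding A a0(2) by Groebner_Basis.algebra
    from isogenous_twist_abscissa[OF d, folded D_def, OF this A0] a0(1) A0 obtain \<beta> where
      b: "\<beta> \<noteq> 0" "A = \<beta>^2 \<or> A = of_int (twist_class d) * \<beta>^2" by auto
    show ?thesis
    proof (cases "A = \<beta>^2")
      case True
      have "\<beta>^4 + 14*D*\<beta>^2 - 15*D^2 = 4*\<alpha>0^2*\<beta>^2"
        using A unfolding True a0(2) by (simp add: algebra_simps flip: power_mult)
      then obtain Q where "twisted e e' Q" "point_add J Q Q = Affine (krat q) y"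
        using half_exists[of e e' q y D \<alpha>0 \<beta>] P PA q a0 b xx_def by (auto simp: D_def d_def)
      then show ?thesis using PA q by (intro exI[of _ Infinity] exI[of _ Q]) simp
    next
      case False
      then have A': "A = of_int (twist_class d) * \<beta>^2" using b by blast
      show ?thesis
      proof (cases "d = 1")
        case d1: False
        have "D = -1 \<and> A = 15*\<beta>^2 \<or> D = 5 \<and> A = 5*\<beta>^2 \<or> D = -5 \<and> A = 3*\<beta>^2"
          using d d1 A' by (auto simp: twist_class_def D_def)
        from good_translate_T[OF this a0(1) b(1)] A a0(2) A0 obtain \<alpha>' \<beta>' where
          g: "\<alpha>' \<noteq> 0" "\<beta>' \<noteq> 0" "\<alpha>'*\<alpha>0 = 4*D" "\<beta>'^4 + 14*D*\<beta>'^2 - 15*D^2 = 4*\<alpha>'^2*\<beta>'^2" by auto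
        have xq: "x + 1 = krat (q + 1)" "q + 1 \<noteq> 0" using q1 by (simp_all add: q krat_hom add_eq_0_iff)
        have x1: "x + 1 \<noteq> 0" unfolding xq(1) using xq(2) krat_eq_iff[of "q+1" 0] by (simp add: krat_hom(5))
        have kd: "1 / (x+1) - 1 = krat (1/(q+1) - 1)"
        proof -
          have "krat (1/(q+1)) * krat (q+1) = 1" using xq(2) by (simp add: krat_hom(4)[symmetric] krat_hom(6))
          then have "1/(x+1) = krat (1/(q+1))" using x1 unfolding xq(1) by (simp add: field_simps)
          then show ?thesis by (simp add: krat_hom)
        qed
        obtain y' where y': "point_add J P J_T = Affine (krat (1/(q+1) - 1)) y'"
          using add_T_x[OF onP x1] PA kd by auto
        have tw: "twisted e e' (Affine (krat (1/(q+1) - 1)) y')"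
          using twisted_add[OF P twisted_T] y' by simp
        have "4*D*(1/(q+1) - 1 + 1) = \<alpha>'^2"
        proof -
          have "\<alpha>'^2*\<alpha>0^2 = 16*D^2" using g(3) by Groebner_Basis.algebra
          then have "\<alpha>'^2*(4*D*(q+1)) = (4*D)*(4*D)" using a0(2) unfolding xx_def by (simp add: power2_eq_square)
          then have "(\<alpha>'^2*(q+1)) * (4*D) = (4*D)*(4*D)" by (simp add: algebra_simps)
          then have "\<alpha>'^2*(q+1) = 4*D" using D0 by (metis mult_right_cancel mult_eq_0_iff zero_neq_numeral)
          then show ?thesis using xq(2) by (simp add: field_simps)
        qed
        from half_exists[OF tw _ this g(1,2,4)] obtain Q where
          Q: "twisted e e' Q" "point_add J Q Q = point_add J P J_T" using y' by (auto simp: D_def d_def)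
        have "point_neg J J_T = J_T" by (simp add: J_T_def J_sel)
        then show ?thesis using Q twisted_T cancel[OF onT(1)]
          by (intro exI[of _ J_T] exI[of _ Q]) simp
      next
        case d1: True
        have D1: "D = 1" by (simp add: D_def d1)
        have ee: "e" "e'" using d1 by (auto simp: d_def tw_d_def split: if_splits)
        have w1: "2*y + x + 1 = krat w" using w ee by (simp add: tw_s_def)
        have w2: "w^2 = 4*q^3 + 5*q^2 + 2*q + 1" using eq D1 by simp
        show ?thesis
        proof (cases "q = 0")
          case True
          have "x = 0" by (simp add: q True krat_hom)
          then have "y * (y + 1) = 0" using onP by (simp add: J_eval power2_eq_square algebra_simps)
          then have "y = 0 \<or> y = -1" by (simp add: eq_neg_iff_add_eq_0)
          then have "P = J_R \<or> P = point_neg J J_R" using PA \<open>x = 0\<close>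
            by (auto simp: J_R_def J_sel add_eq_0_iff)
          then show ?thesis using P by (intro exI[of _ P] exI[of _ Infinity]) auto
        next
          case q0: False
          \<comment> \<open>Both are the square of the ordinate Y. The sign of \<alpha> is matched
            to that of n because translation by (0, 0) involves y and not only x.\<close>
          have "(\<alpha>0*n)^2 = (4*w)^2" using w2 n(1) a0(2) D1 unfolding xx_def by Groebner_Basis.algebra
          then obtain \<alpha> where al: "\<alpha>*n = 4*w" "\<alpha>^2 = xx"
            using a0(2) by (metis mult_minus_left power2_eq_iff power2_minus)
          have al0: "\<alpha> \<noteq> 0" using al xx0 by auto
          have xx4: "\<alpha>^2 \<noteq> 4" using q0 unfolding al xx_def D1 by simp
          have A5: "A = 5*\<beta>^2" "A^2 + 14*A - 15 = 4*A*\<alpha>^2"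
            using A' A D1 al d1 by (simp_all add: twist_class_def)
          have "2*n = A + 7 - 2*\<alpha>^2" unfolding A_def al D1 by simp
          from good_translate_R[OF A5 al0 b(1) this xx4] obtain \<alpha>' \<beta>' where
            g: "\<alpha>' \<noteq> 0" "\<beta>' \<noteq> 0" "\<alpha>'*(\<alpha>^2-4) = 2*(n-\<alpha>)" "\<beta>'^4 + 14*\<beta>'^2 - 15 = 4*\<alpha>'^2*\<beta>'^2" by blast
          define v where "v = (w - q - 1)/2"
          have v: "2*v = w - q - 1" by (simp add: v_def)
          have "2*y = 2*krat v" using w1 v unfolding q by (simp add: krat_hom(1,2,6,7) krat_hom(4)[symmetric] flip: krat_hom) (simp add: krat_hom algebra_simps)
          then have yv: "y = krat v" by simp
          have x0: "x \<noteq> 0" using q0 krat_eq_iff[of q 0] by (simp add: q krat_hom(5))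
          have kd: "- y / x^2 = krat (- v / q^2)"
          proof -
            have "krat (- v / q^2) * krat (q^2) = krat (- v)" using q0 by (simp add: krat_hom(4)[symmetric])
            then show ?thesis using x0 unfolding yv q by (simp add: krat_hom krat_power field_simps)
          qed
          obtain y' where y': "point_add J P J_R = Affine (krat (- v / q^2)) y'"
            using add_R_x[OF onP x0] PA kd by auto
          have tw: "twisted e e' (Affine (krat (- v / q^2)) y')"
          proof -
            have "twisted e e' (point_add J P J_R)" using twisted_add[OF P] twisted_R ee by simp
            then show ?thesis unfolding y' .
          qed
          have "4*D*(- v / q^2 + 1) = \<alpha>'^2"
          proof -
            have xxq: "\<alpha>^2 = 4*(q+1)" unfolding al xx_def D1 by simp
            have "\<alpha>'*(4*q) = 2*(n-\<alpha>)" using g(3) xxq by simp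
            then have "(\<alpha>'*(4*q))^2 = (2*(n-\<alpha>))^2" by simp
            then have "(\<alpha>'*(4*q))^2 = 4*(n-\<alpha>)^2" by (simp add: power_mult_distrib del: right_diff_distrib_numeral)
            also have "\<dots> = 4*(n^2 - 2*(\<alpha>*n) + \<alpha>^2)" by Groebner_Basis.algebra
            also have "\<dots> = 4*((4*(q+1))^2 - 7*(4*(q+1)) + 16 - 2*(4*w) + 4*(q+1))"
              using n(1) xxq unfolding al D1 by simp
            also have "\<dots> = 64*(q^2 - v)" using v by Groebner_Basis.algebra
            finally have "\<alpha>'^2*q^2 = 4*(q^2 - v)" by (simp add: power_mult_distrib)
            then show ?thesis using q0 D1 by (simp add: field_simps)
          qed
          from half_exists[OF tw _ this g(1,2)] g(4) D1 obtain Q where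
            Q: "twisted e e' Q" "point_add J Q Q = point_add J P J_R" using y' by (auto simp: D_def d_def)
          show ?thesis using Q twisted_neg[OF twisted_R] cancel[OF onT(2)] ee
            by (intro exI[of _ "point_neg J J_R"] exI[of _ Q]) simp
        qed
      qed
    qed
  qed
qed

section \<open>Reduction of J at the prime above 2\<close>

lemma (in prime_element) vge_cancel:
  assumes "vge 0 d" "\<not> vge 1 d" "vge n (z * d)"
  shows "vge n z"
proof (cases "z = 0")
  case False
  have "d \<noteq> 0" "val d = 0" using assms(1,2) by (auto simp: vge_def)
  then show ?thesis using assms(3) False val_mult[of z d] by (auto simp: vge_def)
qed simp

lemma vge2_KI: "v2.vge 1 (KI a b c d) \<longleftrightarrow> even (a + b) \<and> even (c + d)"
  by (simp add: v2.vge1_iff KI_div_pi2)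

lemma vge2_numerals: "v2.vge 1 2" "v2.vge 1 4" "\<not> v2.vge 1 3" "\<not> v2.vge 1 1" "v2.vge 0 1"
  by (simp_all add: KI_numeral KI_1 vge2_KI v2.vge_R)

lemma J_integral: "v2.integral_curve J"
  unfolding v2.integral_curve_def J_sel by (simp add: vge2_numerals)

definition J_kernel :: "kf point set" where
  "J_kernel = insert Infinity (v2.kernel_points J)"

abbreviation dbl :: "kf point \<Rightarrow> kf point" where "dbl P \<equiv> point_add J P P"

lemma J_kernel_on_curve: "P \<in> J_kernel \<Longrightarrow> on_curve J P"
  by (auto simp: J_kernel_def v2.kernel_points_def)

lemma J_kernel_dbl: "P \<in> J_kernel \<Longrightarrow> dbl P \<in> J_kernel"
  using v2.kernel_double[OF J_integral vge2_numerals(2)] by (auto simp: J_kernel_def)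

lemma J_double_x:
  assumes "weierstrass_eval J x y = 0" "dbl (Affine x y) = Affine z w"
  shows "z * (4*x^3 + 5*x^2 + 2*x + 1) = x^4 - x^2 - 2*x - 1" "weierstrass_eval J z w = 0"
  using double_x[OF assms] add_on_curve[of J "Affine x y" "Affine x y"] assms by (simp_all add: J_b)

text \<open>On the residue field with four elements doubling acts on abscissae as
  \<open>\<omega> \<mapsto> 0 \<mapsto> 1 \<mapsto> \<infinity>\<close>.\<close>

lemma dbl_residue_1:
  assumes on: "weierstrass_eval J x y = 0" and x: "v2.vge 0 x" "v2.vge 1 (x - 1)"
  shows "dbl (Affine x y) \<in> J_kernel"
proof (cases "dbl (Affine x y)")
  case (Affine z w)
  note z = J_double_x[OF on Affine]
  have "\<not> v2.vge 0 z"
  proof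
    assume "v2.vge 0 z"
    \<comment> \<open>At x = 1 the denominator of the duplication formula is 12 and the numerator is
      -3, so the double cannot be integral.\<close>
    moreover have 12: "v2.vge 1 12" by (simp add: KI_numeral vge2_KI)
    have "v2.vge 1 ((4*x^2 + 9*x + 11) * (x - 1) + 12)"
      unfolding power2_eq_square
      by (intro v2.vge_add v2.vge_mult0 x v2.vge_numeral 12)
    then have "v2.vge 1 (4*x^3 + 5*x^2 + 2*x + 1)"
      by (simp add: power2_eq_square power3_eq_cube algebra_simps)
    ultimately have "v2.vge 1 (x^4 - x^2 - 2*x - 1)" unfolding z(1)[symmetric] by (rule v2.vge_mult0)
    moreover have "v2.vge 1 ((x^3 + x^2 - 2) * (x - 1))"
      unfolding power2_eq_square power3_eq_cube
      by (intro v2.vge_mult0 x v2.vge_add v2.vge_diff v2.vge_numeral)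
    ultimately have "v2.vge 1 ((x^3 + x^2 - 2) * (x - 1) - (x^4 - x^2 - 2*x - 1))"
      using v2.vge_diff by blast
    moreover have "(x^3 + x^2 - 2) * (x - 1) - (x^4 - x^2 - 2*x - 1) = 3"
      by (simp add: power2_eq_square power3_eq_cube power4_eq_xxxx algebra_simps)
    ultimately show False using vge2_numerals by simp
  qed
  then show ?thesis using z Affine by (auto simp: J_kernel_def v2.kernel_points_def v2.vge_def)
qed (simp add: J_kernel_def)

lemma dbl_residue_0:
  assumes on: "weierstrass_eval J x y = 0" and x: "v2.vge 1 x"
  shows "dbl (dbl (Affine x y)) \<in> J_kernel"
proof (cases "dbl (Affine x y)")
  case (Affine z w)
  note z = J_double_x[OF on Affine]
  have x0: "v2.vge 0 x" by (rule v2.vge_mono[OF x]) simp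
  have p: "v2.vge 0 (x^n)" for n using v2.vge_power[OF x0, of n] by simp
  define den where "den = 4*x^3 + 5*x^2 + 2*x + 1"
  have d0: "v2.vge 0 den" unfolding den_def
    by (intro v2.vge_add v2.vge_mult0 v2.vge_numeral p x0 vge2_numerals)
  have d1: "\<not> v2.vge 1 den"
  proof
    assume "v2.vge 1 den"
    moreover have "v2.vge 1 ((4*x^2 + 5*x + 2) * x)" by (intro v2.vge_mult0 v2.vge_add v2.vge_numeral x x0 p)
    ultimately have "v2.vge 1 (den - (4*x^2 + 5*x + 2) * x)" by (rule v2.vge_diff)
    moreover have "den - (4*x^2 + 5*x + 2) * x = 1" unfolding den_def by Groebner_Basis.algebra
    ultimately show False using vge2_numerals by simp
  qed
  \<comment> \<open>This is the numerator of the duplication formula minus its denominator; the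
    double therefore has residue 1.\<close>
  have "v2.vge 1 ((x^3 - 4*x^2 - 6*x - 4) * x - 2)"
    by (intro v2.vge_mult0 v2.vge_diff v2.vge_numeral x x0 p vge2_numerals)
  moreover have "(z - 1) * den = (x^3 - 4*x^2 - 6*x - 4) * x - 2"
    using z(1) unfolding den_def by (simp add: power2_eq_square power3_eq_cube power4_eq_xxxx algebra_simps)
  ultimately have z1: "v2.vge 1 (z - 1)" using v2.vge_cancel[OF d0 d1, of 1 "z - 1"] by simp
  have "v2.vge 0 ((z - 1) + 1)" using v2.vge_mono[OF z1, of 0] vge2_numerals by (intro v2.vge_add) simp_all
  then have "v2.vge 0 z" by simp
  then show ?thesis using dbl_residue_1[OF z(2) _ z1] Affine by simp
qed (simp add: J_kernel_def)

lemma dbl_residue_w: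
  assumes on: "weierstrass_eval J x y = 0" and x0: "v2.vge 0 x" and x: "v2.vge 1 (x^2 + x + 1)"
  shows "dbl (dbl (dbl (Affine x y))) \<in> J_kernel"
proof (cases "dbl (Affine x y)")
  case (Affine z w)
  note z = J_double_x[OF on Affine]
  have p: "v2.vge 0 (x^n)" for n using v2.vge_power[OF x0, of n] by simp
  define den where "den = 4*x^3 + 5*x^2 + 2*x + 1"
  have d0: "v2.vge 0 den" unfolding den_def
    by (intro v2.vge_add v2.vge_mult0 v2.vge_numeral p x0 vge2_numerals)
  have d1: "\<not> v2.vge 1 den"
  proof
    assume "v2.vge 1 den"
    moreover have "v2.vge 1 ((4*x + 1) * (x^2 + x + 1))" by (intro v2.vge_mult0 v2.vge_add v2.vge_numeral x x0 vge2_numerals)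
    ultimately have "v2.vge 1 ((4*x + 1) * (x^2 + x + 1) - den)" by (intro v2.vge_diff)
    moreover have "(4*x + 1) * (x^2 + x + 1) - den = x * 3" unfolding den_def by Groebner_Basis.algebra
    ultimately have "v2.vge 1 (x * 3)" by simp
    then have x1: "v2.vge 1 x" by (rule v2.vge_cancel[OF v2.vge_numeral vge2_numerals(3)])
    have "v2.vge 1 (x^2 + x + 1 - x - x * x)" by (intro v2.vge_diff v2.vge_mult0 x x1 x0)
    then show False using vge2_numerals by (simp add: power2_eq_square)
  qed
  \<comment> \<open>The numerator of the duplication formula factors in this way, so the double has
    residue 0.\<close>
  have "v2.vge 1 ((x^2 - x - 1) * (x^2 + x + 1))"
    by (intro v2.vge_mult0 v2.vge_diff x x0 p vge2_numerals)
  moreover have "z * den = (x^2 - x - 1) * (x^2 + x + 1)"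
    using z(1) unfolding den_def by (simp add: power2_eq_square power4_eq_xxxx algebra_simps)
  ultimately have "v2.vge 1 z" using v2.vge_cancel[OF d0 d1, of 1 z] by simp
  then show ?thesis using dbl_residue_0[OF z(2)] Affine by simp
qed (simp add: J_kernel_def)

definition residues2 :: "kf set" where
  "residues2 = {KI 0 0 0 0, KI 1 0 0 0, KI 0 0 1 0, KI 1 0 1 0}"

lemma residues2_integral:
  assumes "v2.vge 0 x" shows "\<exists>t\<in>residues2. v2.vge 1 (x - t)"
proof (rule v2.integral_residue[OF _ _ _ assms])
  show "residues2 \<subseteq> kint" by (auto simp: residues2_def)
  have red: "\<exists>r\<in>{0,1}. even (m - r)" for m :: int by (simp; presburger)
  show "\<exists>t\<in>residues2. v2.vge 1 (w - t)" if "w \<in> kint" for w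
  proof -
    from that obtain a b c d where w: "w = KI a b c d" by (elim kint_cases)
    obtain r where r: "r \<in> {0,1}" "even ((a + b) - r)" using red by blast
    obtain s where s: "s \<in> {0,1}" "even ((c + d) - s)" using red by blast
    have "v2.vge 1 (w - KI r 0 s 0)"
      unfolding w KI_arith vge2_KI using r(2) s(2) by (simp add: algebra_simps)
    moreover have "KI r 0 s 0 \<in> residues2" using r s by (auto simp: residues2_def)
    ultimately show ?thesis by blast
  qed
  show "\<exists>t'\<in>residues2. v2.vge 1 (t * t' - 1)" if "t \<in> residues2" "\<not> v2.vge 1 t" for t
    using that by (auto simp: residues2_def KI_1 KI_arith vge2_KI)
qed

lemma dbl3_kernel:
  assumes on: "on_curve J P" shows "dbl (dbl (dbl P)) \<in> J_kernel"
proof (cases "P \<in> J_kernel")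
  case False
  then obtain x y where P: "P = Affine x y" by (cases P) (auto simp: J_kernel_def)
  have onP: "weierstrass_eval J x y = 0" using on P by simp
  have x: "v2.vge 0 x" using False onP by (auto simp: P J_kernel_def v2.kernel_points_def v2.vge_def)
  obtain t where t: "t \<in> residues2" "v2.vge 1 (x - t)" using residues2_integral[OF x] by blast
  have t0: "v2.vge 0 t" using t(1) by (auto simp: residues2_def intro: v2.vge_R)
  consider "t = KI 0 0 0 0" | "t = KI 1 0 0 0" | "v2.vge 1 (t^2 + t + 1)"
    using t(1) by (auto simp: residues2_def KI_eval vge2_KI)
  then show ?thesis
  proof cases
    case 1
    then show ?thesis using dbl_residue_0[OF onP] t(2) J_kernel_dbl P by (simp add: KI_0[symmetric])
  next
    case 2
    then show ?thesis using dbl_residue_1[OF onP x] t(2) J_kernel_dbl P by (simp add: KI_1[symmetric])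
  next
    case 3
    have "v2.vge 1 ((x + t + 1) * (x - t) + (t^2 + t + 1))"
      by (intro v2.vge_add v2.vge_mult0 3 t x t0 vge2_numerals)
    then have "v2.vge 1 (x^2 + x + 1)" by (simp add: power2_eq_square algebra_simps)
    then show ?thesis using dbl_residue_w[OF onP x] P by simp
  qed
qed (use J_kernel_dbl in blast)

lemma dbl_pow: "on_curve J P \<Longrightarrow> P [^]\<^bsub>MW J\<^esub> (2 * n :: nat) = dbl (P [^]\<^bsub>MW J\<^esub> n)"
proof -
  assume on: "on_curve J P"
  interpret G: comm_group "MW J" by (rule MW_comm_group[OF J_discriminant])
  have "P [^]\<^bsub>MW J\<^esub> (n + n) = P [^]\<^bsub>MW J\<^esub> n \<otimes>\<^bsub>MW J\<^esub> P [^]\<^bsub>MW J\<^esub> n"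
    by (rule G.nat_pow_mult[symmetric]) (simp only: MW_carrier on)
  then show ?thesis by (simp add: mult_2)
qed

lemma pow8: "on_curve J P \<Longrightarrow> P [^]\<^bsub>MW J\<^esub> (8::nat) = dbl (dbl (dbl P))"
proof -
  assume on: "on_curve J P"
  interpret G: comm_group "MW J" by (rule MW_comm_group[OF J_discriminant])
  have "P [^]\<^bsub>MW J\<^esub> (1::nat) = P" using G.nat_pow_eone on by (simp only: MW_carrier)
  then show ?thesis using dbl_pow[OF on, of 1] dbl_pow[OF on, of 2] dbl_pow[OF on, of 4] by simp
qed

text \<open>The valuation starts at -1 or below, and each doubling lowers it by at least 1.\<close>

lemma kernel_pow_descending:
  assumes "R \<in> J_kernel" "R [^]\<^bsub>MW J\<^esub> ((2::nat) ^ n) \<noteq> Infinity"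
  shows "R \<in> v2.kernel_points J \<and> R [^]\<^bsub>MW J\<^esub> ((2::nat) ^ n) \<in> v2.kernel_points J \<and>
    v2.xval (R [^]\<^bsub>MW J\<^esub> ((2::nat) ^ n)) \<le> - int n - 1"
  using assms(2)
proof (induction n)
  case 0
  interpret G: comm_group "MW J" by (rule MW_comm_group[OF J_discriminant])
  have "R [^]\<^bsub>MW J\<^esub> (1::nat) = R" using G.nat_pow_eone J_kernel_on_curve[OF assms(1)] by (simp only: MW_carrier)
  then show ?case using 0 assms(1) by (auto simp: J_kernel_def v2.kernel_points_def)
next
  case (Suc n)
  have on: "on_curve J R" by (rule J_kernel_on_curve[OF assms(1)])
  have e: "R [^]\<^bsub>MW J\<^esub> ((2::nat) ^ Suc n) = dbl (R [^]\<^bsub>MW J\<^esub> ((2::nat) ^ n))"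
    using dbl_pow[OF on] by simp
  then have "R [^]\<^bsub>MW J\<^esub> ((2::nat) ^ n) \<noteq> Infinity" using Suc.prems by auto
  note IH = Suc.IH[OF this]
  then show ?case using v2.kernel_double[OF J_integral vge2_numerals(2), of "R [^]\<^bsub>MW J\<^esub> ((2::nat) ^ n)"]
    Suc.prems unfolding e by auto
qed

lemma twisted_pow8:
  assumes P: "twisted e e' P" shows "P [^]\<^bsub>MW J\<^esub> (8::nat) = Infinity"
proof (rule ccontr)
  assume ne: "P [^]\<^bsub>MW J\<^esub> (8::nat) \<noteq> Infinity"
  interpret G: comm_group "MW J" by (rule MW_comm_group[OF J_discriminant])
  have step: "\<exists>Q. twisted e e' Q \<and> P [^]\<^bsub>MW J\<^esub> (8::nat) = (Q [^]\<^bsub>MW J\<^esub> (8::nat)) [^]\<^bsub>MW J\<^esub> (2::nat)"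
    if P: "twisted e e' P" for P
  proof -
    obtain S Q where SQ: "twisted e e' S" "twisted e e' Q" "P = point_add J S (dbl Q)"
      "S \<in> {Infinity, J_T, J_R, point_neg J J_R}" using twisted_descent[OF P] by blast
    have on: "on_curve J S" "on_curve J Q" using SQ by (auto simp: twisted_def)
    have "dbl (point_neg J J_R) = point_neg J (dbl J_R)"
      using point_neg_add[OF J_discriminant, of J_R J_R] twisted_R by (simp add: twisted_def)
    also have "\<dots> = J_T" unfolding J_R_double by (simp add: J_T_def J_sel)
    finally have "dbl S = Infinity \<or> dbl S = J_T"
      using SQ(4) J_R_double J_T_double by (elim insertE emptyE) simp_all
    then have "dbl (dbl S) = Infinity" using J_T_double by (elim disjE) simp_all
    then have S8: "S [^]\<^bsub>MW J\<^esub> (8::nat) = \<one>\<^bsub>MW J\<^esub>" using pow8[OF on(1)] by simp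
    have c: "S \<in> carrier (MW J)" "Q \<in> carrier (MW J)" using on by simp_all
    have Q2: "dbl Q = Q [^]\<^bsub>MW J\<^esub> (2::nat)" using dbl_pow[OF on(2), of 1] G.nat_pow_eone[OF c(2)] by simp
    have "P [^]\<^bsub>MW J\<^esub> (8::nat) = (S \<otimes>\<^bsub>MW J\<^esub> Q [^]\<^bsub>MW J\<^esub> (2::nat)) [^]\<^bsub>MW J\<^esub> (8::nat)"
      using SQ(3) Q2 by simp
    also have "\<dots> = S [^]\<^bsub>MW J\<^esub> (8::nat) \<otimes>\<^bsub>MW J\<^esub> (Q [^]\<^bsub>MW J\<^esub> (2::nat)) [^]\<^bsub>MW J\<^esub> (8::nat)"
      by (rule G.pow_mult_distrib[OF G.m_comm]) (intro c G.nat_pow_closed)+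
    also have "\<dots> = (Q [^]\<^bsub>MW J\<^esub> (8::nat)) [^]\<^bsub>MW J\<^esub> (2::nat)"
      unfolding S8 by (simp only: G.nat_pow_pow[OF c(2)] G.l_one G.nat_pow_closed c) simp
    finally show ?thesis using SQ(2) by blast
  qed
  have "\<exists>Q. twisted e e' Q \<and> P [^]\<^bsub>MW J\<^esub> (8::nat) = (Q [^]\<^bsub>MW J\<^esub> (8::nat)) [^]\<^bsub>MW J\<^esub> ((2::nat) ^ n)" for n
  proof (induction n)
    case 0
    have "P [^]\<^bsub>MW J\<^esub> (8::nat) \<in> carrier (MW J)" using P by (intro G.nat_pow_closed) (simp add: twisted_def)
    then show ?case using P G.nat_pow_eone by (intro exI[of _ P]) simp
  next
    case (Suc n)
    then obtain Q where Q: "twisted e e' Q" "P [^]\<^bsub>MW J\<^esub> (8::nat) = (Q [^]\<^bsub>MW J\<^esub> (8::nat)) [^]\<^bsub>MW J\<^esub> ((2::nat) ^ n)" by blast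
    obtain Q' where Q': "twisted e e' Q'" "Q [^]\<^bsub>MW J\<^esub> (8::nat) = (Q' [^]\<^bsub>MW J\<^esub> (8::nat)) [^]\<^bsub>MW J\<^esub> (2::nat)"
      using step[OF Q(1)] by blast
    have c: "Q' [^]\<^bsub>MW J\<^esub> (8::nat) \<in> carrier (MW J)" using Q' by (intro G.nat_pow_closed) (simp add: twisted_def)
    have "P [^]\<^bsub>MW J\<^esub> (8::nat) = (Q' [^]\<^bsub>MW J\<^esub> (8::nat)) [^]\<^bsub>MW J\<^esub> ((2::nat) ^ Suc n)"
      unfolding Q(2) Q'(2) by (simp only: G.nat_pow_pow[OF c] power_Suc)
    then show ?case using Q'(1) by blast
  qed
  note div = this
  \<comment> \<open>With this m, divisibility of 8 P by 2^m inside the kernel forces a valuation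
    strictly below that of 8 P.\<close>
  define m where "m = nat (- v2.xval (P [^]\<^bsub>MW J\<^esub> (8::nat)))"
  obtain Q where Q: "twisted e e' Q" "P [^]\<^bsub>MW J\<^esub> (8::nat) = (Q [^]\<^bsub>MW J\<^esub> (8::nat)) [^]\<^bsub>MW J\<^esub> ((2::nat) ^ m)"
    using div by blast
  have "Q [^]\<^bsub>MW J\<^esub> (8::nat) \<in> J_kernel" using Q(1) dbl3_kernel pow8 by (simp add: twisted_def)
  from kernel_pow_descending[OF this, of m] ne Q(2) have "v2.xval (P [^]\<^bsub>MW J\<^esub> (8::nat)) \<le> - int m - 1" by simp
  then show False by (simp add: m_def split: if_split_asm)
qed

section \<open>Splitting by the Galois action\<close>

definition galois :: "(kf \<Rightarrow> kf) \<Rightarrow> bool" where "galois c \<longleftrightarrow> c = kconj \<or> c = ksig"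

lemma galois_props:
  assumes "galois c"
  shows "on_curve J (map_point c P) \<longleftrightarrow> on_curve J P"
    "map_point c (point_add J P Q) = point_add J (map_point c P) (map_point c Q)"
    "map_point c (point_neg J P) = point_neg J (map_point c P)"
    "map_point c (map_point c P) = P"
proof -
  show "on_curve J (map_point c P) \<longleftrightarrow> on_curve J P"
    using assms kconj.map_curve_on_curve[of J P] ksig.map_curve_on_curve[of J P] map_J by (auto simp: galois_def)
  show "map_point c (point_add J P Q) = point_add J (map_point c P) (map_point c Q)"
    using assms kconj.map_point_add[of J P Q] ksig.map_point_add[of J P Q] map_J by (auto simp: galois_def)
  show "map_point c (point_neg J P) = point_neg J (map_point c P)"
    using assms kconj.map_point_neg[of J P] ksig.map_point_neg[of J P] map_J by (auto simp: galois_def)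
  show "map_point c (map_point c P) = P"
    using assms by (cases P) (auto simp: galois_def kconj_hom ksig_hom)
qed

lemma map_point_kconj_ksig: "map_point kconj (map_point ksig P) = map_point ksig (map_point kconj P)"
  by (cases P) (simp_all add: kconj_ksig)

lemma eigen_add:
  assumes "galois c" "on_curve J P" "on_curve J Q" "eigen c e P" "eigen c e Q"
  shows "eigen c e (point_add J P Q)"
  using assms galois_props(2)[OF assms(1)] point_neg_add[OF J_discriminant assms(2,3)]
  by (cases e) (simp_all add: eigen_def)

lemma eigen_neg:
  assumes "galois c" "eigen c e P" shows "eigen c e (point_neg J P)"
  using assms galois_props(3)[OF assms(1)] by (cases e) (simp_all add: eigen_def)

text \<open>2 P is the sum of an invariant and an anti-invariant point. Splitting by one
  automorphism costs a factor 2, hence the 16 and the 32 below.\<close>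

lemma eigen_split:
  assumes c: "galois c" and on: "on_curve J P"
  shows "eigen c True (point_add J P (map_point c P))"
    "eigen c False (point_add J P (point_neg J (map_point c P)))"
    "point_add J (point_add J P (map_point c P)) (point_add J P (point_neg J (map_point c P))) = dbl P"
proof -
  note g = galois_props[OF c]
  have on': "on_curve J (map_point c P)" "on_curve J (point_neg J (map_point c P))"
    using on g(1) neg_on_curve by auto
  show "eigen c True (point_add J P (map_point c P))"
    using add_comm[OF J_discriminant on on'(1)] by (simp add: eigen_def g)
  show "eigen c False (point_add J P (point_neg J (map_point c P)))"
    using point_neg_add[OF J_discriminant on on'(2)] add_comm[OF J_discriminant neg_on_curve[OF on] on'(1)]
    by (simp add: eigen_def g)
  interpret G: comm_group "MW J" by (rule MW_comm_group[OF J_discriminant])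
  define Q where "Q = map_point c P"
  have cr: "P \<in> carrier (MW J)" "Q \<in> carrier (MW J)" using on on' by (simp_all add: Q_def)
  have "(P \<otimes>\<^bsub>MW J\<^esub> Q) \<otimes>\<^bsub>MW J\<^esub> (P \<otimes>\<^bsub>MW J\<^esub> inv\<^bsub>MW J\<^esub> Q) = (Q \<otimes>\<^bsub>MW J\<^esub> inv\<^bsub>MW J\<^esub> Q) \<otimes>\<^bsub>MW J\<^esub> (P \<otimes>\<^bsub>MW J\<^esub> P)"
    by (simp only: G.m_ac cr G.inv_closed G.m_closed)
  also have "\<dots> = P \<otimes>\<^bsub>MW J\<^esub> P" by (simp only: G.r_inv G.l_one cr G.m_closed)
  finally show "point_add J (point_add J P (map_point c P)) (point_add J P (point_neg J (map_point c P))) = dbl P"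
    using MW_inv[OF J_discriminant, of Q] on' by (simp add: Q_def)
qed

lemma pow_double_sum:
  assumes "on_curve J P" "on_curve J Q" "on_curve J R" "point_add J Q R = dbl P"
    "Q [^]\<^bsub>MW J\<^esub> (n::nat) = Infinity" "R [^]\<^bsub>MW J\<^esub> n = Infinity"
  shows "P [^]\<^bsub>MW J\<^esub> (2 * n) = Infinity"
proof -
  interpret G: comm_group "MW J" by (rule MW_comm_group[OF J_discriminant])
  have c: "P \<in> carrier (MW J)" "Q \<in> carrier (MW J)" "R \<in> carrier (MW J)" using assms by simp_all
  have "P [^]\<^bsub>MW J\<^esub> (2 * n) = (P \<otimes>\<^bsub>MW J\<^esub> P) [^]\<^bsub>MW J\<^esub> n"
    using dbl_pow[OF assms(1)] G.pow_mult_distrib[OF refl c(1,1), of n] by simp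
  also have "\<dots> = (Q \<otimes>\<^bsub>MW J\<^esub> R) [^]\<^bsub>MW J\<^esub> n" using assms(4) by simp
  also have "\<dots> = Q [^]\<^bsub>MW J\<^esub> n \<otimes>\<^bsub>MW J\<^esub> R [^]\<^bsub>MW J\<^esub> n"
    using G.pow_mult_distrib[OF G.m_comm[OF c(2,3)] c(2,3)] by blast
  also have "\<dots> = Infinity" using assms(5,6) by simp
  finally show ?thesis .
qed

lemma J_pow32:
  assumes on: "on_curve J P" shows "P [^]\<^bsub>MW J\<^esub> (32::nat) = Infinity"
proof -
  have gal: "galois kconj" "galois ksig" by (simp_all add: galois_def)
  have closed: "on_curve J (map_point c P)" "on_curve J (point_neg J (map_point c P))"
    "on_curve J (point_add J P (map_point c P))" "on_curve J (point_add J P (point_neg J (map_point c P)))"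
    if "galois c" "on_curve J P" for c P
    using that galois_props(1) neg_on_curve add_on_curve by metis+
  have 16: "R [^]\<^bsub>MW J\<^esub> (16::nat) = Infinity" if R: "on_curve J R" "eigen kconj e R" for R e
  proof -
    have k: "eigen kconj e (map_point ksig R)"
      using R(2) galois_props(3)[OF gal(2), of R] by (cases e) (simp_all add: eigen_def map_point_kconj_ksig)
    note cl = closed[OF gal(2) R(1)] and sp = eigen_split[OF gal(2) R(1)]
    have "twisted e True (point_add J R (map_point ksig R))"
      "twisted e False (point_add J R (point_neg J (map_point ksig R)))"
      using cl sp eigen_add[OF gal(1) R(1) cl(1) R(2) k]
        eigen_add[OF gal(1) R(1) cl(2) R(2) eigen_neg[OF gal(1) k]] by (simp_all add: twisted_def)
    from pow_double_sum[OF R(1) cl(3,4) sp(3) this[THEN twisted_pow8]] show ?thesis by simp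
  qed
  note cl = closed[OF gal(1) on] and sp = eigen_split[OF gal(1) on]
  from pow_double_sum[OF on cl(3,4) sp(3) 16[OF cl(3) sp(1)] 16[OF cl(4) sp(2)]] show ?thesis by simp
qed

lemma rat_square_3:
  fixes w :: rat and r :: int
  assumes e: "w^2 = of_int (3 * r)" and r: "\<not> 3 dvd r"
  shows False
proof -
  obtain a b where ab: "quotient_of w = (a, b)" by fastforce
  have b: "b > 0" "coprime a b" "w = of_int a / of_int b"
    using quotient_of_denom_pos[OF ab] quotient_of_coprime[OF ab] quotient_of_div[OF ab] by auto
  have "(of_int (a^2) :: rat) = of_int (3 * r * b^2)" using e b by (simp add: field_simps power2_eq_square)
  then have 1: "a^2 = 3 * (r * b^2)" by (simp only: of_int_eq_iff mult.assoc)
  have p3: "prime (3::int)" by simp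
  have "3 dvd a^2" using 1 by simp
  then have "3 dvd a" using prime_dvd_power[OF p3] by blast
  then obtain c where c: "a = 3 * c" by blast
  then have "r * b^2 = 3 * c^2" using 1 by (simp add: power2_eq_square)
  then have "3 dvd r * b^2" by simp
  then have "3 dvd b" using r p3 by (metis prime_dvd_mult_iff prime_dvd_power)
  then have "(3::int) dvd 1" using coprime_common_divisor[OF b(2)] \<open>3 dvd a\<close> by blast
  then show False by simp
qed

text \<open>A root would be a rational multiple of the square root of 1, -1, 5 or -5, so 15 or 3
  would be a rational square. The consequence needed is that (-1, 0) is the only point of order 2 on
  J: another one would have an abscissa with 4 x^2 + x + 1 = 0.\<close>

lemma no_sqrt_minus_15: "z^2 \<noteq> (-15::kf)"
proof
  assume z: "z^2 = -15"
  have "(kconj z)^2 = z^2" "(ksig z)^2 = z^2"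
    using z by (simp_all add: kconj.h_simps(8)[symmetric] ksig.h_simps(8)[symmetric] kconj.h_simps(5,9) ksig.h_simps(5,9))
  then obtain e e' where "kconj z = (if e then z else - z)" "ksig z = (if e' then z else - z)"
    unfolding power2_eq_iff by (metis (full_types))
  from eigen_krat[OF this] obtain w where w: "z = krat w * tw_s e e'" by blast
  have "krat (w^2 * of_int (tw_d e e')) = krat (-15)"
    using z unfolding w power_mult_distrib tw_s_sq by (simp add: krat_hom krat_power)
  then have "w^2 * of_int (tw_d e e') = -15" by simp
  moreover have "w^2 \<ge> 0" by simp
  ultimately have "w^2 = of_int (3 * 5) \<or> w^2 = of_int (3 * 1)"
    by (cases e; cases e') (simp_all add: tw_d_def)
  then show False using rat_square_3[of w 5] rat_square_3[of w 1] by auto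
qed

lemma J_no_kernel_torsion:
  assumes "P \<in> v2.kernel_points J" shows "\<not> is_torsion (MW J) P"
proof (rule group.no_torsion_if_descending[OF MW_group[OF J_discriminant], where m = 2 and \<mu> = v2.xval, OF _ _ assms])
  show "x \<in> carrier (MW J)" if "x \<in> v2.kernel_points J" for x
    using that by (auto simp: v2.kernel_points_def)
  show "x [^]\<^bsub>MW J\<^esub> (2::nat) \<in> v2.kernel_points J \<and> v2.xval (x [^]\<^bsub>MW J\<^esub> (2::nat)) < v2.xval x"
    if x: "x \<in> v2.kernel_points J" for x
  proof -
    obtain a b where ab: "x = Affine a b" "weierstrass_eval J a b = 0" "a \<noteq> 0" "v2.val a < 0"
      using x by (auto simp: v2.kernel_points_def)
    have "dbl x \<noteq> Infinity"
    proof
      assume "dbl x = Infinity"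
      then have "4*a^3 + 5*a^2 + 2*a + 1 = 0"
        using double_Infinity(2)[of J a b] ab by (simp add: J_b)
      then have "(a + 1) * (4*a^2 + a + 1) = 0"
        by (simp add: power2_eq_square power3_eq_cube algebra_simps)
      moreover have "a \<noteq> -1" using ab(4) by auto
      then have "a + 1 \<noteq> 0" by (simp add: eq_neg_iff_add_eq_0)
      ultimately have "4*a^2 + a + 1 = 0" by simp
      then have "(8*a + 1)^2 = -15" by Groebner_Basis.algebra
      then show False using no_sqrt_minus_15 by blast
    qed
    moreover have "x [^]\<^bsub>MW J\<^esub> (2::nat) = dbl x" by (simp add: numeral_2_eq_2)
    ultimately show ?thesis using v2.kernel_double[OF J_integral vge2_numerals(2) x] by simp
  qed
qed

section \<open>The points of J\<close>

definition J_points :: "(kf \<times> kf) list" where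
  "J_points = [(KI 0 0 0 0, KI 0 0 0 0), (KI 0 0 0 0, KI (-1) 0 0 0), (KI (-1) 0 0 0, KI 0 0 0 0),
    (KI 0 0 1 0, KI 0 0 1 0), (KI 0 0 1 0, KI (-1) 0 (-2) 0),
    (KI 1 0 (-1) 0, KI 1 0 (-1) 0), (KI 1 0 (-1) 0, KI (-3) 0 2 0)]"

lemma J_points_on_curve: "(x, y) \<in> set J_points \<Longrightarrow> weierstrass_eval J x y = 0"
  unfolding J_points_def by (auto simp: J_eval KI_eval KI_0)

text \<open>The exceptional residue (1, 0) is that of the 2-torsion point (-1, 0), where 2 y + x + 1
  vanishes and \<open>close_points\<close> does not apply.\<close>

lemma J_residue_covered:
  assumes "t \<in> residues2" "t' \<in> residues2" "v2.vge 1 (weierstrass_eval J t t')"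
  shows "t = KI 1 0 0 0 \<and> t' = KI 0 0 0 0 \<or>
    (\<exists>P\<in>set J_points. v2.vge 1 (fst P - t) \<and> v2.vge 1 (snd P - t') \<and> \<not> v2.vge 1 (2*snd P + fst P + 1))"
  using assms unfolding residues2_def
  by (elim insertE emptyE; simp add: J_points_def J_eval KI_eval vge2_KI)

theorem J_rational_points:
  assumes on: "weierstrass_eval J x y = 0" shows "(x, y) \<in> set J_points"
proof -
  interpret G: comm_group "MW J" by (rule MW_comm_group[OF J_discriminant])
  have tors: "is_torsion (MW J) Q" if "on_curve J Q" for Q
    unfolding is_torsion_def using J_pow32[OF that] by (intro exI[of _ 32]) simp
  have nk: "Q \<notin> v2.kernel_points J" for Q
    using tors J_no_kernel_torsion J_kernel_on_curve by (metis J_kernel_def insertI2)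
  have x: "v2.vge 0 x" using nk[of "Affine x y"] on by (auto simp: v2.kernel_points_def v2.vge_def)
  have y: "v2.vge 0 y" by (rule v2.y_integral[OF J_integral on x])
  obtain t where t: "t \<in> residues2" "v2.vge 1 (x - t)" using residues2_integral[OF x] by blast
  obtain t' where t': "t' \<in> residues2" "v2.vge 1 (y - t')" using residues2_integral[OF y] by blast
  have ti: "v2.vge 0 t" "v2.vge 0 t'" using t(1) t'(1) by (auto simp: residues2_def intro: v2.vge_R)
  have e: "weierstrass_eval J t t' = weierstrass_eval J x y
      - ((y + t' + x + 1) * (y - t') + (t' - (x*x + x*t + t*t + x + t)) * (x - t))"
    unfolding J_eval by Groebner_Basis.algebra
  have "v2.vge 1 ((y + t' + x + 1) * (y - t') + (t' - (x*x + x*t + t*t + x + t)) * (x - t))"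
    by (rule v2.vge_add[OF v2.vge_mult0[OF _ t'(2)] v2.vge_mult0[OF _ t(2)]])
      (intro v2.vge_add v2.vge_diff v2.vge_mult0 x y ti vge2_numerals)+
  then have "v2.vge 1 (weierstrass_eval J t t')" unfolding e on diff_0 v2.vge_uminus .
  from J_residue_covered[OF t(1) t'(1) this] show ?thesis
  proof
    \<comment> \<open>Adding (-1, 0) moves any other point with this residue into the kernel: l y +
      y = x^2 has residue 1 while y has residue 0, so the slope l is not integral.\<close>
    assume A: "t = KI 1 0 0 0 \<and> t' = KI 0 0 0 0"
    then have x1: "v2.vge 1 (x - 1)" and y1: "v2.vge 1 y" using t(2) t'(2) by (simp_all add: KI_1[symmetric] KI_0[symmetric])
    show ?thesis
    proof (cases "x = -1")
      case True
      then have "y^2 = 0" using on by (simp add: J_eval)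
      then have "y = 0" by simp
      then show ?thesis using True by (simp add: J_points_def KI_1 KI_0 KI_arith)
    next
      case False
      have onT: "weierstrass_eval J (-1) 0 = 0" by (simp add: J_eval)
      obtain l where l: "is_slope J l x y (-1) 0" "point_add J (Affine x y) (Affine (-1) 0) = chord_sum J l x y (-1)"
        using slope_exists[OF on onT] False by blast
      have "l * (y + 0 + 1 * (-1) + 1) = x^2 + x*(-1) + (-1)^2 + 1*(x + (-1)) + 0 - 1*y"
        using l(1) unfolding is_slope_def J_sel by blast
      then have ly: "l * y = x^2 - y" by simp
      have "\<not> v2.vge 0 l"
      proof
        assume "v2.vge 0 l"
        then have "v2.vge 1 (l * y)" using y1 by (rule v2.vge_mult0)
        moreover have "v2.vge 1 ((x + 1) * (x - 1))" by (intro v2.vge_mult0 v2.vge_add x x1 vge2_numerals)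
        ultimately have "v2.vge 1 (l * y + y - (x + 1) * (x - 1))" by (intro v2.vge_diff v2.vge_add y1)
        moreover have "l * y + y - (x + 1) * (x - 1) = 1" unfolding ly by (simp add: power2_eq_square algebra_simps)
        ultimately show False using vge2_numerals by simp
      qed
      then have l0: "l \<noteq> 0" "v2.val l < 0" by (auto simp: v2.vge_def)
      have "v2.vge (v2.val l) (l - x)" using v2.vge_mono[OF x, of "v2.val l"] l0 by (intro v2.vge_diff v2.vge_val) simp
      then have "v2.vge (v2.val (l^2) + 1) (l - x)" by (rule v2.vge_mono) (use l0 in \<open>simp add: v2.val_power\<close>)
      from v2.val_dominant[OF _ this] l0 have "l^2 + (l - x) \<noteq> 0" "v2.val (l^2 + (l - x)) < 0"
        by (simp_all add: v2.val_power)
      moreover have "third_x J l x (-1) = l^2 + (l - x)" by (simp add: third_x_def J_sel)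
      ultimately have "chord_sum J l x y (-1) \<in> v2.kernel_points J"
        using chord_sum_on_curve[OF on l(1)] by (simp add: chord_sum_def v2.kernel_points_def)
      then show ?thesis using nk by blast
    qed
  next
    assume "\<exists>P\<in>set J_points. v2.vge 1 (fst P - t) \<and> v2.vge 1 (snd P - t') \<and> \<not> v2.vge 1 (2*snd P + fst P + 1)"
    then obtain px py where P: "(px, py) \<in> set J_points" "v2.vge 1 (px - t)" "v2.vge 1 (py - t')"
      "\<not> v2.vge 1 (2*py + px + 1)" by auto
    have onP: "weierstrass_eval J px py = 0" by (rule J_points_on_curve[OF P(1)])
    have pi: "v2.vge 0 px" using v2.vge_add[OF v2.vge_mono[OF P(2), of 0] ti(1)] by simp
    have "v2.vge 1 ((px - t) - (x - t))" "v2.vge 1 ((py - t') - (y - t'))" by (intro v2.vge_diff P t t')+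
    then have c: "v2.vge 1 (px - x)" "v2.vge 1 (py - y)" by simp_all
    have "px = x \<and> py = y"
      using v2.close_points[OF J_integral onP on pi x c] P(4) nk by (auto simp: J_sel)
    then show ?thesis using P by simp
  qed
qed

section \<open>Kubert normal form\<close>

lemma admissible_trans_poly:
  fixes c1 c2 c3 c4 c6 d1 d2 d3 d4 d6 e1 e2 e3 e4 e6 u r s t u' r' s' t' :: "'a::field"
  assumes "u * d1 = c1 + 2 * s"
     "u ^ 2 * d2 = c2 - s * c1 + 3 * r - s ^ 2"
     "u ^ 3 * d3 = c3 + r * c1 + 2 * t"
     "u ^ 4 * d4 = c4 - s * c3 + 2 * r * c2 - (t + r * s) * c1 + 3 * r ^ 2 - 2 * s * t"
     "u ^ 6 * d6 = c6 + r * c4 + r ^ 2 * c2 + r ^ 3 - t * c3 - t ^ 2 - r * t * c1"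
     "u' * e1 = d1 + 2 * s'"
     "u' ^ 2 * e2 = d2 - s' * d1 + 3 * r' - s' ^ 2"
     "u' ^ 3 * e3 = d3 + r' * d1 + 2 * t'"
     "u' ^ 4 * e4 = d4 - s' * d3 + 2 * r' * d2 - (t' + r' * s') * d1 + 3 * r' ^ 2 - 2 * s' * t'"
     "u' ^ 6 * e6 = d6 + r' * d4 + r' ^ 2 * d2 + r' ^ 3 - t' * d3 - t' ^ 2 - r' * t' * d1"
     "U = u * u'" "R = u^2 * r' + r" "S = u * s' + s" "T = u^3 * t' + u^2 * s * r' + t"
  shows "U * e1 = c1 + 2 * S \<and>
     U ^ 2 * e2 = c2 - S * c1 + 3 * R - S ^ 2 \<and>
     U ^ 3 * e3 = c3 + R * c1 + 2 * T \<and>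
     U ^ 4 * e4 = c4 - S * c3 + 2 * R * c2 - (T + R * S) * c1 + 3 * R ^ 2 - 2 * S * T \<and>
     U ^ 6 * e6 = c6 + R * c4 + R ^ 2 * c2 + R ^ 3 - T * c3 - T ^ 2 - R * T * c1"
proof -
  have c: "c1 = u*d1 - 2*s" "c2 = u^2*d2 + s*c1 - 3*r + s^2" "c3 = u^3*d3 - r*c1 - 2*t"
    "c4 = u^4*d4 + s*c3 - 2*r*c2 + (t+r*s)*c1 - 3*r^2 + 2*s*t"
    "c6 = u^6*d6 - r * c4 - r ^ 2 * c2 - r ^ 3 + t * c3 + t ^ 2 + r * t * c1"
    using assms(1-5) by Groebner_Basis.algebra+
  have d: "d1 = u'*e1 - 2*s'" "d2 = u'^2*e2 + s'*d1 - 3*r' + s'^2" "d3 = u'^3*e3 - r'*d1 - 2*t'"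
    "d4 = u'^4*e4 + s'*d3 - 2*r'*d2 + (t'+r'*s')*d1 - 3*r'^2 + 2*s'*t'"
    "d6 = u'^6*e6 - r' * d4 - r' ^ 2 * d2 - r' ^ 3 + t' * d3 + t' ^ 2 + r' * t' * d1"
    using assms(6-10) by Groebner_Basis.algebra+
  show ?thesis
    unfolding assms(11-14) c(5) unfolding c(4) unfolding c(3) unfolding c(2) unfolding c(1)
    unfolding d(5) unfolding d(4) unfolding d(3) unfolding d(2) unfolding d(1)
    by (intro conjI; Groebner_Basis.algebra)
qed

lemma admissible_trans:
  assumes "admissible u r s t E E'" "admissible u' r' s' t' E' E''"
  shows "admissible (u * u') (u^2 * r' + r) (u * s' + s) (u^3 * t' + u^2 * s * r' + t) E E''"
proof -
  have "u * u' \<noteq> 0" using assms by (simp add: admissible_def)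
  then show ?thesis using assms
    admissible_trans_poly[of u "a1 E'" "a1 E" s "a2 E'" "a2 E" r "a3 E'" "a3 E" t "a4 E'" "a4 E" "a6 E'" "a6 E"
      u' "a1 E''" s' "a2 E''" r' "a3 E''" t' "a4 E''" "a6 E''", OF _ _ _ _ _ _ _ _ _ _ refl refl refl refl]
    unfolding admissible_def by blast
qed

lemma admissible_sym_poly:
  fixes c1 c2 c3 c4 c6 d1 d2 d3 d4 d6 u r s t v :: "'a::field"
  assumes "u * d1 = c1 + 2 * s"
     "u ^ 2 * d2 = c2 - s * c1 + 3 * r - s ^ 2"
     "u ^ 3 * d3 = c3 + r * c1 + 2 * t"
     "u ^ 4 * d4 = c4 - s * c3 + 2 * r * c2 - (t + r * s) * c1 + 3 * r ^ 2 - 2 * s * t"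
     "u ^ 6 * d6 = c6 + r * c4 + r ^ 2 * c2 + r ^ 3 - t * c3 - t ^ 2 - r * t * c1"
     "v * u = 1" "S = - (s * v)" "R = - (r * v^2)" "T = (r*s - t) * v^3"
  shows "v * c1 = d1 + 2 * S \<and>
     v ^ 2 * c2 = d2 - S * d1 + 3 * R - S ^ 2 \<and>
     v ^ 3 * c3 = d3 + R * d1 + 2 * T \<and>
     v ^ 4 * c4 = d4 - S * d3 + 2 * R * d2 - (T + R * S) * d1 + 3 * R ^ 2 - 2 * S * T \<and>
     v ^ 6 * c6 = d6 + R * d4 + R ^ 2 * d2 + R ^ 3 - T * d3 - T ^ 2 - R * T * d1"
proof -
  have v2: "v^2 * u^2 = 1" "v^3*u^3 = 1" "v^4*u^4 = 1" "v^6*u^6 = 1"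
    using assms(6) by (simp_all add: power_mult_distrib[symmetric])
  have d: "d1 = v * (c1 + 2*s)" "d2 = v^2 * (c2 - s * c1 + 3 * r - s ^ 2)"
    "d3 = v^3 * (c3 + r * c1 + 2 * t)"
    "d4 = v^4 * (c4 - s * c3 + 2 * r * c2 - (t + r * s) * c1 + 3 * r ^ 2 - 2 * s * t)"
    "d6 = v^6 * (c6 + r * c4 + r ^ 2 * c2 + r ^ 3 - t * c3 - t ^ 2 - r * t * c1)"
    unfolding assms(1-5)[symmetric] mult.assoc[symmetric] v2 assms(6) by simp_all
  show ?thesis unfolding assms(7-) d by (intro conjI; Groebner_Basis.algebra)
qed

lemma admissible_sym:
  assumes "admissible u r s t E E'"
  shows "admissible (1/u) (- (r * (1/u)^2)) (- (s * (1/u))) ((r*s - t) * (1/u)^3) E' E"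
proof -
  have "u \<noteq> 0" using assms by (simp add: admissible_def)
  then have "1/u * u = 1" "1/u \<noteq> 0" by simp_all
  then show ?thesis using assms
    admissible_sym_poly[of u "a1 E'" "a1 E" s "a2 E'" "a2 E" r "a3 E'" "a3 E" t "a4 E'" "a4 E" "a6 E'" "a6 E" "1/u",
      OF _ _ _ _ _ _ refl refl refl]
    unfolding admissible_def by blast
qed

lemma admissible_pow:
  fixes n :: nat
  assumes ad: "admissible u r s t E E'" and d: "discriminant E' \<noteq> 0" and P: "on_curve E' P"
  shows "old_point u r s t (P [^]\<^bsub>MW E'\<^esub> n) = (old_point u r s t P) [^]\<^bsub>MW E\<^esub> n"
proof (induction n)
  case (Suc n)
  have "P [^]\<^bsub>MW E'\<^esub> n \<in> carrier (MW E')"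
    by (rule monoid.nat_pow_closed[OF group.is_monoid[OF MW_group[OF d]]]) (simp add: P)
  then show ?case using Suc admissible_add[OF ad d _ P, of "P [^]\<^bsub>MW E'\<^esub> n"] by simp
qed simp

section \<open>Curves with a point of order 15\<close>

definition order15 :: "'a::field weierstrass \<Rightarrow> 'a point \<Rightarrow> bool" where
  "order15 E P \<longleftrightarrow> on_curve E P \<and> (\<forall>n::nat. P [^]\<^bsub>MW E\<^esub> n = Infinity \<longleftrightarrow> 15 dvd n)"

lemma order15_transfer:
  assumes ad: "admissible u r s t E E'" and d: "discriminant E' \<noteq> 0"
    and P: "order15 E (old_point u r s t P)"
  shows "order15 E' P"
proof -
  have on: "on_curve E' P" using P old_point_on_curve[OF ad] by (simp add: order15_def)
  have "old_point u r s t Q = Infinity \<longleftrightarrow> Q = Infinity" for Q by (cases Q) simp_all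
  then show ?thesis using P on admissible_pow[OF ad d on] unfolding order15_def by metis
qed

text \<open>The Tate normal form: the tangent at (0, 0) is the horizontal axis, and the scaling is
  fixed by a2 = a3.\<close>

definition tate :: "'a::field \<Rightarrow> 'a \<Rightarrow> 'a weierstrass" where
  "tate b c = \<lparr>a1 = 1 - c, a2 = - b, a3 = - b, a4 = 0, a6 = 0\<rparr>"

lemma tate_sel: "a1 (tate b c) = 1 - c" "a2 (tate b c) = - b" "a3 (tate b c) = - b"
  "a4 (tate b c) = 0" "a6 (tate b c) = 0"
  by (simp_all add: tate_def)

lemma point_pow_simps:
  fixes n :: nat
  assumes d: "discriminant E \<noteq> 0" and P: "on_curve E P"
  shows "on_curve E (P [^]\<^bsub>MW E\<^esub> n)" "P [^]\<^bsub>MW E\<^esub> (1::nat) = P"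
    "P [^]\<^bsub>MW E\<^esub> (m + n) = point_add E (P [^]\<^bsub>MW E\<^esub> m) (P [^]\<^bsub>MW E\<^esub> n)"
proof -
  interpret G: comm_group "MW E" by (rule MW_comm_group[OF d])
  have c: "P \<in> carrier (MW E)" using P by simp
  show "on_curve E (P [^]\<^bsub>MW E\<^esub> n)" using G.nat_pow_closed[OF c] by simp
  show "P [^]\<^bsub>MW E\<^esub> (1::nat) = P" by (rule G.nat_pow_eone[OF c])
  show "P [^]\<^bsub>MW E\<^esub> (m + n) = point_add E (P [^]\<^bsub>MW E\<^esub> m) (P [^]\<^bsub>MW E\<^esub> n)"
    using G.nat_pow_mult[OF c, of m n] by simp
qed

text \<open>Two multiples of a point of order 15 have the same abscissa only if they are equal or opposite.\<close>

lemma order15_x_neq: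
  fixes m n :: nat
  assumes d: "discriminant E \<noteq> 0" and P: "order15 E P"
    and m: "P [^]\<^bsub>MW E\<^esub> m = Affine x y" and n: "P [^]\<^bsub>MW E\<^esub> n = Affine x' y'"
    and ne: "\<not> 15 dvd m + n" "\<not> 15 dvd m - n" "n \<le> m"
  shows "x \<noteq> x'"
proof
  assume x: "x = x'"
  have on: "on_curve E P" using P by (simp add: order15_def)
  note pw = point_pow_simps[OF d on]
  have w: "weierstrass_eval E x y = 0" "weierstrass_eval E x y' = 0" using pw(1)[of m] pw(1)[of n] m n x by simp_all
  from same_x[OF w] show False
  proof
    assume "Affine x y = Affine x y'"
    then have e: "P [^]\<^bsub>MW E\<^esub> m = P [^]\<^bsub>MW E\<^esub> n" using m n x by simp
    have "P [^]\<^bsub>MW E\<^esub> m = point_add E (P [^]\<^bsub>MW E\<^esub> n) (P [^]\<^bsub>MW E\<^esub> (m - n))"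
      using pw(3)[of n "m - n"] ne by simp
    then have "P [^]\<^bsub>MW E\<^esub> (m - n) = point_add E (point_neg E (P [^]\<^bsub>MW E\<^esub> n)) (P [^]\<^bsub>MW E\<^esub> n)"
      using neg_add_cancel[OF d pw(1)[of n] pw(1)[of "m - n"]] e by simp
    then have "P [^]\<^bsub>MW E\<^esub> (m - n) = Infinity"
      using add_neg[of E] add_comm[OF d pw(1)[of n] neg_on_curve[OF pw(1)[of n]]] by simp
    then show False using P ne by (simp add: order15_def)
  next
    assume A: "Affine x y = point_neg E (Affine x y')"
    have "Affine x y' = point_neg E (Affine x y)"
      using arg_cong[OF A, of "point_neg E"] unfolding point_neg_neg by (rule sym)
    then have "point_add E (P [^]\<^bsub>MW E\<^esub> m) (P [^]\<^bsub>MW E\<^esub> n) = Infinity"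
      unfolding m n x[symmetric] by (metis add_neg)
    then show False using P ne pw(3)[of m n] by (simp add: order15_def)
  qed
qed

text \<open>Moving P to the origin and its tangent to the horizontal axis kills a6 and a4. Then a3
  \<noteq> 0 since 2 P \<noteq> 0, and a2 \<noteq> 0 since 3 P \<noteq> 0, so scaling by a3 / a2
  makes the two equal.\<close>

lemma tate_form_exists:
  fixes E :: "'a::field weierstrass"
  assumes d: "discriminant E \<noteq> 0" and P: "order15 E P"
  shows "\<exists>u r s t b c. admissible u r s t E (tate b c) \<and> order15 (tate b c) (Affine 0 0)"
proof -
  have on: "on_curve E P" using P by (simp add: order15_def)
  note pw = point_pow_simps[OF d on]
  have i: "P [^]\<^bsub>MW E\<^esub> n \<noteq> Infinity" if "\<not> 15 dvd n" for n :: nat using P that by (simp add: order15_def)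
  obtain x y where Pxy: "P = Affine x y" using i[of 1] pw(2) by (cases P) auto
  have w: "weierstrass_eval E x y = 0" using on Pxy by simp
  have "point_add E P P \<noteq> Infinity" using i[of 2] pw(3)[of 1 1] unfolding pw(2) one_add_one by simp
  then have "\<not> (x = x \<and> y = - y - a1 E * x - a3 E)" using Pxy add_neg_eq by auto
  from slope_exists[OF w w this] obtain l where l: "is_slope E l x y x y" by blast
  define E1 where "E1 = \<lparr> a1 = a1 E + 2 * l, a2 = a2 E - l * a1 E + 3 * x - l ^ 2,
     a3 = a3 E + x * a1 E + 2 * y,
     a4 = a4 E - l * a3 E + 2 * x * a2 E - (y + x * l) * a1 E + 3 * x ^ 2 - 2 * l * y,
     a6 = a6 E + x * a4 E + x ^ 2 * a2 E + x ^ 3 - y * a3 E - y ^ 2 - x * y * a1 E\<rparr>"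
  have ad: "admissible 1 x l y E E1" by (simp add: admissible_def E1_def)
  have d1: "discriminant E1 \<noteq> 0" using admissible_discriminant[OF ad] d by simp
  have P1: "order15 E1 (Affine 0 0)"
    by (rule order15_transfer[OF ad d1]) (use P Pxy in simp)
  have a6: "a6 E1 = 0" using P1 by (simp add: order15_def weierstrass_eval_def)
  have a4: "a4 E1 = 0" using l unfolding is_slope_def E1_def
    by (simp add: power2_eq_square algebra_simps)
  have on1: "on_curve E1 (Affine 0 0)" using P1 by (simp add: order15_def)
  note pw1 = point_pow_simps[OF d1 on1]
  have i1: "(Affine 0 0) [^]\<^bsub>MW E1\<^esub> n \<noteq> Infinity" if "\<not> 15 dvd n" for n :: nat using P1 that by (simp add: order15_def)
  have w1: "weierstrass_eval E1 0 0 = 0" using on1 by simp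
  have O2: "(Affine 0 0) [^]\<^bsub>MW E1\<^esub> (2::nat) = chord_sum E1 0 0 0 0"
    using pw1(3)[of 1 1] add_slope[OF d1 w1 w1, of 0] a4 unfolding pw1(2) one_add_one by (simp add: is_slope_def)
  have "(Affine 0 0) [^]\<^bsub>MW E1\<^esub> (2::nat) = Affine (- a2 E1) (a1 E1 * a2 E1 - a3 E1)"
    unfolding O2 by (simp add: chord_sum_def third_x_def)
  from order15_x_neq[OF d1 P1 this, of 1 0 0] have a2: "a2 E1 \<noteq> 0" using pw1(2) by simp
  have a3: "a3 E1 \<noteq> 0"
  proof
    assume "a3 E1 = 0"
    then have "point_add E1 (Affine 0 0) (Affine 0 0) = Infinity" by simp
    then show False using i1[of 2] pw1(3)[of 1 1] unfolding pw1(2) one_add_one by simp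
  qed
  define v where "v = a3 E1 / a2 E1"
  have v: "v \<noteq> 0" using a2 a3 by (simp add: v_def)
  define b c where "b = - (a2 E1 / v^2)" and "c = 1 - a1 E1 / v"
  have ad2: "admissible v 0 0 0 E1 (tate b c)"
  proof -
    have "v ^ 3 * (a2 E1 / v^2) = a3 E1" using a2 v by (simp add: power3_eq_cube power2_eq_square) (simp add: v_def)
    then show ?thesis using v a4 a6 by (simp add: admissible_def tate_sel b_def c_def)
  qed
  have d2: "discriminant (tate b c) \<noteq> 0" using admissible_discriminant[OF ad2] d1 by auto
  have "order15 (tate b c) (Affine 0 0)"
    by (rule order15_transfer[OF ad2 d2]) (use P1 in simp)
  then show ?thesis using admissible_trans[OF ad ad2] by blast
qed

lemma tate_step:
  fixes n :: nat
  assumes d: "discriminant (tate b c) \<noteq> 0" and P: "order15 (tate b c) (Affine 0 0)"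
    and n: "(Affine 0 0) [^]\<^bsub>MW (tate b c)\<^esub> n = Affine x y" and x: "x \<noteq> 0" and l: "l * x = y"
    and x': "x' = l^2 + (1-c)*l + b - x" and y': "y' = - (l + 1 - c) * x' + b"
  shows "(Affine 0 0) [^]\<^bsub>MW (tate b c)\<^esub> (Suc n) = Affine x' y'"
proof -
  have on: "on_curve (tate b c) (Affine 0 0)" using P by (simp add: order15_def)
  note pw = point_pow_simps[OF d on]
  have w: "weierstrass_eval (tate b c) x y = 0" "weierstrass_eval (tate b c) 0 0 = 0" using pw(1)[of n] n on by simp_all
  obtain k where k: "is_slope (tate b c) k x y 0 0"
    "point_add (tate b c) (Affine x y) (Affine 0 0) = chord_sum (tate b c) k x y 0"
    using slope_exists[OF w] x by auto
  have "k * x = l * x" using k(1) l by (simp add: is_slope_def)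
  then have "k = l" using x by simp
  have "(Affine 0 0) [^]\<^bsub>MW (tate b c)\<^esub> (Suc n) = chord_sum (tate b c) l x y 0"
    using pw(3)[of n 1] pw(2) n k(2) \<open>k = l\<close> by simp
  also have "\<dots> = Affine x' y'"
    unfolding chord_sum_def third_x_def tate_sel x' y' l[symmetric] by (simp add: algebra_simps)
  finally show ?thesis .
qed

text \<open>The multiples \<open>2 O, \<dots>, 6 O\<close> of \<open>O = (0, 0)\<close> in terms of \<open>r = b / c\<close> and \<open>s = c / (r - 1)\<close>;
  that \<open>4 O\<close>, \<open>5 O\<close> and \<open>6 O\<close> are collinear gives the equation of the modular curve.\<close>

lemma tate_order15:
  fixes b c :: "'a::field"
  assumes d: "discriminant (tate b c) \<noteq> 0" and P: "order15 (tate b c) (Affine 0 0)"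
  shows "\<exists>r s x y. c = s*(r-1) \<and> b = r*c \<and> r \<noteq> 0 \<and> s \<noteq> 0 \<and> r \<noteq> 1 \<and> s \<noteq> 1 \<and> r \<noteq> s \<and>
    x*(s-1)^2 = s*(r-1)*(r-s) \<and> (s-1)*y = - (s*(r-s)*x) - (1-c)*x*(s-1) + b*(s-1) \<and>
    (r*s*(s-1) - r*(r-1)) * (y - r^2*(r-1)*(s-1)) = (r*s^2*(r-s) - r^2*(r-1)*(s-1)) * (x - r*(r-1))"
proof -
  define Q where "Q n = (Affine 0 0) [^]\<^bsub>MW (tate b c)\<^esub> (n::nat)" for n
  have on: "on_curve (tate b c) (Affine 0 0)" using P by (simp add: order15_def)
  note pw = point_pow_simps[OF d on, folded Q_def]
  have i: "Q n \<noteq> Infinity" if "\<not> 15 dvd n" for n using P that by (simp add: order15_def Q_def)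
  note neq = order15_x_neq[OF d P, folded Q_def]
  note step = tate_step[OF d P, folded Q_def]
  have Q1: "Q 1 = Affine 0 0" by (rule pw(2))
  have w0: "weierstrass_eval (tate b c) 0 0 = 0" using on by simp
  have "Q 2 = point_add (tate b c) (Affine 0 0) (Affine 0 0)" using pw(3)[of 1 1] unfolding Q1 one_add_one .
  also have "\<dots> = chord_sum (tate b c) 0 0 0 0"
    by (rule add_slope[OF d w0 w0]) (simp add: is_slope_def tate_sel)
  also have "\<dots> = Affine b (b*c)" by (simp add: chord_sum_def third_x_def tate_sel algebra_simps)
  finally have Q2: "Q 2 = Affine b (b*c)" .
  \<comment> \<open>Here and below, b, c, r - 1, s - 1 and r - s are nonzero because the abscissa of
    n O differs from that of O for n = 2, 3, 4, 5, 6.\<close>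
  have b0: "b \<noteq> 0" using neq[OF Q2 Q1] by simp
  have "Q (Suc 2) = Affine c (b - c)"
    by (rule step[OF Q2 b0, of c]) (simp_all add: power2_eq_square algebra_simps)
  then have Q3: "Q 3 = Affine c (b - c)" by (simp add: eval_nat_numeral)
  have c0: "c \<noteq> 0" using neq[OF Q3 Q1] by simp
  define r where "r = b / c"
  have br: "b = r*c" using c0 by (simp add: r_def)
  have r0: "r \<noteq> 0" using b0 c0 by (simp add: r_def)
  have "Q (Suc 3) = Affine (r*(r-1)) (r^2*(c-r+1))"
    by (rule step[OF Q3 c0, of "r-1"]) (simp_all add: br power2_eq_square algebra_simps)
  then have Q4: "Q 4 = Affine (r*(r-1)) (r^2*(c-r+1))" by (simp add: eval_nat_numeral)
  have r1: "r \<noteq> 1" using neq[OF Q4 Q1] by simp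
  define s where "s = c / (r-1)"
  have cs: "c = s*(r-1)" using r1 by (simp add: s_def)
  have s0: "s \<noteq> 0" using c0 cs by auto
  have y4: "r^2*(c-r+1) = r^2*(r-1)*(s-1)" unfolding cs by (simp add: algebra_simps)
  have x4: "r*(r-1) \<noteq> 0" using r0 r1 by simp
  have "Q (Suc 4) = Affine (r*s*(s-1)) (r*s^2*(r-s))"
    by (rule step[OF Q4 x4, of "r*(s-1)"]) (simp_all add: br cs power2_eq_square algebra_simps)
  then have Q5: "Q 5 = Affine (r*s*(s-1)) (r*s^2*(r-s))" by (simp add: eval_nat_numeral)
  have s1: "s \<noteq> 1" using neq[OF Q5 Q1] by auto
  define l where "l = s*(r-s)/(s-1)"
  have l: "l*(s-1) = s*(r-s)" using s1 by (simp add: l_def)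
  have x5: "r*s*(s-1) \<noteq> 0" using r0 s0 s1 by simp
  have ly5: "l*(r*s*(s-1)) = r*s^2*(r-s)"
  proof -
    have "l*(r*s*(s-1)) = r*s*(l*(s-1))" by (simp add: algebra_simps)
    then show ?thesis unfolding l by (simp add: power2_eq_square algebra_simps)
  qed
  define x where "x = l^2 + (1-c)*l + b - r*s*(s-1)"
  define y where "y = - (l + 1 - c) * x + b"
  have "Q (Suc 5) = Affine x y" by (rule step[OF Q5 x5 ly5 x_def y_def])
  then have Q6: "Q 6 = Affine x y" by (simp add: eval_nat_numeral)
  have "x*(s-1)^2 = (l*(s-1))^2 + (1-c)*(l*(s-1))*(s-1) + (b - r*s*(s-1))*(s-1)^2"
    unfolding x_def by (simp add: power2_eq_square algebra_simps)
  also have "\<dots> = s*(r-1)*(r-s)" unfolding l br cs by (simp add: power2_eq_square algebra_simps)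
  finally have x6: "x*(s-1)^2 = s*(r-1)*(r-s)" .
  have "(s-1)*y = - ((l*(s-1))*x) - (1-c)*x*(s-1) + b*(s-1)"
    unfolding y_def by (simp add: algebra_simps)
  then have y6: "(s-1)*y = - (s*(r-s)*x) - (1-c)*x*(s-1) + b*(s-1)" unfolding l .
  have "x \<noteq> 0" using neq[OF Q6 Q1] by simp
  then have rs: "r \<noteq> s" using x6 s1 by auto
  have x45: "r*s*(s-1) \<noteq> r*(r-1)" using neq[OF Q5 Q4] by simp
  have w4: "weierstrass_eval (tate b c) (r*(r-1)) (r^2*(c-r+1)) = 0" using pw(1)[of 4] Q4 by simp
  have w5: "weierstrass_eval (tate b c) (r*s*(s-1)) (r*s^2*(r-s)) = 0" using pw(1)[of 5] Q5 by simp
  obtain k where k: "is_slope (tate b c) k (r*(r-1)) (r^2*(c-r+1)) (r*s*(s-1)) (r*s^2*(r-s))"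
    "point_add (tate b c) (Affine (r*(r-1)) (r^2*(c-r+1))) (Affine (r*s*(s-1)) (r*s^2*(r-s)))
      = chord_sum (tate b c) k (r*(r-1)) (r^2*(c-r+1)) (r*s*(s-1))"
    using slope_exists[OF w4 w5] x45 by metis
  \<comment> \<open>15 O = 0 enters as 9 O = -6 O, with 9 O computed as 4 O + 5 O.\<close>
  have "point_add (tate b c) (Q 6) (Q 9) = Infinity" using pw(3)[of 6 9, symmetric] P by (simp add: order15_def Q_def)
  then have "Q 9 = point_neg (tate b c) (Q 6)" using add_eq_Infinity_iff[OF pw(1) pw(1)] by blast
  moreover have "Q 9 = chord_sum (tate b c) k (r*(r-1)) (r^2*(c-r+1)) (r*s*(s-1))"
    using pw(3)[of 4 5] Q4 Q5 k(2) by simp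
  ultimately have ch: "chord_sum (tate b c) k (r*(r-1)) (r^2*(c-r+1)) (r*s*(s-1)) = point_neg (tate b c) (Affine x y)"
    using Q6 by simp
  have x3: "third_x (tate b c) k (r*(r-1)) (r*s*(s-1)) = x" using ch by (simp add: chord_sum_def)
  have "- (r^2*(c-r+1) + k*(x - r*(r-1))) - a1 (tate b c) * x - a3 (tate b c) = - y - a1 (tate b c) * x - a3 (tate b c)"
    using ch unfolding chord_sum_def Let_def x3 by simp
  then have ky: "r^2*(c-r+1) + k*(x - r*(r-1)) = y" by (simp only: diff_conv_add_uminus add_right_cancel neg_equal_iff_equal)
  have kk: "k*(r*s*(s-1) - r*(r-1)) = r*s^2*(r-s) - r^2*(c-r+1)" using k(1) by (simp add: is_slope_def)
  have "(r*s*(s-1) - r*(r-1)) * (y - r^2*(c-r+1)) = (k*(r*s*(s-1) - r*(r-1))) * (x - r*(r-1))"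
    unfolding ky[symmetric] by (simp add: algebra_simps)
  then have "(r*s*(s-1) - r*(r-1)) * (y - r^2*(r-1)*(s-1)) = (r*s^2*(r-s) - r^2*(r-1)*(s-1)) * (x - r*(r-1))"
    unfolding kk y4 .
  then show ?thesis using cs br r0 s0 r1 s1 rs x6 y6 by blast
qed

text \<open>Multiplying by powers of s - 1 eliminates x and y; the factor r s (r - 1) that splits
  off is nonzero.\<close>

lemma modular_equation:
  fixes r s x y b c :: "'a::field"
  assumes "c = s*(r-1)" "b = r*c" "r \<noteq> 0" "s \<noteq> 0" "r \<noteq> 1" "s \<noteq> 1"
    "x*(s-1)^2 = s*(r-1)*(r-s)" "(s-1)*y = - (s*(r-s)*x) - (1-c)*x*(s-1) + b*(s-1)"
    "(r*s*(s-1) - r*(r-1)) * (y - r^2*(r-1)*(s-1)) = (r*s^2*(r-s) - r^2*(r-1)*(s-1)) * (x - r*(r-1))"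
  shows "r^3 + r^2*(7*s^4 - s^5 - 18*s^3 + 19*s^2 - 10*s) + r*(4*s^4 - s^5 - 5*s^2 + 5*s)
    - s^5 + s^4 - s^3 + s^2 - s = 0"
proof -
  define m where "m = s - 1"
  define xx where "xx = s*(r-1)*(r-s)"
  have m: "s = m + 1" "m \<noteq> 0" using assms(6) by (simp_all add: m_def)
  have x: "x*m^2 = xx" unfolding xx_def m_def by (rule assms(7))
  define yy where "yy = - (s*(r-s)*xx) - (1-c)*xx*m + b*m*m^2"
  have "(y*m^3) = (m*y)*m^2" by (simp add: power2_eq_square power3_eq_cube)
  also have "m*y = - (s*(r-s)*x) - (1-c)*x*m + b*m" using assms(8) unfolding m_def .
  also have "(- (s*(r-s)*x) - (1-c)*x*m + b*m)*m^2 = - (s*(r-s)*(x*m^2)) - (1-c)*(x*m^2)*m + b*m*m^2"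
    by (simp add: algebra_simps)
  also have "\<dots> = yy" unfolding x yy_def ..
  finally have y: "y*m^3 = yy" .
  have "(r*s*m - r*(r-1)) * (yy - r^2*(r-1)*m*m^3) = ((r*s*m - r*(r-1)) * (y - r^2*(r-1)*m)) * m^3"
    unfolding y[symmetric] by (simp add: algebra_simps)
  also have "\<dots> = ((r*s^2*(r-s) - r^2*(r-1)*m) * (x - r*(r-1))) * m^3"
    using assms(9) unfolding m_def by simp
  also have "\<dots> = (r*s^2*(r-s) - r^2*(r-1)*m) * (x*m^2 - r*(r-1)*m^2) * m"
    by (simp add: power2_eq_square power3_eq_cube algebra_simps)
  finally have "(r*s*m - r*(r-1)) * (yy - r^2*(r-1)*m*m^3) - (r*s^2*(r-s) - r^2*(r-1)*m) * (xx - r*(r-1)*m^2) * m = 0"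
    unfolding x by simp
  moreover have "(r*s*m - r*(r-1)) * (yy - r^2*(r-1)*m*m^3) - (r*s^2*(r-s) - r^2*(r-1)*m) * (xx - r*(r-1)*m^2) * m
    = r*s*(r-1) * (r^3 + r^2*(7*s^4 - s^5 - 18*s^3 + 19*s^2 - 10*s) + r*(4*s^4 - s^5 - 5*s^2 + 5*s)
    - s^5 + s^4 - s^3 + s^2 - s)"
    unfolding yy_def xx_def assms(2) unfolding assms(1) m_def by Groebner_Basis.algebra
  ultimately show ?thesis using assms(3-5) by simp
qed

text \<open>The plane curve is singular at r = s = 1; two blow-ups, r = 1 + u (1 + u (z + 1)), split
  off u^6. With p = z / (u (z + 1)) the equation is quadratic in z, of discriminant (p - 1)^2 (p^4 -
  2 p^3 - p^2 - 2 p + 1). The variable x absorbs the square factor, and for y = - p x the relation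
  x^2 + (1 + p - p^2) x + p = 0 is the equation of J up to the factor - x.\<close>

lemma modular_parametrization:
  fixes r s :: "'a::field"
  assumes eq: "r^3 + r^2*(7*s^4 - s^5 - 18*s^3 + 19*s^2 - 10*s) + r*(4*s^4 - s^5 - 5*s^2 + 5*s)
    - s^5 + s^4 - s^3 + s^2 - s = 0" and s1: "s \<noteq> 1" and rs: "r \<noteq> s"
  shows "\<exists>u p z x. s = 1 + u \<and> r = 1 + u*(1 + u*(z+1)) \<and> p*(u*(z+1)) = z \<and> z + 1 \<noteq> 0 \<and> p \<noteq> 0 \<and> p \<noteq> 1 \<and>
    x*(p-1) = 1 - p - p^2 - z*p^3 \<and> (-p*x)^2 + x*(-p*x) + (-p*x) = x^3 + x^2 \<and> x \<noteq> 0"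
proof -
  define u where "u = s - 1"
  have s: "s = 1 + u" and u0: "u \<noteq> 0" using s1 by (simp_all add: u_def)
  define z where "z = ((r - 1)/u - 1)/u - 1"
  have r: "r = 1 + u*(1 + u*(z+1))" using u0 by (simp add: z_def field_simps)
  have z1: "z + 1 \<noteq> 0" using rs unfolding r s by auto
  have "u^6 * (z^3 + 2*u^2*z^2 - u^3*z^2 - 2*u^3*z + 2*u^2*z + u*z - u^3) = 0"
    using eq unfolding r s by Groebner_Basis.algebra
  then have e1: "z^3 + 2*u^2*z^2 - u^3*z^2 - 2*u^3*z + 2*u^2*z + u*z - u^3 = 0" using u0 by simp
  have z0: "z \<noteq> 0" using e1 u0 by auto
  define p where "p = z/(u*(z+1))"
  have p: "p*(u*(z+1)) = z" using u0 z1 by (simp add: p_def)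
  have p0: "p \<noteq> 0" using z0 u0 z1 by (simp add: p_def)
  have "p^3 * (z+1)^3 * (z^3 + 2*u^2*z^2 - u^3*z^2 - 2*u^3*z + 2*u^2*z + u*z - u^3)
     = z^3*p^3*(z+1)^3 + 2*(z^2+z)*(p*(u*(z+1)))^2*(p*(z+1)) - (z^2+2*z+1)*(p*(u*(z+1)))^3
       + z*(p*(u*(z+1)))*p^2*(z+1)^2"
    by Groebner_Basis.algebra
  also have "\<dots> = z^2 * (z+1)^2 * (z^2*p^3 + z*(p^3+2*p-1) + p^2)"
    unfolding p by Groebner_Basis.algebra
  finally have "p^3 * (z+1)^3 * (z^3 + 2*u^2*z^2 - u^3*z^2 - 2*u^3*z + 2*u^2*z + u*z - u^3)
     = z^2 * (z+1)^2 * (z^2*p^3 + z*(p^3+2*p-1) + p^2)" .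
  then have e2: "z^2*p^3 + z*(p^3+2*p-1) + p^2 = 0" using e1 z0 z1 by simp
  \<comment> \<open>p = 1 would give z = -1, that is r = s.\<close>
  have p1: "p \<noteq> 1"
  proof
    assume "p = 1"
    then have "(z+1)^2 = 0" using e2 by (simp add: power2_eq_square algebra_simps)
    then show False using z1 by simp
  qed
  define x where "x = (1 - p - p^2 - z*p^3)/(p-1)"
  have x: "x*(p-1) = 1 - p - p^2 - z*p^3" using p1 by (simp add: x_def)
  have "(x^2 + x*(1+p-p^2) + p)*(p-1)^2 = (x*(p-1))^2 + (x*(p-1))*(p-1)*(1+p-p^2) + p*(p-1)^2"
    by (simp add: power2_eq_square algebra_simps)
  also have "\<dots> = p^3 * (z^2*p^3 + z*(p^3+2*p-1) + p^2)" unfolding x by Groebner_Basis.algebra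
  finally have e3: "x^2 + x*(1+p-p^2) + p = 0" using e2 p1 by simp
  have x0: "x \<noteq> 0" using e3 p0 by auto
  have "(-p*x)^2 + x*(-p*x) + (-p*x) - (x^3 + x^2) = - x*(x^2 + x*(1+p-p^2) + p)"
    by (simp add: power2_eq_square power3_eq_cube algebra_simps)
  then have "(-p*x)^2 + x*(-p*x) + (-p*x) = x^3 + x^2" unfolding e3 by simp
  then show ?thesis using s r p z1 p0 p1 x x0 by blast
qed

section \<open>From points of J back to normal forms\<close>

lemma parameters_of_modular_point:
  fixes z u p x y :: "'a::field"
  assumes "x*(p-1) = 1 - p - p^2 - z*p^3" "p*(u*(z+1)) = z" "y = - p * x" "x \<noteq> 0" "p \<noteq> 0" "z + 1 \<noteq> 0"
  shows "p = - y / x" "z = (1 - p - p^2 - x*(p-1)) / p^3" "u = z / (p * (z + 1))"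
proof -
  show "p = - y / x" using assms by simp
  have "z * p^3 = 1 - p - p^2 - x*(p-1)" unfolding assms(1) by simp
  then show "z = (1 - p - p^2 - x*(p-1)) / p^3" using assms by (simp add: eq_divide_eq)
  have "u * (p * (z+1)) = z" using assms(2) by (simp add: ac_simps)
  then show "u = z / (p * (z + 1))" using assms by (simp add: eq_divide_eq)
qed

text \<open>E0 has eight points of order 15. A point and its negative have the same normal form, so
  the four pairs are those of E0 itself.\<close>

lemma tate_admissible_E0:
  assumes "(b, c) \<in> {(KF (-7/2) 0 (-11/2) 0, KF (1/2) 0 1 0), (KF 152 0 (-94) 0, KF 16 0 (-10) 0),
     (KF (-9) 0 (11/2) 0, KF (3/2) 0 (-1) 0), (KF 58 0 94 0, KF 6 0 10 0)}"
  shows "\<exists>u r s t. admissible u r s t (tate b c) E0"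
proof -
  have "admissible (KF (1/2) 0 1 0) (KF (-3/4) 0 (-1) 0) (KF 0 0 1 0) (KF (-3/4) 0 (-5/4) 0)
    (tate (KF (-7/2) 0 (-11/2) 0) (KF (1/2) 0 1 0)) E0"
    by (simp add: admissible_def tate_sel E0_sel kf_eq_iff power2_eq_square power3_eq_cube eval_nat_numeral)
  moreover have "admissible (KF (-3) 0 2 0) (KF 29 0 (-18) 0) (KF 6 0 (-4) 0) (KF 356 0 (-220) 0)
    (tate (KF 152 0 (-94) 0) (KF 16 0 (-10) 0)) E0"
    by (simp add: admissible_def tate_sel E0_sel kf_eq_iff power2_eq_square power3_eq_cube eval_nat_numeral)
  moreover have "admissible (KF (-3/2) 0 1 0) (KF (-7/4) 0 1 0) (KF (-1/2) 0 0 0) (KF (-71/8) 0 (11/2) 0)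
    (tate (KF (-9) 0 (11/2) 0) (KF (3/2) 0 (-1) 0)) E0"
    by (simp add: admissible_def tate_sel E0_sel kf_eq_iff power2_eq_square power3_eq_cube eval_nat_numeral)
  moreover have "admissible (KF 1 0 2 0) (KF 11 0 18 0) (KF 3 0 6 0) (KF 157 0 254 0)
    (tate (KF 58 0 94 0) (KF 6 0 10 0)) E0"
    by (simp add: admissible_def tate_sel E0_sel kf_eq_iff power2_eq_square power3_eq_cube eval_nat_numeral)
  ultimately show ?thesis using assms by (elim insertE emptyE Pair_inject; hypsubst; blast)
qed

lemma tate_parameters:
  fixes x y :: kf
  assumes xy: "(x, y) \<in> set J_points" "x \<noteq> 0"
    and par: "s = 1 + u" "r = 1 + u*(1 + u*(z+1))" "p*(u*(z+1)) = z" "z + 1 \<noteq> 0" "p \<noteq> 0"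
     "x*(p-1) = 1 - p - p^2 - z*p^3" "y = - p * x" and bc: "c = s*(r-1)" "b = r*c"
  shows "(b, c) \<in> {(KF (-7/2) 0 (-11/2) 0, KF (1/2) 0 1 0), (KF 152 0 (-94) 0, KF 16 0 (-10) 0),
     (KF (-9) 0 (11/2) 0, KF (3/2) 0 (-1) 0), (KF 58 0 94 0, KF 6 0 10 0)}"
proof -
  note e = parameters_of_modular_point[OF par(6,3,7) xy(2) par(5,4)]
  \<comment> \<open>Points with x = 0 or y = 0 are cusps; four points of the list remain.\<close>
  have "y \<noteq> 0" using par xy by simp
  then consider "x = KF 0 0 1 0" "y = KF 0 0 1 0" | "x = KF 0 0 1 0" "y = KF (-1) 0 (-2) 0"
    | "x = KF 1 0 (-1) 0" "y = KF 1 0 (-1) 0" | "x = KF 1 0 (-1) 0" "y = KF (-3) 0 2 0"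
    using xy unfolding J_points_def by (auto simp: KI_def kf_eq_iff)
  then show ?thesis
  proof cases
    case 1
    have p: "p = KF (-1) 0 0 0" unfolding e(1) 1 by (subst divide_eq_eq, simp add: kf_eq_iff)
    have z: "z = KF (-1) 0 (-2) 0" unfolding e(2) 1 p
      by (subst divide_eq_eq, simp add: kf_eq_iff eval_nat_numeral)
    have u: "u = KF (-1/2) 0 (-1/2) 0" unfolding e(3) z p by (subst divide_eq_eq, simp add: kf_eq_iff)
    show ?thesis unfolding bc par(1,2) u z by (simp add: kf_eq_iff)
  next
    case 2
    have p: "p = KF 1 0 1 0" unfolding e(1) 2 by (subst divide_eq_eq, simp add: kf_eq_iff)
    have z: "z = KF 1 0 (-1) 0" unfolding e(2) 2 p
      by (subst divide_eq_eq, simp add: kf_eq_iff eval_nat_numeral)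
    have u: "u = KF 1 0 (-1) 0" unfolding e(3) z p by (subst divide_eq_eq, simp add: kf_eq_iff)
    show ?thesis unfolding bc par(1,2) u z by (simp add: kf_eq_iff)
  next
    case 3
    have p: "p = KF (-1) 0 0 0" unfolding e(1) 3 by (subst divide_eq_eq, simp add: kf_eq_iff)
    have z: "z = KF (-3) 0 2 0" unfolding e(2) 3 p
      by (subst divide_eq_eq, simp add: kf_eq_iff eval_nat_numeral)
    have u: "u = KF (-1) 0 (1/2) 0" unfolding e(3) z p by (subst divide_eq_eq, simp add: kf_eq_iff)
    show ?thesis unfolding bc par(1,2) u z by (simp add: kf_eq_iff)
  next
    case 4
    have p: "p = KF 2 0 (-1) 0" unfolding e(1) 4 by (subst divide_eq_eq, simp add: kf_eq_iff)
    have z: "z = KF 0 0 1 0" unfolding e(2) 4 p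
      by (subst divide_eq_eq, simp add: kf_eq_iff eval_nat_numeral)
    have u: "u = KF 0 0 1 0" unfolding e(3) z p by (subst divide_eq_eq, simp add: kf_eq_iff)
    show ?thesis unfolding bc par(1,2) u z by (simp add: kf_eq_iff)
  qed
qed

theorem order15_admissible_E0:
  fixes E :: "kf weierstrass"
  assumes d: "discriminant E \<noteq> 0" and P: "order15 E P"
  shows "\<exists>u r s t. admissible u r s t E0 E"
proof -
  obtain u r s t b c where ad: "admissible u r s t E (tate b c)" and O: "order15 (tate b c) (Affine 0 0)"
    using tate_form_exists[OF d P] by blast
  have d': "discriminant (tate b c) \<noteq> 0" using admissible_discriminant[OF ad] d by auto
  obtain r' s' x y where rs: "c = s'*(r'-1)" "b = r'*c" "r' \<noteq> 0" "s' \<noteq> 0" "r' \<noteq> 1" "s' \<noteq> 1" "r' \<noteq> s'"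
    "x*(s'-1)^2 = s'*(r'-1)*(r'-s')" "(s'-1)*y = - (s'*(r'-s')*x) - (1-c)*x*(s'-1) + b*(s'-1)"
    "(r'*s'*(s'-1) - r'*(r'-1)) * (y - r'^2*(r'-1)*(s'-1)) = (r'*s'^2*(r'-s') - r'^2*(r'-1)*(s'-1)) * (x - r'*(r'-1))"
    using tate_order15[OF d' O] by blast
  obtain v p z w where v: "s' = 1 + v" "r' = 1 + v*(1 + v*(z+1))" "p*(v*(z+1)) = z" "z + 1 \<noteq> 0" "p \<noteq> 0"
    "w*(p-1) = 1 - p - p^2 - z*p^3" "(-p*w)^2 + w*(-p*w) + (-p*w) = w^3 + w^2" "w \<noteq> 0"
    using modular_parametrization[OF modular_equation[OF rs(1-6,8-10)] rs(6,7)] by blast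
  have "(w, -p*w) \<in> set J_points" by (rule J_rational_points) (use v(7) in \<open>simp add: J_eval\<close>)
  from tate_admissible_E0[OF tate_parameters[OF this v(8,1-6) refl rs(1,2)]]
  obtain u' r' s' t' where "admissible u' r' s' t' (tate b c) E0" by blast
  from admissible_sym[OF admissible_trans[OF ad this]] show ?thesis by blast
qed

section \<open>Transfer to the complex numbers\<close>

lemma torsion_subgroup_sel:
  "carrier (torsion_subgroup G) = {x \<in> carrier G. is_torsion G x}"
  "x \<otimes>\<^bsub>torsion_subgroup G\<^esub> y = x \<otimes>\<^bsub>G\<^esub> y" "\<one>\<^bsub>torsion_subgroup G\<^esub> = \<one>\<^bsub>G\<^esub>"
  "x [^]\<^bsub>torsion_subgroup G\<^esub> (n::nat) = x [^]\<^bsub>G\<^esub> n"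
  by (simp_all add: torsion_subgroup_def is_torsion_def nat_pow_def)

lemma torsion_subgroup_group:
  fixes G (structure)
  assumes "comm_group G"
  shows "group (torsion_subgroup G)"
proof -
  interpret comm_group G by fact
  have "subgroup {x \<in> carrier G. is_torsion G x} G"
    by (rule subgroupI) (auto intro: torsion_mult torsion_inv intro!: exI[of _ "\<one>"])
  from subgroup_imp_group[OF this] show ?thesis by (simp add: torsion_subgroup_def is_torsion_def)
qed

lemma iso_torsion_iff:
  assumes "group G" "group H" "f \<in> iso G H" "x \<in> carrier G"
  shows "is_torsion H (f x) \<longleftrightarrow> is_torsion G x"
proof -
  interpret group_hom G H f
    using assms by (simp add: group_hom_def group_hom_axioms_def iso_def)
  have "f y = \<one>\<^bsub>H\<^esub> \<longleftrightarrow> y = \<one>\<^bsub>G\<^esub>" if "y \<in> carrier G" for y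
    using inj_on_eq_iff[OF bij_betw_imp_inj_on that G.one_closed, of f] assms(3) hom_one by (simp add: iso_def)
  then show ?thesis using assms unfolding is_torsion_def by (simp add: hom_nat_pow[symmetric])
qed

lemma torsion_subgroup_iso:
  assumes "group G" "group H" and f: "f \<in> iso G H"
  shows "torsion_subgroup G \<cong> torsion_subgroup H"
proof -
  have b: "f \<in> hom G H" "bij_betw f (carrier G) (carrier H)" using f by (auto simp: iso_def)
  note t = iso_torsion_iff[OF assms]
  have "f ` carrier (torsion_subgroup G) = carrier (torsion_subgroup H)"
    using t bij_betw_imp_surj_on[OF b(2)] unfolding torsion_subgroup_sel by (auto simp: set_eq_iff image_iff) metis
  then have "bij_betw f (carrier (torsion_subgroup G)) (carrier (torsion_subgroup H))"
    using b(2) unfolding torsion_subgroup_sel bij_betw_def by (auto intro: inj_on_subset)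
  moreover have "f \<in> hom (torsion_subgroup G) (torsion_subgroup H)"
    using b(1) t unfolding hom_def torsion_subgroup_sel by auto
  ultimately show ?thesis unfolding is_iso_def iso_def by blast
qed

lemma abelian_rank_pos:
  fixes G (structure)
  assumes "comm_group G" and x: "x \<in> carrier G" "\<not> is_torsion G x"
  shows "abelian_rank G > 0"
proof -
  interpret comm_group G by fact
  have "k x = 0" if "(\<Otimes>\<^bsub>G\<^esub>y\<in>{x}. y [^]\<^bsub>G\<^esub> k y) = \<one>\<^bsub>G\<^esub>" for k :: "'a \<Rightarrow> int"
  proof (rule ccontr)
    assume k: "k x \<noteq> 0"
    have "x [^] k x = \<one>" using that x by simp
    then have "x [^] nat \<bar>k x\<bar> = \<one>"
    proof (cases "k x < 0")
      case True
      then have "inv (x [^] nat (- k x)) = \<one>" using \<open>x [^] k x = \<one>\<close> by (simp only: int_pow_def2 if_True)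
      then have "x [^] nat (- k x) = \<one>" using x by (simp only: inv_eq_1_iff nat_pow_closed)
      then show ?thesis using True by (simp only: abs_of_neg)
    next
      case False
      then have "x [^] nat (k x) = \<one>" using \<open>x [^] k x = \<one>\<close> by (simp only: int_pow_def2 if_False)
      then show ?thesis using False by (simp only: abs_of_nonneg not_less)
    qed
    moreover have "nat \<bar>k x\<bar> > 0" using k by simp
    ultimately show False using x(2) unfolding is_torsion_def by blast
  qed
  then have "int_independent G {x}" by (simp add: int_independent_def)
  then have "enat (card {x}) \<le> abelian_rank G"
    unfolding abelian_rank_def using x by (intro Sup_upper) blast
  moreover have "(0::enat) < enat (card {x})" by (simp add: zero_enat_def)
  ultimately show ?thesis by (rule less_le_trans[rotated])
qed

lemma order15_exists:
  fixes E :: "'a::field weierstrass"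
  assumes d: "discriminant E \<noteq> 0" and iso: "torsion_subgroup (MW E) \<cong> integer_mod_group 15"
  shows "\<exists>P. order15 E P"
proof -
  interpret G: comm_group "MW E" by (rule MW_comm_group[OF d])
  have gt: "group (torsion_subgroup (MW E))" by (rule torsion_subgroup_group) (rule MW_comm_group[OF d])
  have "integer_mod_group 15 \<cong> torsion_subgroup (MW E)" by (rule group.iso_sym[OF gt iso])
  then obtain f where f: "f \<in> iso (integer_mod_group 15) (torsion_subgroup (MW E))" by (auto simp: is_iso_def)
  interpret f: group_hom "integer_mod_group 15" "torsion_subgroup (MW E)" f
    using f gt by (simp add: group_hom_def group_hom_axioms_def iso_def)
  have inj: "inj_on f (carrier (integer_mod_group 15))" using f by (simp add: iso_def bij_betw_def)
  have one: "(1::int) \<in> carrier (integer_mod_group 15)" by simp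
  have "order15 E (f 1)"
    unfolding order15_def
  proof (intro conjI allI)
    show "on_curve E (f 1)" using f.hom_closed[OF one] by (simp add: torsion_subgroup_sel)
    fix n :: nat
    have "f 1 [^]\<^bsub>MW E\<^esub> n = f (int n mod 15)"
      using f.hom_nat_pow[OF one, of n] by (simp add: torsion_subgroup_sel)
    moreover have "f 0 = Infinity" using f.hom_one by (simp add: torsion_subgroup_sel)
    moreover have "f (int n mod 15) = f 0 \<longleftrightarrow> int n mod 15 = 0"
      using inj by (rule inj_on_eq_iff) (simp_all add: carrier_integer_mod_group)
    ultimately show "f 1 [^]\<^bsub>MW E\<^esub> n = Infinity \<longleftrightarrow> 15 dvd n" by presburger
  qed
  then show ?thesis ..
qed

lemma isomorphic_overI:
  fixes E E' :: "'a::field_char_0 weierstrass"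
  assumes "admissible u r s t E E'" "{u, r, s, t} \<subseteq> K"
  shows "isomorphic_over K E E'"
  unfolding isomorphic_over_def using assms admissible_eval[OF assms(1)] by (auto simp: admissible_def)

context field_hom
begin

lemma field_closed_range: "field_closed (range h)"
  unfolding field_closed_def
proof (intro conjI ballI)
  show "1 \<in> range h" using h_one by (metis rangeI)
  fix x assume x: "x \<in> range h"
  show "inverse x \<in> range h" using x by (force simp: h_one inverse_eq_divide h_divide[of 1, unfolded h_one, symmetric])
  fix y assume y: "y \<in> range h"
  show "x - y \<in> range h" using x y by (auto simp: h_diff[symmetric])
  show "x * y \<in> range h" using x y by (auto simp: h_mult[symmetric])
qed

lemma map_curve_coefficients: "{a1 (map_curve E), a2 (map_curve E), a3 (map_curve E), a4 (map_curve E), a6 (map_curve E)} \<subseteq> range h"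
  by (simp add: map_curve_sel)

lemma map_curve_exists:
  assumes "{a1 E, a2 E, a3 E, a4 E, a6 E} \<subseteq> range h"
  shows "\<exists>E'. E = map_curve E'"
proof -
  obtain c1 c2 c3 c4 c6 where "a1 E = h c1" "a2 E = h c2" "a3 E = h c3" "a4 E = h c4" "a6 E = h c6"
    using assms by auto
  then have "E = map_curve \<lparr>a1 = c1, a2 = c2, a3 = c3, a4 = c4, a6 = c6\<rparr>" by (cases E) (simp add: map_curve_def)
  then show ?thesis by blast
qed

text \<open>Identifies the points over the abstract field with those over its image, which carries
  the results to a subset of the ambient field.\<close>

lemma map_point_iso: "map_point h \<in> iso (MW E) (mordell_weil_group (range h) (map_curve E))"
proof -
  have "P \<in> carrier (mordell_weil_group (range h) (map_curve E)) \<longleftrightarrow> P \<in> map_point h ` carrier (MW E)" for P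
  proof (cases P)
    case Infinity
    have "map_point h Infinity \<in> map_point h ` carrier (MW E)" by (rule imageI) simp
    then show ?thesis unfolding Infinity by (simp add: mw_carrier)
  next
    case (Affine x y)
    show ?thesis
    proof
      assume P: "P \<in> carrier (mordell_weil_group (range h) (map_curve E))"
      then obtain x' y' where "x = h x'" "y = h y'" using Affine by (auto simp: mw_carrier)
      then have e: "P = map_point h (Affine x' y')" using Affine by simp
      then have "on_curve E (Affine x' y')" using P map_curve_on_curve unfolding mw_carrier by blast
      then show "P \<in> map_point h ` carrier (MW E)" unfolding e by (intro imageI) simp
    next
      assume "P \<in> map_point h ` carrier (MW E)"
      then obtain Q where Q: "P = map_point h Q" "on_curve E Q" by auto
      then show "P \<in> carrier (mordell_weil_group (range h) (map_curve E))"
        unfolding mw_carrier by (cases Q) (simp_all add: map_curve_on_curve map_curve_eval h_eq_0)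
    qed
  qed
  then have "map_point h ` carrier (MW E) = carrier (mordell_weil_group (range h) (map_curve E))" by blast
  moreover have "inj (map_point h)" by (rule point.inj_map) (simp add: inj_def h_eq)
  ultimately show ?thesis unfolding iso_def bij_betw_def hom_def
    by (auto simp: map_point_add intro: inj_on_subset)
qed

lemma map_curve_comm_group:
  "discriminant E \<noteq> 0 \<Longrightarrow> comm_group (mordell_weil_group (range h) (map_curve E))"
  by (rule mw_comm_group[OF field_closed_range map_curve_coefficients]) (simp add: map_curve_discriminant h_eq_0)

lemma map_curve_torsion_subgroup:
  assumes "discriminant E \<noteq> 0"
  shows "torsion_subgroup (MW E) \<cong> torsion_subgroup (mordell_weil_group (range h) (map_curve E))"
  using map_point_iso by (rule torsion_subgroup_iso[OF MW_group[OF assms] comm_group.axioms(2)[OF map_curve_comm_group[OF assms]]])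

lemma map_curve_admissible:
  "admissible u r s t E E' \<Longrightarrow> admissible (h u) (h r) (h s) (h t) (map_curve E) (map_curve E')"
  unfolding admissible_def map_curve_sel h_simps[symmetric] h_eq by (simp add: h_eq_0)

lemma map_curve_rank_pos:
  assumes d: "discriminant E \<noteq> 0" and P: "on_curve E P" "\<not> is_torsion (MW E) P"
  shows "abelian_rank (mordell_weil_group (range h) (map_curve E)) > 0"
proof (rule abelian_rank_pos[OF map_curve_comm_group[OF d]])
  note g = MW_group[OF d] comm_group.axioms(2)[OF map_curve_comm_group[OF d]] map_point_iso
  show "map_point h P \<in> carrier (mordell_weil_group (range h) (map_curve E))"
    using map_point_iso[of E] P unfolding iso_def hom_def by auto
  show "\<not> is_torsion (mordell_weil_group (range h) (map_curve E)) (map_point h P)"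
    using iso_torsion_iff[OF g] P by simp
qed

end

section \<open>The embedding into the complex numbers\<close>

definition kf_complex :: "kf \<Rightarrow> complex" where
  "kf_complex x = of_rat (k0 x) + of_rat (k1 x) * \<i> + (of_rat (k2 x) + of_rat (k3 x) * \<i>) * ((1 + of_real (sqrt 5)) / 2)"

interpretation kc: field_hom kf_complex
proof
  have phi: "((1 + of_real (sqrt 5)) / 2)^2 = (1 + of_real (sqrt 5)) / 2 + (1::complex)"
    by (simp add: power_divide power2_eq_square field_simps of_real_mult[symmetric] del: of_real_mult)
  fix x y
  show "kf_complex (x + y) = kf_complex x + kf_complex y"
    unfolding kf_complex_def plus_kf.simps of_rat_add by (simp only: distrib_left distrib_right ac_simps)
  have "(X0 + X1 * \<i> + (X2 + X3 * \<i>) * p) * (Y0 + Y1 * \<i> + (Y2 + Y3 * \<i>) * p) =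
     (X0*Y0 - X1*Y1 + X2*Y2 - X3*Y3) + (X0*Y1 + X1*Y0 + X2*Y3 + X3*Y2) * \<i> +
     ((X0*Y2 - X1*Y3 + X2*Y0 - X3*Y1 + X2*Y2 - X3*Y3) + (X0*Y3 + X1*Y2 + X2*Y1 + X3*Y0 + X2*Y3 + X3*Y2) * \<i>) * p"
    if "p^2 = p + 1" for p X0 X1 X2 X3 Y0 Y1 Y2 Y3 :: complex
    using that i_squared by Groebner_Basis.algebra
  from this[OF phi] show "kf_complex (x * y) = kf_complex x * kf_complex y"
    by (simp add: kf_complex_def of_rat_add of_rat_mult of_rat_diff)
  show "kf_complex 1 = 1" by (simp add: kf_complex_def)
qed

lemma ring_of_type_algebra_sel:
  "carrier (ring_of_type_algebra :: 'a::field ring) = UNIV"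
  "x \<oplus>\<^bsub>ring_of_type_algebra\<^esub> y = (x + y :: 'a)" "x \<otimes>\<^bsub>ring_of_type_algebra\<^esub> y = x * y"
  "\<zero>\<^bsub>ring_of_type_algebra\<^esub> = (0::'a)" "\<one>\<^bsub>ring_of_type_algebra\<^esub> = (1::'a)"
  by (simp_all add: ring_of_type_algebra_def)

lemma ring_of_type_algebra_inv:
  fixes x :: "'a::field"
  shows "\<ominus>\<^bsub>ring_of_type_algebra\<^esub> x = - x" "x \<noteq> 0 \<Longrightarrow> inv\<^bsub>ring_of_type_algebra\<^esub> x = inverse x"
proof -
  interpret R: Ring.field "ring_of_type_algebra :: 'a ring" by (rule field_from_type_algebra)
  show "\<ominus>\<^bsub>ring_of_type_algebra\<^esub> x = - x"
    by (rule R.minus_equality) (simp_all add: ring_of_type_algebra_sel)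
  show "x \<noteq> 0 \<Longrightarrow> inv\<^bsub>ring_of_type_algebra\<^esub> x = inverse x"
    by (rule R.comm_inv_char) (simp_all add: ring_of_type_algebra_sel)
qed

lemma field_closed_generate_field:
  "field_closed (generate_field (ring_of_type_algebra :: 'a::field ring) S)"
  unfolding field_closed_def
proof (intro conjI ballI)
  let ?G = "generate_field (ring_of_type_algebra :: 'a ring) S"
  note g = generate_field.intros[where R = "ring_of_type_algebra :: 'a ring" and H = S,
    unfolded ring_of_type_algebra_sel]
  show one: "1 \<in> ?G" by (rule g(1))
  fix x assume x: "x \<in> ?G"
  have m: "- z \<in> ?G" if "z \<in> ?G" for z using g(3)[OF that] by (simp add: ring_of_type_algebra_inv)
  show "inverse x \<in> ?G"
  proof (cases "x = 0")
    case True
    then show ?thesis using x by simp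
  next
    case False
    then show ?thesis using g(4)[OF x False] by (simp add: ring_of_type_algebra_inv)
  qed
  fix y assume y: "y \<in> ?G"
  show "x - y \<in> ?G" using g(5)[OF x m[OF y]] by simp
  show "x * y \<in> ?G" by (rule g(6)[OF x y])
qed

lemma generate_field_subset:
  fixes K :: "'a::field set"
  assumes K: "field_closed K" and S: "S \<subseteq> K"
  shows "generate_field ring_of_type_algebra S \<subseteq> K"
proof
  fix x assume "x \<in> generate_field ring_of_type_algebra S"
  then show "x \<in> K"
  proof induction
    case (m_inv z)
    then show ?case using K by (simp add: ring_of_type_algebra_sel ring_of_type_algebra_inv field_closed_def)
  qed (use S in \<open>auto simp: ring_of_type_algebra_sel ring_of_type_algebra_inv field_closed_simps[OF K]\<close>)
qed

lemma of_rat_field_closed: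
  fixes K :: "'a::field_char_0 set"
  assumes K: "field_closed K"
  shows "of_rat q \<in> K"
proof -
  have n: "of_nat n \<in> K" for n by (induction n) (simp_all add: field_closed_simps[OF K])
  have z: "of_int k \<in> K" for k
    by (cases k rule: int_cases2) (simp_all add: n field_closed_simps[OF K])
  obtain a b where "quotient_of q = (a, b)" by fastforce
  then have "of_rat q = (of_int a / of_int b :: 'a)" using quotient_of_div[of q] by (simp add: of_rat_divide)
  then show ?thesis by (simp add: z field_closed_simps[OF K])
qed

lemma range_kf_complex: "range kf_complex = QQ_i_sqrt5"
proof
  have K: "field_closed QQ_i_sqrt5" unfolding QQ_i_sqrt5_def by (rule field_closed_generate_field)
  have "\<i> \<in> QQ_i_sqrt5" "complex_of_real (sqrt 5) \<in> QQ_i_sqrt5"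
    unfolding QQ_i_sqrt5_def by (auto intro: generate_field.incl)
  then show "range kf_complex \<subseteq> QQ_i_sqrt5"
    by (auto simp: kf_complex_def of_rat_field_closed[OF K] field_closed_simps[OF K])
  have "\<i> = kf_complex (KF 0 1 0 0)" "complex_of_real (sqrt 5) = kf_complex (KF (-1) 0 2 0)"
    by (simp_all add: kf_complex_def)
  then have "{\<i>, complex_of_real (sqrt 5)} \<subseteq> range kf_complex" by blast
  then show "QQ_i_sqrt5 \<subseteq> range kf_complex"
    unfolding QQ_i_sqrt5_def by (rule generate_field_subset[OF kc.field_closed_range])
qed

lemma admissible_is_torsion:
  assumes ad: "admissible u r s t E E'" and d: "discriminant E' \<noteq> 0" and P: "on_curve E' P"
  shows "is_torsion (MW E) (old_point u r s t P) \<longleftrightarrow> is_torsion (MW E') P"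
proof -
  have "old_point u r s t Q = Infinity \<longleftrightarrow> Q = Infinity" for Q by (cases Q) simp_all
  then show ?thesis unfolding is_torsion_def using admissible_pow[OF ad d P] by (metis mw_simps(2))
qed

theorem theorem3p1:
  fixes K :: "complex set" and Z15_curves :: "complex weierstrass set"
  assumes "K = QQ_i_sqrt5"
    and "Z15_curves = {E. elliptic_curve_over K E \<and>
                          torsion_subgroup (mordell_weil_group K E) \<cong> integer_mod_group 15}"
  shows "(\<exists>E\<in>Z15_curves. \<forall>E'\<in>Z15_curves. isomorphic_over K E E') \<and>
         (\<forall>E\<in>Z15_curves. abelian_rank (mordell_weil_group K E) > 0)"
proof -
  have K: "K = range kf_complex" using assms(1) range_kf_complex by simp
  have E0: "kc.map_curve E0 \<in> Z15_curves"
  proof -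
    have "torsion_subgroup (mordell_weil_group K (kc.map_curve E0)) \<cong> torsion_subgroup (MW E0)"
      by (rule group.iso_sym[OF torsion_subgroup_group[OF MW_comm_group[OF E0_discriminant]]])
        (simp add: K kc.map_curve_torsion_subgroup[OF E0_discriminant])
    then have "torsion_subgroup (mordell_weil_group K (kc.map_curve E0)) \<cong> integer_mod_group 15"
      using E0_torsion_subgroup by (rule iso_trans)
    then show ?thesis using kc.map_curve_coefficients[of E0] E0_discriminant
      by (simp add: assms(2) elliptic_curve_over_def K kc.map_curve_discriminant kc.h_eq_0)
  qed
  \<comment> \<open>Both claims are read off from this: every curve in question comes from
    \<open>kf\<close>, has a point of order 15 there, and is therefore linked to E0 by a change of
    variables, along which the nontorsion point can be carried.\<close>
  have Z15: "\<exists>E u r s t. E' = kc.map_curve E \<and> discriminant E \<noteq> 0 \<and> admissible u r s t E0 E" if E': "E' \<in> Z15_curves" for E'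
  proof -
    have c: "{a1 E', a2 E', a3 E', a4 E', a6 E'} \<subseteq> range kf_complex" "discriminant E' \<noteq> 0"
      and t: "torsion_subgroup (mordell_weil_group K E') \<cong> integer_mod_group 15"
      using E' by (simp_all add: assms(2) elliptic_curve_over_def K)
    obtain E where E: "E' = kc.map_curve E" using kc.map_curve_exists[OF c(1)] by blast
    have d: "discriminant E \<noteq> 0" using c(2) by (simp add: E kc.map_curve_discriminant kc.h_eq_0)
    have "torsion_subgroup (MW E) \<cong> integer_mod_group 15"
      using iso_trans[OF kc.map_curve_torsion_subgroup[OF d]] t unfolding E K .
    then obtain P where "order15 E P" using order15_exists[OF d] by blast
    then show ?thesis using E d order15_admissible_E0[OF d] by blast
  qed
  have "isomorphic_over K (kc.map_curve E0) E'" if E': "E' \<in> Z15_curves" for E'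
  proof -
    obtain E u r s t where E: "E' = kc.map_curve E" "admissible u r s t E0 E" using Z15[OF E'] by blast
    show ?thesis unfolding E(1) K by (rule isomorphic_overI[OF kc.map_curve_admissible[OF E(2)]]) simp
  qed
  moreover have "abelian_rank (mordell_weil_group K E') > 0" if E': "E' \<in> Z15_curves" for E'
  proof -
    obtain E u r s t where E: "E' = kc.map_curve E" "discriminant E \<noteq> 0" "admissible u r s t E0 E" using Z15[OF E'] by blast
    obtain u' r' s' t' where ad: "admissible u' r' s' t' E E0" using admissible_sym[OF E(3)] by blast
    show ?thesis unfolding E(1) K
    proof (rule kc.map_curve_rank_pos[OF E(2)])
      show "on_curve E (old_point u' r' s' t' (Affine (KI (-5) 0 0 0) (KI 2 (-4) 0 8)))"
        by (simp only: old_point_on_curve[OF ad] E0_nontorsion(1))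
      show "\<not> is_torsion (MW E) (old_point u' r' s' t' (Affine (KI (-5) 0 0 0) (KI 2 (-4) 0 8)))"
        by (simp only: admissible_is_torsion[OF ad E0_discriminant E0_nontorsion(1)] E0_nontorsion(2) not_False_eq_True)
    qed
  qed
  ultimately show ?thesis using E0 by blast
qed

end
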